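(* Let $A$ and $B$ be Banach algebras and let $\phi:A\to B$ be a dense and completely relatively spectral morphism. Then $\phi$ induces an isomorphism $K_*(A)\simeq K_*(B)$ (that is, for $*=0,1$).
   Context: Algebras are complex and unital; morphisms are continuous unital algebra homomorphisms; subalgebras contain the unit. $\mathrm{sp}_A(a)$ denotes the spectrum of $a$ in $A$. A morphism $\phi:A\to B$ is dense if $\phi(A)$ is dense in $B$. It is spectral relative to a subalgebra $X\subseteq A$ if $\mathrm{sp}_B(\phi(x))=\mathrm{sp}_A(x)$ for all $x\in X$ (equivalently, for $x\in X$: $x$ is invertible in $A$ iff $\phi(x)$ is invertible in $B$). It is relatively spectral if it is spectral relative to some dense subalgebra of $A$. It is completely relatively spectral if for every $n\ge 1$ the amplified (entrywise) morphism $M_n(\phi):M_n(A)\to M_n(B)$ is relatively spectral. $K_0,K_1$ are the usual (topological) K-groups of Banach algebras. *)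

theory Defs
  imports
    "HOL-Analysis.Path_Connected"
    "HOL-Analysis.Function_Topology"
    "Jordan_Normal_Form.Matrix"
begin

section \<open>Complex unital Banach algebras\<close>

text \<open>The unit comes from \<^class>\<open>monoid_mult\<close> and not from \<^class>\<open>ring_1\<close> or
  \<^class>\<open>real_normed_algebra_1\<close>, so neither \<open>0 \<noteq> 1\<close> nor \<open>norm 1 = 1\<close> is imposed.\<close>

class complex_banach_algebra = real_normed_algebra + banach + monoid_mult +
  fixes scaleC :: "complex \<Rightarrow> 'a \<Rightarrow> 'a" (infixr \<open>*\<^sub>C\<close> 75)
  assumes scaleC_add_right: "c *\<^sub>C (x + y) = c *\<^sub>C x + c *\<^sub>C y"
    and scaleC_add_left: "(c + d) *\<^sub>C x = c *\<^sub>C x + d *\<^sub>C x"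
    and scaleC_scaleC: "c *\<^sub>C d *\<^sub>C x = (c * d) *\<^sub>C x"
    and scaleR_scaleC: "r *\<^sub>R x = complex_of_real r *\<^sub>C x"
    and mult_scaleC_left: "(c *\<^sub>C x) * y = c *\<^sub>C (x * y)"
    and mult_scaleC_right: "x * (c *\<^sub>C y) = c *\<^sub>C (x * y)"
    and norm_scaleC: "norm (c *\<^sub>C x) = cmod c * norm x"

definition morphism :: "('a::complex_banach_algebra \<Rightarrow> 'b::complex_banach_algebra) \<Rightarrow> bool" where
  "morphism \<phi> \<longleftrightarrow> continuous_on UNIV \<phi> \<and> \<phi> 1 = 1 \<and>
     (\<forall>x y. \<phi> (x + y) = \<phi> x + \<phi> y) \<and> (\<forall>x y. \<phi> (x * y) = \<phi> x * \<phi> y) \<and>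
     (\<forall>c x. \<phi> (c *\<^sub>C x) = c *\<^sub>C \<phi> x)"

definition dense_morphism :: "('a::complex_banach_algebra \<Rightarrow> 'b::complex_banach_algebra) \<Rightarrow> bool" where
  "dense_morphism \<phi> \<longleftrightarrow> closure (range \<phi>) = UNIV"


section \<open>Relatively spectral morphisms\<close>

text \<open>Complex algebras are represented here as \<^typ>\<open>(complex, 'a) module\<close> records, which carry
  both the ring operations and the scalar multiplication; the topology is passed separately.\<close>

definition spectrum :: "(complex, 'a) module \<Rightarrow> 'a \<Rightarrow> complex set" where
  "spectrum A a = {c. c \<odot>\<^bsub>A\<^esub> \<one>\<^bsub>A\<^esub> \<ominus>\<^bsub>A\<^esub> a \<notin> Units A}"

definition unital_subalgebra :: "'a set \<Rightarrow> (complex, 'a) module \<Rightarrow> bool" where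
  "unital_subalgebra X A \<longleftrightarrow> X \<subseteq> carrier A \<and> \<one>\<^bsub>A\<^esub> \<in> X \<and>
     (\<forall>x\<in>X. \<forall>y\<in>X. x \<oplus>\<^bsub>A\<^esub> y \<in> X \<and> x \<otimes>\<^bsub>A\<^esub> y \<in> X) \<and> (\<forall>c. \<forall>x\<in>X. c \<odot>\<^bsub>A\<^esub> x \<in> X)"

definition spectral_relative_to ::
    "'a set \<Rightarrow> (complex, 'a) module \<Rightarrow> (complex, 'b) module \<Rightarrow> ('a \<Rightarrow> 'b) \<Rightarrow> bool" where
  "spectral_relative_to X A B \<phi> \<longleftrightarrow> (\<forall>x\<in>X. spectrum B (\<phi> x) = spectrum A x)"

definition relatively_spectral ::
    "(complex, 'a) module \<Rightarrow> 'a topology \<Rightarrow> (complex, 'b) module \<Rightarrow> ('a \<Rightarrow> 'b) \<Rightarrow> bool" where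
  "relatively_spectral A T B \<phi> \<longleftrightarrow>
     (\<exists>X. unital_subalgebra X A \<and> T closure_of X = carrier A \<and> spectral_relative_to X A B \<phi>)"

text \<open>The matrix algebra \<open>M\<^sub>n(A)\<close>. Written out because \<^const>\<open>ring_mat\<close> requires
  \<^class>\<open>semiring_1\<close>.\<close>

definition mat_alg :: "nat \<Rightarrow> (complex, 'a::complex_banach_algebra mat) module" where
  "mat_alg n = \<lparr>carrier = carrier_mat n n, mult = (*), one = 1\<^sub>m n, zero = 0\<^sub>m n n, add = (+),
     smult = (\<lambda>c. map_mat (scaleC c))\<rparr>"

text \<open>The Banach algebra topology of \<open>M\<^sub>n(A)\<close> is the product topology on the \<open>n\<^sup>2\<close> entries.\<close>

definition mat_topology :: "nat \<Rightarrow> 'a::topological_space mat topology" where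
  "mat_topology n = pullback_topology (carrier_mat n n)
     (\<lambda>a. restrict (\<lambda>ij. a $$ ij) ({..<n} \<times> {..<n}))
     (product_topology (\<lambda>_. euclidean) ({..<n} \<times> {..<n}))"

definition completely_relatively_spectral ::
    "('a::complex_banach_algebra \<Rightarrow> 'b::complex_banach_algebra) \<Rightarrow> bool" where
  "completely_relatively_spectral \<phi> \<longleftrightarrow>
     (\<forall>n\<ge>1. relatively_spectral (mat_alg n) (mat_topology n) (mat_alg n) (map_mat \<phi>))"


section \<open>The group \<open>K\<^sub>0\<close>\<close>

definition block_sum :: "'a::zero mat \<Rightarrow> 'a mat \<Rightarrow> 'a mat" where
  "block_sum a b = four_block_mat a (0\<^sub>m (dim_row a) (dim_col b)) (0\<^sub>m (dim_row b) (dim_col a)) b"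

definition idempotents :: "'a::complex_banach_algebra mat set" where
  "idempotents = {e. (\<exists>n. e \<in> carrier_mat n n) \<and> e * e = e}"

text \<open>Algebraic (Murray--von Neumann) equivalence of idempotents of possibly different sizes:
  \<open>e = x y\<close> and \<open>f = y x\<close> with \<open>x\<close>, \<open>y\<close> rectangular.\<close>

definition idem_rel :: "('a::complex_banach_algebra mat \<times> 'a mat) set" where
  "idem_rel = {(e, f). e \<in> idempotents \<and> f \<in> idempotents \<and>
     (\<exists>x \<in> carrier_mat (dim_row e) (dim_row f). \<exists>y \<in> carrier_mat (dim_row f) (dim_row e).
        x * y = e \<and> y * x = f)}"

definition V_monoid :: "'a::complex_banach_algebra itself \<Rightarrow> 'a mat set monoid" where
  "V_monoid _ = \<lparr>carrier = idempotents // idem_rel,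
     mult = (\<lambda>P Q. \<Union>e\<in>P. \<Union>f\<in>Q. idem_rel `` {block_sum e f}),
     one = idem_rel `` {0\<^sub>m 0 0}\<rparr>"

definition V_map :: "('a::complex_banach_algebra \<Rightarrow> 'b::complex_banach_algebra) \<Rightarrow>
    'a mat set \<Rightarrow> 'b mat set" where
  "V_map \<phi> P = (\<Union>e\<in>P. idem_rel `` {map_mat \<phi> e})"

text \<open>Grothendieck group of a commutative monoid; the class of \<open>(x, y)\<close> is the formal difference
  of \<open>x\<close> and \<open>y\<close>.\<close>

definition groth_rel :: "('m, 'c) monoid_scheme \<Rightarrow> (('m \<times> 'm) \<times> ('m \<times> 'm)) set" where
  "groth_rel M = {((x, y), (x', y')). x \<in> carrier M \<and> y \<in> carrier M \<and>
     x' \<in> carrier M \<and> y' \<in> carrier M \<and>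
     (\<exists>z \<in> carrier M. x \<otimes>\<^bsub>M\<^esub> y' \<otimes>\<^bsub>M\<^esub> z = x' \<otimes>\<^bsub>M\<^esub> y \<otimes>\<^bsub>M\<^esub> z)}"

definition groth_group :: "('m, 'c) monoid_scheme \<Rightarrow> ('m \<times> 'm) set monoid" where
  "groth_group M = \<lparr>carrier = (carrier M \<times> carrier M) // groth_rel M,
     mult = (\<lambda>P Q. \<Union>(x, y)\<in>P. \<Union>(x', y')\<in>Q. groth_rel M `` {(x \<otimes>\<^bsub>M\<^esub> x', y \<otimes>\<^bsub>M\<^esub> y')}),
     one = groth_rel M `` {(\<one>\<^bsub>M\<^esub>, \<one>\<^bsub>M\<^esub>)}\<rparr>"

definition groth_map :: "('n, 'd) monoid_scheme \<Rightarrow> ('m \<Rightarrow> 'n) \<Rightarrow> ('m \<times> 'm) set \<Rightarrow> ('n \<times> 'n) set" where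
  "groth_map N f P = (\<Union>(x, y)\<in>P. groth_rel N `` {(f x, f y)})"

definition K0 :: "'a::complex_banach_algebra itself \<Rightarrow> ('a mat set \<times> 'a mat set) set monoid" where
  "K0 T = groth_group (V_monoid T)"

definition K0_map :: "('a::complex_banach_algebra \<Rightarrow> 'b::complex_banach_algebra) \<Rightarrow>
    ('a mat set \<times> 'a mat set) set \<Rightarrow> ('b mat set \<times> 'b mat set) set" where
  "K0_map \<phi> = groth_map (V_monoid TYPE('b)) (V_map \<phi>)"


section \<open>The group \<open>K\<^sub>1\<close>\<close>

text \<open>\<open>K\<^sub>1(A)\<close> is the direct limit of the groups \<open>\<pi>\<^sub>0(GL\<^sub>n(A))\<close> along \<open>u \<mapsto> u \<oplus> 1\<close>. Its elements
  are represented as classes of invertible matrices of arbitrary size.\<close>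

definition GL :: "nat \<Rightarrow> 'a::complex_banach_algebra mat set" where
  "GL n = Units (mat_alg n)"

definition GL_topology :: "nat \<Rightarrow> 'a::complex_banach_algebra mat topology" where
  "GL_topology n = subtopology (mat_topology n) (GL n)"

definition stabilize :: "nat \<Rightarrow> 'a::{zero,one} mat \<Rightarrow> 'a mat" where
  "stabilize k u = block_sum u (1\<^sub>m (k - dim_row u))"

definition K1_rel :: "('a::complex_banach_algebra mat \<times> 'a mat) set" where
  "K1_rel = {(u, v). u \<in> (\<Union>n. GL n) \<and> v \<in> (\<Union>n. GL n) \<and>
     (\<exists>k \<ge> max (dim_row u) (dim_row v).
        path_component_of (GL_topology k) (stabilize k u) (stabilize k v))}"

definition stable_mult :: "'a::complex_banach_algebra mat \<Rightarrow> 'a mat \<Rightarrow> 'a mat" where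
  "stable_mult u v = (let k = max (dim_row u) (dim_row v) in stabilize k u * stabilize k v)"

definition K1 :: "'a::complex_banach_algebra itself \<Rightarrow> 'a mat set monoid" where
  "K1 _ = \<lparr>carrier = (\<Union>n. GL n) // K1_rel,
     mult = (\<lambda>P Q. \<Union>u\<in>P. \<Union>v\<in>Q. K1_rel `` {stable_mult u v}),
     one = K1_rel `` {1\<^sub>m 0}\<rparr>"

definition K1_map :: "('a::complex_banach_algebra \<Rightarrow> 'b::complex_banach_algebra) \<Rightarrow>
    'a mat set \<Rightarrow> 'b mat set" where
  "K1_map \<phi> P = (\<Union>u\<in>P. K1_rel `` {map_mat \<phi> u})"

end

theory Submission
  imports Defs "HOL-Analysis.Homotopy" "HOL-Analysis.Complex_Transcendental"
    "HOL-Analysis.Bounded_Continuous_Function"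
begin

text \<open>If \<open>x\<close>, \<open>y\<close> lie in the dense subalgebra \<open>X\<close>, so does the segment between them; if the segment
  between \<open>\<phi> x\<close> and \<open>\<phi> y\<close> consists of invertible elements, the same is therefore true of the
  segment between \<open>x\<close> and \<open>y\<close>. Lifting paths piecewise in this way makes \<open>\<phi>\<close> a bijection on the path
  components of \<open>GL\<^sub>n\<close>, hence on \<open>K\<^sub>1\<close>. The argument works equally well for the elements whose
  spectrum avoids a fixed circle. Such an element has a Riesz projection, an idempotent that depends
  continuously on it, and nearby idempotents are similar; so \<open>\<phi>\<close> is a bijection on the similarity
  classes of idempotents in \<open>M\<^sub>n\<close>. Equivalent idempotents become similar after adding zero blocks,
  hence \<open>\<phi>\<close> is an isomorphism on the monoids of equivalence classes, and on \<open>K\<^sub>0\<close>.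

  To have norms and limits at hand for all \<open>n\<close> at once, \<open>M\<^sub>n(A)\<close> is realised as a closed
  subalgebra, with its own unit, of the bounded operators on the bounded sequences in \<open>A\<close>.\<close>


section \<open>Units in closed subalgebras\<close>

text \<open>Spectral invariance is known only on a dense subalgebra \<open>X\<close>, which need be
  neither open nor closed under inverses or limits, and elements with close images may be far apart
  in the source. Hence closeness is always measured in the target, where the good elements form an
  open set, and it is used through convexity: a straight segment in \<open>X\<close> has its image
  in any ball that contains the images of its endpoints. Idempotents do not form an open set; a gap
  in the spectrum is an open condition, which is why Riesz projections enter. An idempotent
  \<open>e\<close> is represented by \<open>2e\<close>: its spectrum lies in {0, 2} and is separated
  by the unit circle, and the projection for the inside of the circle is the complement 1 - e. In
  place of a contour integral, this projection is the limit of the inverses of 1 - x^(2^k), because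
  x^(2^k) tends to 0 on the inner part of the spectrum and to infinity on the outer part. These
  inverses arise from resolvents by averaging, so a morphism preserves them exactly. Spectral
  invariance is given for sizes n \<ge> 1; matrices of size 0 are therefore treated apart or
  enlarged.\<close>

text \<open>The ambient algebra is only a real one and need not have a unit: \<open>p\<close> is the unit of \<open>C\<close>, and \<open>cs c\<close>
  stands for the scalar multiple \<open>c p\<close>.\<close>

locale banach_subalg =
  fixes C :: "'k::{real_normed_algebra,banach} set" and p :: 'k and cs :: "complex \<Rightarrow> 'k"
  assumes closed_C: "closed C" and subspace_C: "subspace C"
    and mult_C: "\<And>x y. x \<in> C \<Longrightarrow> y \<in> C \<Longrightarrow> x * y \<in> C"
    and p_C: "p \<in> C"
    and p_left: "\<And>x. x \<in> C \<Longrightarrow> p * x = x" and p_right: "\<And>x. x \<in> C \<Longrightarrow> x * p = x"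
    and cs_C: "\<And>c. cs c \<in> C" and cs_one: "cs 1 = p"
    and cs_mult: "\<And>a b. cs (a * b) = cs a * cs b"
    and cs_comm: "\<And>c x. x \<in> C \<Longrightarrow> cs c * x = x * cs c"
    and cs_lin: "bounded_linear cs"
begin

lemma add_C: "x \<in> C \<Longrightarrow> y \<in> C \<Longrightarrow> x + y \<in> C"
  and diff_C: "x \<in> C \<Longrightarrow> y \<in> C \<Longrightarrow> x - y \<in> C"
  and scaleR_C: "x \<in> C \<Longrightarrow> r *\<^sub>R x \<in> C"
  and zero_C: "0 \<in> C"
  using subspace_C by (auto simp: subspace_add subspace_diff subspace_scale subspace_0)

lemmas C_intros = add_C diff_C scaleR_C zero_C mult_C p_C cs_C

definition U :: "'k set" where
  "U = {x \<in> C. \<exists>y\<in>C. x * y = p \<and> y * x = p}"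

definition uinv :: "'k \<Rightarrow> 'k" where
  "uinv x = (THE y. y \<in> C \<and> x * y = p \<and> y * x = p)"

lemma left_right_inverse_eq:
  assumes "x \<in> C" "y \<in> C" "z \<in> C" "y * x = p" "x * z = p"
  shows "y = z"
proof -
  have "y = y * (x * z)" using assms p_right by simp
  also have "\<dots> = (y * x) * z" by (simp only: mult.assoc)
  also have "\<dots> = z" using assms p_left by simp
  finally show ?thesis .
qed

lemma uinv_eqI:
  assumes "x \<in> C" "y \<in> C" "x * y = p" "y * x = p"
  shows "uinv x = y"
  unfolding uinv_def
  by (rule the_equality) (use assms left_right_inverse_eq in blast)+

lemma U_I: "x \<in> C \<Longrightarrow> y \<in> C \<Longrightarrow> x * y = p \<Longrightarrow> y * x = p \<Longrightarrow> x \<in> U"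
  unfolding U_def by blast

lemma U_inv:
  assumes "x \<in> U"
  shows "x \<in> C" "uinv x \<in> C" "x * uinv x = p" "uinv x * x = p" "uinv x \<in> U"
proof -
  obtain y where y: "x \<in> C" "y \<in> C" "x * y = p" "y * x = p" using assms unfolding U_def by blast
  moreover have "uinv x = y" by (rule uinv_eqI[OF y])
  ultimately show "x \<in> C" "uinv x \<in> C" "x * uinv x = p" "uinv x * x = p" "uinv x \<in> U"
    using U_I[of y x] by simp_all
qed

lemma U_mult:
  assumes "x \<in> U" "y \<in> U"
  shows "x * y \<in> U" "uinv (x * y) = uinv y * uinv x"
proof -
  note x = U_inv[OF assms(1)] and y = U_inv[OF assms(2)]
  have 1: "x * y * (uinv y * uinv x) = p"
    by (metis mult.assoc p_right x(1,3) y(3))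
  have 2: "uinv y * uinv x * (x * y) = p"
    by (metis mult.assoc p_left y(1,4) x(4))
  show "x * y \<in> U" "uinv (x * y) = uinv y * uinv x"
    using 1 2 x y by (auto intro!: U_I[of _ "uinv y * uinv x"] uinv_eqI mult_C)
qed

text \<open>A one-sided inverse of \<open>p - h\<close> is the fixed point of the contraction \<open>y \<mapsto> p + h y\<close>,
  respectively \<open>y \<mapsto> p + y h\<close>.\<close>

lemma neumann:
  assumes h: "h \<in> C" "norm h < 1"
  shows "p - h \<in> U"
proof -
  have cC: "complete C" using closed_C by (simp add: complete_eq_closed)
  have "\<exists>!y. y \<in> C \<and> p + h * y = y"
  proof (rule Banach_fix[OF cC _ _ h(2)])
    show "C \<noteq> {}" using p_C by auto
    show "(\<lambda>y. p + h * y) ` C \<subseteq> C" using h by (auto intro!: C_intros)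
    fix x y
    have "dist (p + h * x) (p + h * y) = norm (h * (x - y))" by (simp add: dist_norm algebra_simps)
    also have "\<dots> \<le> norm h * dist x y" unfolding dist_norm by (rule norm_mult_ineq)
    finally show "dist (p + h * x) (p + h * y) \<le> norm h * dist x y" .
  qed simp
  then obtain y where y: "y \<in> C" "p + h * y = y" by auto
  have "\<exists>!y. y \<in> C \<and> p + y * h = y"
  proof (rule Banach_fix[OF cC _ _ h(2)])
    show "C \<noteq> {}" using p_C by auto
    show "(\<lambda>y. p + y * h) ` C \<subseteq> C" using h by (auto intro!: C_intros)
    fix x y
    have "dist (p + x * h) (p + y * h) = norm ((x - y) * h)" by (simp add: dist_norm algebra_simps)
    also have "\<dots> \<le> norm h * dist x y" unfolding dist_norm
      by (metis mult.commute norm_mult_ineq)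
    finally show "dist (p + x * h) (p + y * h) \<le> norm h * dist x y" .
  qed simp
  then obtain z where z: "z \<in> C" "p + z * h = z" by auto
  have 1: "(p - h) * y = p" using y by (simp add: left_diff_distrib p_left) (metis add_diff_cancel_right')
  have 2: "z * (p - h) = p" using z by (simp add: right_diff_distrib p_right) (metis add_diff_cancel_right')
  have "z = y" by (rule left_right_inverse_eq[of "p - h"]) (use 1 2 y z h in \<open>auto intro!: C_intros\<close>)
  with 1 2 y h show ?thesis by (auto intro!: U_I[of _ y] C_intros)
qed

text \<open>Factor \<open>y = x * (p - uinv x * (x - y))\<close> and apply \<open>neumann\<close>.
  The estimate rests on \<open>uinv y - uinv x = uinv y * (x - y) * uinv x\<close>.\<close>

lemma U_perturb:
  assumes x: "x \<in> U" and y: "y \<in> C" and le: "norm (uinv x) * norm (y - x) \<le> 1 / 2"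
  shows "y \<in> U" "norm (uinv y - uinv x) \<le> 2 * (norm (uinv x))\<^sup>2 * norm (y - x)"
proof -
  note xi = U_inv[OF x]
  have h: "uinv x * (x - y) \<in> C" using xi y by (auto intro!: C_intros)
  have "norm (uinv x * (x - y)) \<le> norm (uinv x) * norm (y - x)"
    by (metis norm_minus_commute norm_mult_ineq)
  with le have "norm (uinv x * (x - y)) < 1" by simp
  from neumann[OF h this] have "p - uinv x * (x - y) \<in> U" .
  from U_mult(1)[OF x this] have "x * (p - uinv x * (x - y)) \<in> U" .
  also have "x * (p - uinv x * (x - y)) = x * p - (x * uinv x) * (x - y)"
    by (simp only: right_diff_distrib mult.assoc)
  also have "\<dots> = y" using xi y by (simp add: p_right p_left diff_C)
  finally show yU: "y \<in> U" .
  note yi = U_inv[OF yU]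
  have eq: "uinv y - uinv x = uinv y * (x - y) * uinv x"
    using xi yi by (simp add: left_diff_distrib right_diff_distrib mult.assoc p_right)
       (simp add: p_left flip: mult.assoc)
  have n1: "norm (uinv y - uinv x) \<le> norm (uinv y) * norm (y - x) * norm (uinv x)"
    unfolding eq by (metis (no_types, lifting) mult_right_mono norm_ge_zero norm_minus_commute norm_mult_ineq order_trans)
  \<comment> \<open>The unknown \<open>norm (uinv y)\<close> reappears on the right with the factor
    1/2 and is absorbed; this is the reason for 1/2 in the hypothesis.\<close>
  have "norm (uinv y) \<le> norm (uinv x) + norm (uinv y - uinv x)" by norm
  also have "\<dots> \<le> norm (uinv x) + norm (uinv y) * (norm (uinv x) * norm (y - x))"
    using n1 by (simp add: mult_ac)
  also have "\<dots> \<le> norm (uinv x) + norm (uinv y) * (1 / 2)"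
    by (intro add_left_mono mult_left_mono le) simp
  finally have n2: "norm (uinv y) \<le> 2 * norm (uinv x)" by simp
  have "norm (uinv y - uinv x) \<le> norm (uinv y) * (norm (y - x) * norm (uinv x))"
    using n1 by (simp add: mult_ac)
  also have "\<dots> \<le> 2 * norm (uinv x) * (norm (y - x) * norm (uinv x))"
    by (intro mult_right_mono n2) simp
  finally show "norm (uinv y - uinv x) \<le> 2 * (norm (uinv x))\<^sup>2 * norm (y - x)"
    by (simp add: power2_eq_square mult_ac)
qed

text \<open>With a common bound \<open>M\<close>, the resolvents along the whole unit circle can be
  perturbed at once.\<close>

lemma U_perturb_bound:
  assumes x: "x \<in> U" and M: "norm (uinv x) \<le> M" "0 < M"
    and y: "y \<in> C" and le: "norm (y - x) \<le> 1 / (2 * M)"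
  shows "y \<in> U" "norm (uinv y - uinv x) \<le> 2 * M\<^sup>2 * norm (y - x)"
proof -
  have "norm (uinv x) * norm (y - x) \<le> M * (1 / (2 * M))"
    using M le by (intro mult_mono) auto
  also have "\<dots> = 1 / 2" using M by simp
  finally have h: "norm (uinv x) * norm (y - x) \<le> 1 / 2" .
  show "y \<in> U" by (rule U_perturb(1)[OF x y h])
  have "norm (uinv y - uinv x) \<le> 2 * (norm (uinv x))\<^sup>2 * norm (y - x)" by (rule U_perturb(2)[OF x y h])
  also have "\<dots> \<le> 2 * M\<^sup>2 * norm (y - x)"
    using M by (intro mult_right_mono mult_left_mono power_mono) auto
  finally show "norm (uinv y - uinv x) \<le> 2 * M\<^sup>2 * norm (y - x)" .
qed

lemma U_open:
  assumes "x \<in> U"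
  obtains r where "r > 0" "ball x r \<inter> C \<subseteq> U"
proof
  \<comment> \<open>Adding 1 keeps the denominator positive even in the zero algebra, where
    \<open>uinv x = 0\<close>.\<close>
  let ?M = "norm (uinv x) + 1"
  have M: "?M > 0" by (simp add: add_nonneg_pos)
  show "1 / (2 * ?M) > 0" using M by simp
  show "ball x (1 / (2 * ?M)) \<inter> C \<subseteq> U"
    using U_perturb_bound(1)[OF assms, of ?M] M by (auto simp: dist_norm norm_minus_commute)
qed

lemma uinv_cont: "continuous_on U uinv"
  unfolding continuous_on_iff
proof (intro ballI allI impI)
  fix x and e :: real assume x: "x \<in> U" and e: "0 < e"
  let ?M = "norm (uinv x) + 1"
  have M: "?M > 0" by (simp add: add_nonneg_pos)
  let ?d = "min (1 / (2 * ?M)) (e / (2 * ?M\<^sup>2))"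
  show "\<exists>d>0. \<forall>x'\<in>U. dist x' x < d \<longrightarrow> dist (uinv x') (uinv x) < e"
  proof (intro exI[of _ ?d] conjI ballI impI)
    show "?d > 0" using M e by simp
    fix y assume y: "y \<in> U" "dist y x < ?d"
    have "norm (uinv y - uinv x) \<le> 2 * ?M\<^sup>2 * norm (y - x)"
      by (rule U_perturb_bound(2)[OF x]) (use y M U_inv(1) in \<open>auto simp: dist_norm\<close>)
    also have "\<dots> < 2 * ?M\<^sup>2 * (e / (2 * ?M\<^sup>2))"
      using y M by (intro mult_strict_left_mono) (auto simp: dist_norm)
    also have "\<dots> = e" using M by simp
    finally show "dist (uinv y) (uinv x) < e" by (simp add: dist_norm)
  qed
qed

end


section \<open>Riesz projections for the unit circle\<close>

context banach_subalg
begin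

lemmas cs_simps = linear_add[OF bounded_linear.linear[OF cs_lin]] linear_diff[OF bounded_linear.linear[OF cs_lin]]
  linear_neg[OF bounded_linear.linear[OF cs_lin]] linear_0[OF bounded_linear.linear[OF cs_lin]]

text \<open>The elements whose spectrum misses the unit circle: \<open>p - cs z * x\<close> is z
  times 1/z - x, and 1/z runs over the circle together with z.\<close>

definition D :: "'k set" where
  "D = {x \<in> C. \<forall>z. cmod z = 1 \<longrightarrow> p - cs z * x \<in> U}"

text \<open>\<open>res k x t\<close> is the inverse of \<open>p - e^(it) x^(2^k)\<close> (lemma \<open>res_inverse\<close>). The recursion exhibits it
  as an average of values of the resolvent over the \<open>2^k\<close>-th roots of \<open>e^(it)\<close>, that is, as a Riemann sum
  for the Riesz projection belonging to the part of the spectrum inside the unit circle.\<close>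

primrec res :: "nat \<Rightarrow> 'k \<Rightarrow> real \<Rightarrow> 'k" where
  "res 0 x t = uinv (p - cs (cis t) * x)"
| "res (Suc k) x t = (1/2) *\<^sub>R (res k x (t/2) + res k x (t/2 + pi))"

text \<open>The power x^(2^k), written without \<open>^\<close> since the ambient type carries no
  unit.\<close>

primrec sq :: "nat \<Rightarrow> 'k \<Rightarrow> 'k" where
  "sq 0 x = x"
| "sq (Suc k) x = sq k x * sq k x"

section \<open>Averages of resolvents over roots of unity\<close>

lemma sq_C: "x \<in> C \<Longrightarrow> sq k x \<in> C"
  by (induction k) (auto intro: mult_C)

text \<open>Partial fractions: 1/(1 - a^2) is the mean of 1/(1 - a) and 1/(1 + a), and also their
  product. The mean drives the recursion of \<open>res\<close>; the product makes the limit
  idempotent.\<close>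

lemma average_inverse:
  assumes a: "a \<in> C" and u: "u \<in> C" "(p - a) * u = p" "u * (p - a) = p"
    and v: "v \<in> C" "(p + a) * v = p" "v * (p + a) = p"
  shows "(p - a * a) * ((1/2) *\<^sub>R (u + v)) = p" "((1/2) *\<^sub>R (u + v)) * (p - a * a) = p"
    "u * v = (1/2) *\<^sub>R (u + v)"
proof -
  have f1: "p - a * a = (p + a) * (p - a)" and f2: "p - a * a = (p - a) * (p + a)"
    using a by (simp_all add: algebra_simps p_left p_right p_C)
  have pa: "p + a \<in> C" "p - a \<in> C" using a by (auto intro: C_intros)
  have 1: "(p - a * a) * u = p + a" unfolding f1 mult.assoc u using pa by (simp add: p_right)
  have 2: "(p - a * a) * v = p - a" unfolding f2 mult.assoc v using pa by (simp add: p_right)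
  have 3: "u * (p - a * a) = p + a" unfolding f2 mult.assoc[symmetric] u using pa by (simp add: p_left)
  have 4: "v * (p - a * a) = p - a" unfolding f1 mult.assoc[symmetric] v using pa by (simp add: p_left)
  have two: "(1/2) *\<^sub>R (p + a + (p - a)) = p" by (simp add: scaleR_2[symmetric])
  show A: "(p - a * a) * ((1/2) *\<^sub>R (u + v)) = p"
    using two by (simp only: mult_scaleR_right distrib_left 1 2)
  show "((1/2) *\<^sub>R (u + v)) * (p - a * a) = p"
    using two by (simp only: mult_scaleR_left distrib_right 3 4)
  have "u * v * (p - a * a) = u * (v * (p + a)) * (p - a)" unfolding f1 by (simp only: mult.assoc)
  also have "\<dots> = p" using u v by (simp add: p_right)
  finally have B: "u * v * (p - a * a) = p" .
  show "u * v = (1/2) *\<^sub>R (u + v)"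
    by (rule left_right_inverse_eq[OF _ _ _ B A]) (use a u v in \<open>auto intro!: C_intros\<close>)
qed

lemma cs_square:
  assumes "x \<in> C"
  shows "(cs c * x) * (cs c * x) = cs (c * c) * (x * x)"
proof -
  have "(cs c * x) * (cs c * x) = cs c * (x * cs c) * x" by (simp only: mult.assoc)
  also have "\<dots> = cs (c * c) * (x * x)" by (simp only: cs_comm[OF assms, symmetric] cs_mult mult.assoc)
  finally show ?thesis .
qed

lemma res_inverse:
  assumes "x \<in> D"
  shows "res k x t \<in> C \<and> (p - cs (cis t) * sq k x) * res k x t = p \<and>
    res k x t * (p - cs (cis t) * sq k x) = p"
proof (induction k arbitrary: t)
  case 0
  then show ?case using assms U_inv[of "p - cs (cis t) * x"] by (simp add: D_def)
next
  case (Suc k)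
  let ?a = "cs (cis (t/2)) * sq k x"
  have xC: "x \<in> C" using assms by (simp add: D_def)
  then have sC: "sq k x \<in> C" and a: "?a \<in> C" by (auto intro: sq_C mult_C cs_C)
  have sq: "?a * ?a = cs (cis t) * sq (Suc k) x"
    unfolding cs_square[OF sC] by (simp add: cis_mult)
  \<comment> \<open>The angles \<open>t/2\<close> and \<open>t/2 + pi\<close> give the two square
    roots of \<open>cis t\<close>, which differ by a sign.\<close>
  have "p - cs (cis (t/2 + pi)) * sq k x = p + ?a"
    by (simp add: cs_simps flip: cis_mult)
  with Suc[of "t/2"] Suc[of "t/2 + pi"]
  show ?case using average_inverse[OF a, of "res k x (t/2)" "res k x (t/2 + pi)"]
    unfolding res.simps sq[symmetric] by (auto intro!: add_C scaleR_C)
qed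

lemma res_mult:
  assumes "x \<in> D"
  shows "res (Suc k) x t = res k x (t/2) * res k x (t/2 + pi)"
proof -
  let ?a = "cs (cis (t/2)) * sq k x"
  have xC: "x \<in> C" using assms by (simp add: D_def)
  then have a: "?a \<in> C" by (auto intro: sq_C mult_C cs_C)
  have "p - cs (cis (t/2 + pi)) * sq k x = p + ?a"
    by (simp add: cs_simps flip: cis_mult)
  with res_inverse[OF assms, of k "t/2"] res_inverse[OF assms, of k "t/2 + pi"]
  show ?thesis using average_inverse(3)[OF a, of "res k x (t/2)" "res k x (t/2 + pi)"]
    by simp
qed

lemma res_unique:
  assumes "x \<in> D" "y \<in> C" "y * (p - cs (cis t) * sq k x) = p"
  shows "res k x t = y"
proof -
  have "p - cs (cis t) * sq k x \<in> C" using assms by (auto intro!: C_intros sq_C simp: D_def)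
  from left_right_inverse_eq[OF this, of y "res k x t"] show ?thesis
    using assms res_inverse[OF assms(1), of k t] by auto
qed

text \<open>Periodicity is hidden by the recursion, which halves the angle; it follows from the
  uniqueness of inverses.\<close>

lemma res_cis_cong:
  assumes "x \<in> D" "cis t = cis s"
  shows "res k x t = res k x s"
  using res_unique[OF assms(1), of "res k x s" t k] res_inverse[OF assms(1), of k s] assms(2) by simp

lemma res_C: "x \<in> D \<Longrightarrow> res k x t \<in> C"
  using res_inverse by blast

text \<open>Averaging does not enlarge errors. Every estimate on \<open>res 0\<close> climbs the
  recursion by this fact.\<close>

lemma norm_average_le:
  fixes a b c d :: 'k
  assumes "norm (a - c) \<le> e" "norm (b - d) \<le> e"
  shows "norm ((1/2) *\<^sub>R (a + b) - (1/2) *\<^sub>R (c + d)) \<le> e"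
proof -
  have "(1/2) *\<^sub>R (a + b) - (1/2) *\<^sub>R (c + d) = (1/2) *\<^sub>R ((a - c) + (b - d))"
    by (simp add: algebra_simps)
  then have "norm ((1/2) *\<^sub>R (a + b) - (1/2) *\<^sub>R (c + d)) = norm ((a - c) + (b - d)) / 2" by simp
  also have "\<dots> \<le> e" using assms norm_triangle_ineq[of "a - c" "b - d"] by linarith
  finally show ?thesis .
qed

lemma res_close:
  assumes "\<And>t. norm (res 0 x t - res 0 y t) \<le> e"
  shows "norm (res k x t - res k y t) \<le> e"
proof (induction k arbitrary: t)
  case (Suc k)
  then show ?case unfolding res.simps by (intro norm_average_le)
qed (rule assms)

text \<open>Each level halves differences of angles, so the modulus of continuity of
  \<open>res 0\<close> is stretched by 2 per level while the error \<open>e\<close> stays the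
  same.\<close>

lemma res_oscillation:
  assumes "\<And>t s. \<bar>t - s\<bar> \<le> d \<Longrightarrow> norm (res 0 x t - res 0 x s) \<le> e"
  shows "\<bar>t - s\<bar> \<le> 2 ^ k * d \<Longrightarrow> norm (res k x t - res k x s) \<le> e"
proof (induction k arbitrary: t s)
  case 0
  then show ?case using assms[of t s] by simp
next
  case (Suc k)
  have "\<bar>t/2 - s/2\<bar> \<le> 2 ^ k * d" "\<bar>t/2 + pi - (s/2 + pi)\<bar> \<le> 2 ^ k * d" using Suc.prems by auto
  with Suc.IH show ?case unfolding res.simps by (intro norm_average_le) blast+
qed

lemma cs_bound: obtains B where "B > 0" "\<And>c. norm (cs c) \<le> B * cmod c"
  using bounded_linear.pos_bounded[OF cs_lin] by (auto simp: mult.commute)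

lemma D_bound:
  assumes "x \<in> D"
  obtains M where "M > 0" "\<And>z. cmod z = 1 \<Longrightarrow> norm (uinv (p - cs z * x)) \<le> M"
proof -
  let ?f = "\<lambda>z. uinv (p - cs z * x)"
  have "continuous_on (sphere 0 1) (\<lambda>z. p - cs z * x)"
    by (intro continuous_intros bounded_linear.continuous_on[OF cs_lin])
  then have "continuous_on (sphere 0 1) ?f"
    by (rule continuous_on_compose2[OF uinv_cont]) (use assms in \<open>auto simp: D_def\<close>)
  then have "compact (?f ` sphere 0 1)" by (intro compact_continuous_image) auto
  then obtain M where "\<And>y. y \<in> ?f ` sphere 0 1 \<Longrightarrow> norm y \<le> M"
    using compact_imp_bounded bounded_iff by metis
  then have "\<And>z. cmod z = 1 \<Longrightarrow> norm (?f z) \<le> max M 1" by (simp add: le_max_iff_disj)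
  then show ?thesis by (intro that[of "max M 1"]) auto
qed

lemma res_equicontinuous:
  assumes x: "x \<in> D" and e: "e > 0"
  obtains d where "d > 0" "\<And>t s. \<bar>t - s\<bar> \<le> d \<Longrightarrow> norm (res 0 x t - res 0 x s) \<le> e"
proof -
  let ?f = "\<lambda>z. uinv (p - cs z * x)"
  have "continuous_on (sphere 0 1) (\<lambda>z. p - cs z * x)"
    by (intro continuous_intros bounded_linear.continuous_on[OF cs_lin])
  then have "continuous_on (sphere 0 1) ?f"
    by (rule continuous_on_compose2[OF uinv_cont]) (use x in \<open>auto simp: D_def\<close>)
  then have "uniformly_continuous_on (sphere 0 1) ?f" by (intro compact_uniformly_continuous) auto
  then obtain d where d: "d > 0"
    "\<And>z w. cmod z = 1 \<Longrightarrow> cmod w = 1 \<Longrightarrow> dist z w < d \<Longrightarrow> dist (?f z) (?f w) < e"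
    unfolding uniformly_continuous_on_def using e by (metis mem_sphere_0)
  have "isCont cis 0" unfolding cis_conv_exp by (intro continuous_intros)
  then obtain d' where d': "d' > 0" "\<And>t. dist t 0 < d' \<Longrightarrow> dist (cis t) (cis 0) < d"
    using d(1) unfolding continuous_at_eps_delta by metis
  have "dist (cis t) (cis s) < d" if "dist t s < d'" for t s
  proof -
    \<comment> \<open>Rotation invariance turns continuity of \<open>cis\<close> at 0 into uniform
      continuity.\<close>
    have "cis t - cis s = cis s * (cis (t - s) - 1)" by (simp add: algebra_simps cis_mult)
    then have "dist (cis t) (cis s) = dist (cis (t - s)) (cis 0)" by (simp add: dist_norm norm_mult)
    then show ?thesis using d'(2)[of "t - s"] that by (simp add: dist_norm)
  qed
  with d'(1) show ?thesis
    by (intro that[of "d'/2"]) (auto simp: dist_norm intro!: less_imp_le d(2)[unfolded dist_norm])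
qed

text \<open>Once \<open>2 ^ K * d\<close> reaches the period 2 pi, the stretched modulus of
  continuity covers all angles.\<close>

lemma res_nearly_constant:
  assumes x: "x \<in> D" and e: "e > 0"
  obtains K where "\<And>t s. norm (res K x t - res K x s) \<le> e"
proof -
  obtain d where d: "d > 0" "\<And>t s. \<bar>t - s\<bar> \<le> d \<Longrightarrow> norm (res 0 x t - res 0 x s) \<le> e"
    using res_equicontinuous[OF assms] by blast
  obtain K where "2 * pi / d < 2 ^ K" using real_arch_pow[of 2 "2 * pi / d"] by auto
  then have K: "2 * pi \<le> 2 ^ K * d" using d by (simp add: field_simps)
  have "norm (res K x t - res K x s) \<le> e" for t s
  proof -
    \<comment> \<open>Arbitrary angles are replaced by their representatives in the interval from
      -pi to pi, whose distance is at most 2 pi.\<close>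
    have "\<bar>Arg (cis t) - Arg (cis s)\<bar> \<le> 2 ^ K * d"
      using K Arg_bounded[of "cis t"] Arg_bounded[of "cis s"] by (auto simp: abs_if)
    from res_oscillation[OF d(2) this]
    have "norm (res K x (Arg (cis t)) - res K x (Arg (cis s))) \<le> e" by auto
    moreover have "res K x (Arg (cis t)) = res K x t" "res K x (Arg (cis s)) = res K x s"
      by (auto intro!: res_cis_cong x simp: cis_Arg sgn_if sgn_div_norm)
    ultimately show ?thesis by simp
  qed
  then show ?thesis by (rule that)
qed

text \<open>The Riesz projection for the open unit disc: the inverse of 1 - x^(2^k) tends to 1 on
  the part of the spectrum inside the circle and to 0 on the part outside.\<close>

definition proj :: "'k \<Rightarrow> 'k" where
  "proj x = lim (\<lambda>k. res k x 0)"

text \<open>Level \<open>K\<close> is nearly constant, and the later levels are averages of its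
  values, hence near the same constant.\<close>

lemma res_uniformly_Cauchy:
  assumes x: "x \<in> D" and e: "e > 0"
  obtains K where "\<And>j t s. j \<ge> K \<Longrightarrow> norm (res j x t - res K x s) \<le> e"
proof -
  obtain K where K: "\<And>t s. norm (res K x t - res K x s) \<le> e" using res_nearly_constant[OF assms] by blast
  have "norm (res j x t - res K x s) \<le> e" if "j \<ge> K" for j t s
    using that
  proof (induction j arbitrary: t rule: dec_induct)
    case (step n)
    \<comment> \<open>The constant is its own average, so that \<open>norm_average_le\<close>
      applies.\<close>
    have eq: "res K x s = (1/2) *\<^sub>R (res K x s + res K x s)" by (simp flip: scaleR_2)
    show ?case by (subst eq) (simp only: res.simps, intro norm_average_le step)
  qed (rule K)
  then show ?thesis by (rule that)
qed

text \<open>The limit is independent of the angle: late levels at \<open>t\<close> and at 0 are both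
  close to the same \<open>res K x s\<close>. Idempotency will use the angles 0 and pi
  together.\<close>

lemma res_tendsto:
  assumes x: "x \<in> D"
  shows "(\<lambda>k. res k x t) \<longlonglongrightarrow> proj x"
proof -
  have "Cauchy (\<lambda>k. res k x 0)"
  proof (rule metric_CauchyI)
    fix e :: real assume "0 < e"
    then obtain K where K: "\<And>j t s. j \<ge> K \<Longrightarrow> norm (res j x t - res K x s) \<le> e/3"
      using res_uniformly_Cauchy[OF x, of "e/3"] by auto
    have "dist (res m x 0) (res n x 0) < e" if "m \<ge> K" "n \<ge> K" for m n
      using K[OF that(1), of 0 0] K[OF that(2), of 0 0] \<open>0 < e\<close> by norm
    then show "\<exists>M. \<forall>m\<ge>M. \<forall>n\<ge>M. dist (res m x 0) (res n x 0) < e" by blast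
  qed
  then have lim: "(\<lambda>k. res k x 0) \<longlonglongrightarrow> proj x"
    unfolding proj_def by (simp add: Cauchy_convergent_iff convergent_LIMSEQ_iff)
  have "(\<lambda>k. res k x t - res k x 0) \<longlonglongrightarrow> 0"
  proof (rule LIMSEQ_I)
    fix e :: real assume "0 < e"
    then obtain K where K: "\<And>j t s. j \<ge> K \<Longrightarrow> norm (res j x t - res K x s) \<le> e/3"
      using res_uniformly_Cauchy[OF x, of "e/3"] by auto
    have "norm (res m x t - res m x 0 - 0) < e" if "m \<ge> K" for m
      using K[OF that(1), of 0 0] K[OF that(1), of t 0] \<open>0 < e\<close> by norm
    then show "\<exists>no. \<forall>n\<ge>no. norm (res n x t - res n x 0 - 0) < e" by blast
  qed
  from tendsto_add[OF this lim] show ?thesis by simp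
qed

text \<open>In the limit, the product formula \<open>res_mult\<close> at angle 0 reads P = P *
  P.\<close>

lemma proj_idem: "x \<in> D \<Longrightarrow> proj x * proj x = proj x"
proof -
  assume x: "x \<in> D"
  have "(\<lambda>k. res k x 0 * res k x pi) \<longlonglongrightarrow> proj x * proj x"
    by (intro tendsto_intros res_tendsto x)
  moreover have "(\<lambda>k. res k x 0 * res k x pi) = (\<lambda>k. res (Suc k) x 0)"
    by (subst res_mult[OF x]) simp
  moreover have "(\<lambda>k. res (Suc k) x 0) \<longlonglongrightarrow> proj x"
    using res_tendsto[OF x] by (rule LIMSEQ_Suc)
  ultimately show ?thesis by (simp add: LIMSEQ_unique)
qed

lemma proj_C: "x \<in> D \<Longrightarrow> proj x \<in> C"
  using closed_sequentially[OF closed_C _ res_tendsto] res_C by blast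

text \<open>By compactness the resolvents are bounded on the circle, so those of a nearby
  \<open>y\<close> are uniformly close; averaging and the limit keep the bound
  \<open>e\<close>.\<close>

lemma proj_perturb:
  assumes x: "x \<in> D" and e: "e > 0"
  obtains r where "r > 0" "\<And>y. y \<in> C \<Longrightarrow> dist y x < r \<Longrightarrow> y \<in> D \<and> norm (proj y - proj x) \<le> e"
proof -
  obtain M where M: "M > 0" "\<And>z. cmod z = 1 \<Longrightarrow> norm (uinv (p - cs z * x)) \<le> M"
    using D_bound[OF x] by blast
  obtain B where B: "B > 0" "\<And>c. norm (cs c) \<le> B * cmod c" using cs_bound by blast
  have xC: "x \<in> C" using x by (simp add: D_def)
  \<comment> \<open>\<open>B * r\<close> bounds the change of \<open>p - cs z * x\<close>. The first
    term makes \<open>U_perturb_bound\<close> applicable, the second bounds the change of the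
    inverse by \<open>e\<close>.\<close>
  define r where "r = min (1 / (2 * M) / B) (e / (2 * M\<^sup>2) / B)"
  have r: "r > 0" "B * r \<le> 1 / (2 * M)" "2 * M\<^sup>2 * (B * r) \<le> e" using M B e
    by (auto simp: r_def min_def field_simps)
  have "y \<in> D \<and> norm (proj y - proj x) \<le> e" if y: "y \<in> C" "dist y x < r" for y
  proof -
    have *: "p - cs z * y \<in> U \<and> norm (uinv (p - cs z * y) - uinv (p - cs z * x)) \<le> e"
      if z: "cmod z = 1" for z
    proof -
      have "norm (p - cs z * y - (p - cs z * x)) = norm (cs z * (y - x))"
        by (simp add: algebra_simps norm_minus_commute)
      also have "\<dots> \<le> norm (cs z) * norm (y - x)" by (rule norm_mult_ineq)
      also have "\<dots> \<le> B * r" using B(2)[of z] z y B(1) r(1)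
        by (intro mult_mono) (auto simp: dist_norm)
      finally have n: "norm (p - cs z * y - (p - cs z * x)) \<le> B * r" .
      have U: "p - cs z * x \<in> U" using x z by (simp add: D_def)
      have yC: "p - cs z * y \<in> C" using y by (auto intro!: C_intros)
      note pert = U_perturb_bound[OF U M(2)[OF z] M(1) yC order_trans[OF n r(2)]]
      have "norm (uinv (p - cs z * y) - uinv (p - cs z * x)) \<le> 2 * M\<^sup>2 * (B * r)"
        using pert(2) mult_left_mono[OF n, of "2 * M\<^sup>2"] by simp
      with pert(1) r(3) show ?thesis by linarith
    qed
    have yD: "y \<in> D" using * y by (auto simp: D_def)
    have "norm (res k y 0 - res k x 0) \<le> e" for k
      by (rule res_close) (use * in simp)
    moreover have "(\<lambda>k. norm (res k y 0 - res k x 0)) \<longlonglongrightarrow> norm (proj y - proj x)"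
      by (intro tendsto_intros res_tendsto x yD)
    ultimately have "norm (proj y - proj x) \<le> e" by (intro LIMSEQ_le_const2) auto
    with yD show ?thesis by blast
  qed
  with r(1) show ?thesis by (rule that)
qed

text \<open>The product expands to 1 - (a + b - a b) e.\<close>

lemma p_plus_scaled_idempotent:
  assumes e: "e \<in> C" "e * e = e" and ab: "a + b = a * b"
  shows "(p - cs a * e) * (p - cs b * e) = p"
proof -
  have "(cs a * e) * (cs b * e) = cs a * (e * cs b) * e" by (simp only: mult.assoc)
  also have "\<dots> = cs a * cs b * (e * e)" by (simp only: cs_comm[OF e(1), symmetric] mult.assoc)
  also have "\<dots> = cs (a + b) * e" by (simp add: e ab cs_mult)
  finally have "(cs a * e) * (cs b * e) = cs (a + b) * e" .
  then show ?thesis using e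
    by (simp add: algebra_simps p_left p_right C_intros cs_simps)
qed

text \<open>The spectrum of \<open>2e\<close> lies in {0, 2}. Doubling moves 1 off the circle to the
  outside, so the point inside is 0, and its projection is the complement of
  \<open>e\<close>.\<close>

lemma double_idempotent:
  assumes e: "e \<in> C" "e * e = e"
  shows "2 *\<^sub>R e \<in> D" "proj (2 *\<^sub>R e) = p - e"
proof -
  have csR: "cs (of_real r) = r *\<^sub>R p" for r
    using linear_scale[OF bounded_linear.linear[OF cs_lin], of r 1] cs_one by (simp add: scaleR_conv_of_real)
  have dbl: "cs z * (2 *\<^sub>R e) = cs (2 * z) * e" for z
    using csR[of 2] e by (simp add: cs_mult p_left mult.assoc cs_comm C_intros p_C) 
  \<comment> \<open>\<open>a / (a - 1)\<close> is the solution b of a + b = a b.\<close>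
  have inverse: "(p - cs a * e) * (p - cs (a / (a - 1)) * e) = p \<and> (p - cs (a / (a - 1)) * e) * (p - cs a * e) = p"
    if "a \<noteq> 1" for a
  proof -
    have "a + a / (a - 1) = a * (a / (a - 1))" using that by (simp add: field_simps)
    then show ?thesis using p_plus_scaled_idempotent[OF e, of a "a / (a - 1)"]
        p_plus_scaled_idempotent[OF e, of "a / (a - 1)" a] by (simp add: add.commute mult.commute)
  qed
  show D: "2 *\<^sub>R e \<in> D"
    unfolding D_def
  proof (intro CollectI conjI allI impI)
    fix z assume "cmod z = 1"
    then have "cmod (2 * z) \<noteq> cmod 1" by (simp add: norm_mult)
    then have "2 * z \<noteq> 1" by metis
    from inverse[OF this] show "p - cs z * (2 *\<^sub>R e) \<in> U"
      unfolding dbl using e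
      by (intro U_I[of _ "p - cs (2 * z / (2 * z - 1)) * e"]) (auto intro!: C_intros)
  qed (use e in \<open>auto intro: scaleR_C\<close>)
  \<comment> \<open>The scalar in (2e)^(2^k) = 2^(2^k) e. It turns the inverse into an explicit
    combination of \<open>p\<close> and \<open>e\<close>.\<close>
  define m :: "nat \<Rightarrow> real" where "m k = 2 ^ (2 ^ k)" for k
  have sq: "sq k (2 *\<^sub>R e) = m k *\<^sub>R e" for k
    by (induction k) (simp_all add: m_def e power_add mult_2)
  have "res k (2 *\<^sub>R e) 0 = p - (m k / (m k - 1)) *\<^sub>R e" for k
  proof (rule res_unique[OF D])
    have "m k > 1" by (simp add: m_def one_less_power)
    then have "complex_of_real (m k) \<noteq> 1" by simp
    from inverse[OF this]
    have "(p - cs (of_real (m k / (m k - 1))) * e) * (p - cs (of_real (m k)) * e) = p" by simp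
    then show "(p - (m k / (m k - 1)) *\<^sub>R e) * (p - cs (cis 0) * sq k (2 *\<^sub>R e)) = p"
      unfolding csR using e by (simp add: sq cs_one p_left)
  qed (use e in \<open>auto intro!: C_intros\<close>)
  moreover have "(\<lambda>k. m k / (m k - 1)) \<longlonglongrightarrow> 1"
  proof -
    have "(\<lambda>k. (1/2 :: real) ^ (2 ^ k)) \<longlonglongrightarrow> 0"
      using LIMSEQ_subseq_LIMSEQ[OF LIMSEQ_power_zero[of "1/2 :: real"], of "\<lambda>k. 2 ^ k"]
      by (simp add: strict_mono_def o_def)
    then have "(\<lambda>k. 1 / (1 - (1/2 :: real) ^ (2 ^ k))) \<longlonglongrightarrow> 1 / (1 - 0)" by (intro tendsto_intros) auto
    moreover have "1 / (1 - (1/2 :: real) ^ (2 ^ k)) = m k / (m k - 1)" for k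
    proof -
      have "m k > 1" by (simp add: m_def one_less_power)
      moreover have "(1/2 :: real) ^ (2 ^ k) = 1 / m k" by (simp add: m_def power_one_over)
      ultimately show ?thesis by (simp add: field_simps)
    qed
    ultimately show ?thesis by simp
  qed
  then have "(\<lambda>k. p - (m k / (m k - 1)) *\<^sub>R e) \<longlonglongrightarrow> p - 1 *\<^sub>R e" by (intro tendsto_intros)
  ultimately show "proj (2 *\<^sub>R e) = p - e"
    using res_tendsto[OF D, of 0] by (simp add: LIMSEQ_unique)
qed

section \<open>Similarity of idempotents and its local constancy\<close>

definition sim :: "'k \<Rightarrow> 'k \<Rightarrow> bool" where
  "sim e f \<longleftrightarrow> (\<exists>z\<in>U. z * e = f * z)"

lemma sim_sym:
  assumes "sim e f" "e \<in> C" "f \<in> C"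
  shows "sim f e"
proof -
  obtain z where z: "z \<in> U" "z * e = f * z" using assms unfolding sim_def by blast
  note zi = U_inv[OF z(1)]
  have "uinv z * f = uinv z * (f * z) * uinv z" using zi assms(3) by (simp add: mult.assoc p_right)
  also have "\<dots> = (uinv z * z) * e * uinv z" unfolding z(2)[symmetric] by (simp only: mult.assoc)
  also have "\<dots> = e * uinv z" using zi assms by (simp add: p_left)
  finally show ?thesis unfolding sim_def using zi by blast
qed

lemma sim_trans:
  assumes "sim e f" "sim f g"
  shows "sim e g"
proof -
  obtain z where z: "z \<in> U" "z * e = f * z" using assms unfolding sim_def by blast
  obtain w where w: "w \<in> U" "w * f = g * w" using assms unfolding sim_def by blast
  have "w * z * e = g * (w * z)" using z w by (metis mult.assoc)
  then show ?thesis unfolding sim_def using U_mult(1)[OF w(1) z(1)] by blast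
qed

text \<open>Undoes the passage to complements that comes from
  \<open>proj (2 *\<^sub>R e) = p - e\<close>.\<close>

lemma sim_complement:
  assumes "sim e f"
  shows "sim (p - e) (p - f)"
proof -
  obtain z where z: "z \<in> U" "z * e = f * z" using assms unfolding sim_def by blast
  then have "z * (p - e) = (p - f) * z" using U_inv(1)[OF z(1)] by (simp add: algebra_simps p_left p_right)
  then show ?thesis unfolding sim_def using z by blast
qed

text \<open>The element f e + (1 - f)(1 - e) always intertwines \<open>e\<close> and
  \<open>f\<close>; it differs from 1 by (f - e)(1 - 2e), so it is invertible for \<open>f\<close>
  close to \<open>e\<close>.\<close>

lemma sim_near:
  assumes e: "e \<in> C" "e * e = e"
  obtains r where "r > 0" "\<And>f. f \<in> C \<Longrightarrow> f * f = f \<Longrightarrow> norm (f - e) \<le> r \<Longrightarrow> sim e f"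
proof -
  let ?M = "norm (p - 2 *\<^sub>R e) + 1"
  have M: "?M > 0" by (simp add: add_nonneg_pos)
  have "sim e f" if f: "f \<in> C" "f * f = f" "norm (f - e) \<le> 1 / (2 * ?M)" for f
  proof -
    let ?h = "(f - e) * (p - 2 *\<^sub>R e)"
    have "norm ?h \<le> norm (f - e) * norm (p - 2 *\<^sub>R e)" by (rule norm_mult_ineq)
    also have "\<dots> \<le> 1 / (2 * ?M) * ?M" using f by (intro mult_mono) auto
    also have "\<dots> < 1" using M by simp
    finally have n: "norm ?h < 1" .
    have hC: "?h \<in> C" using e f by (auto intro!: C_intros)
    let ?z = "f * e + (p - f) * (p - e)"
    have "p - ?h = ?z" using e f by (simp add: algebra_simps p_left p_right p_C scaleR_2)
    with neumann[OF hC n] have "?z \<in> U" by simp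
    moreover have "?z * e = f * ?z"
    proof -
      have 1: "(p - e) * e = 0" using e by (simp add: algebra_simps p_left)
      have 2: "f * (p - f) = 0" using f by (simp add: algebra_simps p_right)
      have "?z * e = f * (e * e) + (p - f) * ((p - e) * e)" by (simp only: distrib_right mult.assoc)
      also have "\<dots> = (f * f) * e + (f * (p - f)) * (p - e)" unfolding 1 2 e(2) f(2) by simp
      also have "\<dots> = f * ?z" by (simp only: distrib_left mult.assoc)
      finally show ?thesis .
    qed
    ultimately show ?thesis unfolding sim_def by blast
  qed
  then show ?thesis using M by (intro that[of "1 / (2 * ?M)"]) auto
qed

lemma proj_near_sim:
  assumes x: "x \<in> D"
  obtains r where "r > 0" "\<And>y. y \<in> C \<Longrightarrow> dist y x < r \<Longrightarrow> y \<in> D \<and> sim (proj x) (proj y)"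
proof -
  obtain e where e: "e > 0" "\<And>f. f \<in> C \<Longrightarrow> f * f = f \<Longrightarrow> norm (f - proj x) \<le> e \<Longrightarrow> sim (proj x) f"
    using sim_near[OF proj_C[OF x] proj_idem[OF x]] by blast
  obtain r where r: "r > 0" "\<And>y. y \<in> C \<Longrightarrow> dist y x < r \<Longrightarrow> y \<in> D \<and> norm (proj y - proj x) \<le> e"
    using proj_perturb[OF x e(1)] by blast
  show ?thesis by (rule that[OF r(1)]) (use r(2) e(2) proj_C proj_idem in blast)
qed

lemma D_subset_C: "D \<subseteq> C"
  by (auto simp: D_def)

text \<open>The similarity class of \<open>proj\<close> is locally constant on \<open>D\<close>, and
  a segment is connected.\<close>

lemma proj_segment_sim:
  assumes "closed_segment a b \<subseteq> D"
  shows "sim (proj a) (proj b)"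
proof (rule connected_equivalence_relation[of "closed_segment a b" a b "\<lambda>x y. sim (proj x) (proj y)"])
  show "\<exists>T. openin (top_of_set (closed_segment a b)) T \<and> x \<in> T \<and> (\<forall>y\<in>T. sim (proj x) (proj y))"
    if "x \<in> closed_segment a b" for x
  proof -
    have "x \<in> D" using that assms by blast
    then obtain r where r: "r > 0" "\<And>y. y \<in> C \<Longrightarrow> dist y x < r \<Longrightarrow> y \<in> D \<and> sim (proj x) (proj y)"
      using proj_near_sim by blast
    show ?thesis
      using that r assms D_subset_C
      by (intro exI[of _ "closed_segment a b \<inter> ball x r"]) (auto simp: dist_commute intro!: openin_open_Int)
  qed
  show "sim (proj y) (proj x)" if "sim (proj x) (proj y)" "x \<in> closed_segment a b" "y \<in> closed_segment a b" for x y
    using that assms by (intro sim_sym[OF that(1)]) (auto intro: proj_C)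
  show "sim (proj x) (proj z)" if "sim (proj x) (proj y)" "sim (proj y) (proj z)" for x y z
    using sim_trans that by blast
qed auto

end


section \<open>Lifting along relatively spectral homomorphisms\<close>

text \<open>The laws of \<open>\<Phi>\<close> are stated on \<open>C\<close> because the type also
  contains elements outside the algebra. The hypothesis \<open>spectral\<close> speaks of
  invertibility; since \<open>X\<close> contains \<open>p\<close> and is stable under scalars, it
  also applies to \<open>p - cs z * x\<close>.\<close>

locale relatively_spectral_hom =
  A: banach_subalg C p cs + B: banach_subalg C' p' cs'
  for C :: "'k::{real_normed_algebra,banach} set" and p cs
    and C' :: "'l::{real_normed_algebra,banach} set" and p' cs' +
  fixes \<Phi> :: "'k \<Rightarrow> 'l" and X :: "'k set"
  assumes \<Phi>_C: "\<And>x. x \<in> C \<Longrightarrow> \<Phi> x \<in> C'"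
    and \<Phi>_add: "\<And>x y. x \<in> C \<Longrightarrow> y \<in> C \<Longrightarrow> \<Phi> (x + y) = \<Phi> x + \<Phi> y"
    and \<Phi>_scaleR: "\<And>r x. x \<in> C \<Longrightarrow> \<Phi> (r *\<^sub>R x) = r *\<^sub>R \<Phi> x"
    and \<Phi>_mult: "\<And>x y. x \<in> C \<Longrightarrow> y \<in> C \<Longrightarrow> \<Phi> (x * y) = \<Phi> x * \<Phi> y"
    and \<Phi>_cs: "\<And>c. \<Phi> (cs c) = cs' c"
    and \<Phi>_cont: "continuous_on C \<Phi>"
    and X_C: "X \<subseteq> C" and subspace_X: "subspace X" and p_X: "p \<in> X"
    and cs_X: "\<And>c x. x \<in> X \<Longrightarrow> cs c * x \<in> X"
    and X_dense: "C \<subseteq> closure X" and range_dense: "C' \<subseteq> closure (\<Phi> ` C)"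
    and spectral: "\<And>x. x \<in> X \<Longrightarrow> \<Phi> x \<in> B.U \<Longrightarrow> x \<in> A.U"
begin

lemma \<Phi>_p: "\<Phi> p = p'"
  using \<Phi>_cs[of 1] by (simp add: A.cs_one B.cs_one)

lemma \<Phi>_diff: "x \<in> C \<Longrightarrow> y \<in> C \<Longrightarrow> \<Phi> (x - y) = \<Phi> x - \<Phi> y"
  using \<Phi>_add[of "x - y" y] A.diff_C[of x y] by simp

lemma \<Phi>_U:
  assumes "x \<in> A.U"
  shows "\<Phi> x \<in> B.U" "\<Phi> (A.uinv x) = B.uinv (\<Phi> x)"
proof -
  note x = A.U_inv[OF assms]
  have *: "\<Phi> x * \<Phi> (A.uinv x) = p'" "\<Phi> (A.uinv x) * \<Phi> x = p'"
    using x \<Phi>_p by (simp_all flip: \<Phi>_mult)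
  show "\<Phi> x \<in> B.U" by (rule B.U_I[OF _ _ *]) (use x \<Phi>_C in auto)
  show "\<Phi> (A.uinv x) = B.uinv (\<Phi> x)" by (rule B.uinv_eqI[OF _ _ *, symmetric]) (use x \<Phi>_C in auto)
qed

lemma \<Phi>_resolvent: "x \<in> C \<Longrightarrow> \<Phi> (p - cs z * x) = p' - cs' z * \<Phi> x"
  by (simp add: \<Phi>_diff \<Phi>_mult \<Phi>_p \<Phi>_cs A.C_intros)

lemma \<Phi>_D: "x \<in> A.D \<Longrightarrow> \<Phi> x \<in> B.D"
  unfolding A.D_def B.D_def using \<Phi>_U(1) \<Phi>_C by (auto simp flip: \<Phi>_resolvent)

text \<open>All elements \<open>p - cs z * x\<close> lie in \<open>X\<close>, so
  \<open>spectral\<close> decides each of them.\<close>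

lemma spectral_D:
  assumes "x \<in> X" "\<Phi> x \<in> B.D"
  shows "x \<in> A.D"
proof -
  have xC: "x \<in> C" using assms X_C by auto
  have "p - cs z * x \<in> X" for z
    using assms(1) p_X cs_X subspace_X by (auto intro: subspace_diff)
  then show ?thesis using spectral assms(2) xC
    unfolding A.D_def B.D_def by (auto simp: \<Phi>_resolvent)
qed

lemma \<Phi>_res: "x \<in> A.D \<Longrightarrow> \<Phi> (A.res k x t) = B.res k (\<Phi> x) t"
proof (induction k arbitrary: t)
  case 0
  then have "x \<in> C" "p - cs (cis t) * x \<in> A.U" by (auto simp: A.D_def)
  then show ?case by (simp add: \<Phi>_U(2) \<Phi>_resolvent)
next
  case (Suc k)
  then show ?case by (simp add: \<Phi>_add \<Phi>_scaleR A.res_C A.C_intros)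
qed

text \<open>Both sides are limits of the averages \<open>res\<close>, which \<open>\<Phi>\<close>
  preserves exactly.\<close>

lemma \<Phi>_proj:
  assumes x: "x \<in> A.D"
  shows "\<Phi> (A.proj x) = B.proj (\<Phi> x)"
proof (rule LIMSEQ_unique)
  show "(\<lambda>k. \<Phi> (A.res k x 0)) \<longlonglongrightarrow> \<Phi> (A.proj x)"
    by (rule continuous_on_tendsto_compose[OF \<Phi>_cont A.res_tendsto[OF x] A.proj_C[OF x]])
      (simp add: A.res_C x)
  show "(\<lambda>k. \<Phi> (A.res k x 0)) \<longlonglongrightarrow> B.proj (\<Phi> x)"
    unfolding \<Phi>_res[OF x] by (rule B.res_tendsto[OF \<Phi>_D[OF x]])
qed

section \<open>Approximation and segments in the dense subspace\<close>

lemma dense_approximation: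
  assumes x: "x \<in> C" and "0 < e" "0 < d"
  obtains a where "a \<in> X" "dist a x < e" "dist (\<Phi> a) (\<Phi> x) < d"
proof -
  obtain r where r: "r > 0" "\<And>y. y \<in> C \<Longrightarrow> dist y x < r \<Longrightarrow> dist (\<Phi> y) (\<Phi> x) < d"
    using \<Phi>_cont x \<open>0 < d\<close> unfolding continuous_on_iff by metis
  have "min r e > 0" using r assms by simp
  moreover have "x \<in> closure X" using x X_dense by auto
  ultimately obtain a where "a \<in> X" "dist a x < min r e" unfolding closure_approachable by blast
  with r X_C that show ?thesis by auto
qed

text \<open>Density is used twice: for the range of \<open>\<Phi>\<close> and then for
  \<open>X\<close> in \<open>C\<close>, joined by continuity of \<open>\<Phi>\<close>.\<close>

lemma approximate_image:
  assumes y: "y \<in> C'" and "0 < d"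
  obtains a where "a \<in> X" "dist (\<Phi> a) y < d"
proof -
  have "y \<in> closure (\<Phi> ` C)" using y range_dense by auto
  then obtain x where x: "x \<in> C" "dist (\<Phi> x) y < d/2" unfolding closure_approachable
    using \<open>0 < d\<close> by (metis half_gt_zero imageE)
  obtain a where "a \<in> X" "dist (\<Phi> a) (\<Phi> x) < d/2"
    using dense_approximation[OF x(1), of "d/2" "d/2"] \<open>0 < d\<close> by auto
  with x show ?thesis by (intro that) (auto intro: dist_triangle_half_l simp: dist_commute)
qed

text \<open>\<open>X\<close> and balls are convex and \<open>\<Phi>\<close> is affine on segments.
  No closeness of \<open>a\<close> and \<open>b\<close> in the source is required; this lets
  conditions in the target be pulled back along the segment.\<close>

lemma image_segment_subset_ball:
  assumes "a \<in> X" "b \<in> X" "\<Phi> a \<in> ball y r" "\<Phi> b \<in> ball y r" "z \<in> closed_segment a b"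
  shows "z \<in> X" "\<Phi> z \<in> ball y r \<inter> C'"
proof -
  have cX: "closed_segment a b \<subseteq> X"
    by (rule closed_segment_subset) (use assms subspace_X in \<open>auto intro: subspace_imp_convex\<close>)
  then show zX: "z \<in> X" using assms by auto
  obtain u where u: "0 \<le> u" "u \<le> 1" "z = (1 - u) *\<^sub>R a + u *\<^sub>R b" using assms(5) by (auto simp: in_segment)
  have "\<Phi> z = (1 - u) *\<^sub>R \<Phi> a + u *\<^sub>R \<Phi> b"
    unfolding u using assms(1,2) X_C by (subst \<Phi>_add) (auto simp: subset_iff \<Phi>_scaleR intro!: A.C_intros)
  then have "\<Phi> z \<in> closed_segment (\<Phi> a) (\<Phi> b)" using u by (auto simp: in_segment)
  also have "\<dots> \<subseteq> ball y r" by (rule closed_segment_subset) (use assms in auto)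
  finally show "\<Phi> z \<in> ball y r \<inter> C'" using zX X_C \<Phi>_C by auto
qed

lemma segment_path_component:
  fixes a b :: "'z::real_normed_vector"
  shows "closed_segment a b \<subseteq> S \<Longrightarrow> path_component S a b"
  unfolding path_component_def by (intro exI[of _ "linepath a b"]) auto

lemma spectral_segment_path:
  assumes "a \<in> X" "b \<in> X" "\<Phi> a \<in> ball y r" "\<Phi> b \<in> ball y r" "ball y r \<inter> C' \<subseteq> B.U"
  shows "path_component A.U a b"
  using image_segment_subset_ball[OF assms(1-4)] assms(5) spectral
  by (intro segment_path_component) blast

section \<open>Path components of the units\<close>

lemma GL_surj:
  assumes v: "v \<in> B.U"
  obtains x where "x \<in> A.U" "path_component B.U (\<Phi> x) v"
proof -
  obtain r where r: "r > 0" "ball v r \<inter> C' \<subseteq> B.U" using B.U_open[OF v] by blast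
  obtain a where a: "a \<in> X" "dist (\<Phi> a) v < r" using approximate_image[OF B.U_inv(1)[OF v] r(1)] by blast
  have aC: "\<Phi> a \<in> C'" using a X_C \<Phi>_C by auto
  with a r have "\<Phi> a \<in> B.U" by (auto simp: dist_commute)
  then have "a \<in> A.U" using spectral a by blast
  moreover
  have "closed_segment (\<Phi> a) v \<subseteq> ball v r \<inter> C'"
    using a r aC B.U_inv(1)[OF v] B.subspace_C
    by (intro closed_segment_subset) (auto simp: dist_commute intro!: convex_Int intro: subspace_imp_convex)
  then have "path_component B.U (\<Phi> a) v" using r(2) by (intro segment_path_component) blast
  ultimately show ?thesis by (rule that)
qed

text \<open>Moves a unit into \<open>X\<close> inside its path component with arbitrarily small
  effect on the image, so that \<open>spectral\<close> becomes available.\<close>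

lemma near_unit:
  assumes u: "u \<in> A.U" and "d > 0"
  obtains a where "a \<in> X" "dist (\<Phi> a) (\<Phi> u) < d" "path_component A.U u a"
proof -
  obtain r where r: "r > 0" "ball u r \<inter> C \<subseteq> A.U" using A.U_open[OF u] by blast
  have uC: "u \<in> C" by (rule A.U_inv(1)[OF u])
  obtain a where a: "a \<in> X" "dist a u < r" "dist (\<Phi> a) (\<Phi> u) < d"
    using dense_approximation[OF uC r(1) \<open>d > 0\<close>] by blast
  have "closed_segment u a \<subseteq> ball u r \<inter> C"
    using a r uC X_C A.subspace_C
    by (intro closed_segment_subset) (auto simp: dist_commute intro!: convex_Int intro: subspace_imp_convex)
  then have "path_component A.U u a" using r(2) by (intro segment_path_component) blast
  with a show ?thesis by (intro that)
qed

text \<open>The path is not lifted as a function. Being approximable from the component of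
  \<open>u\<close> is propagated along its connected image, and each local move is realised by a
  segment in \<open>X\<close>.\<close>

lemma GL_inj:
  assumes u: "u \<in> A.U" and v: "v \<in> A.U" and path: "path_component B.U (\<Phi> u) (\<Phi> v)"
  shows "path_component A.U u v"
proof -
  obtain g where g: "path g" "path_image g \<subseteq> B.U" "pathstart g = \<Phi> u" "pathfinish g = \<Phi> v"
    using path unfolding path_component_def by blast
  \<comment> \<open>The quantifier over all \<open>e\<close> matters: the next move starts from an
    approximant that must fall into a ball not known beforehand.\<close>
  define P where "P y \<longleftrightarrow> (\<forall>e>0. \<exists>a\<in>X. dist (\<Phi> a) y < e \<and> path_component A.U u a)" for y
  have "P (\<Phi> v)"
  proof (rule connected_induction_simple[of "path_image g" "\<Phi> u"])
    show "connected (path_image g)" using g by (simp add: connected_path_image)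
    show "\<Phi> u \<in> path_image g" "\<Phi> v \<in> path_image g"
      using g pathstart_in_path_image[of g] pathfinish_in_path_image[of g] by simp_all
    show "P (\<Phi> u)" unfolding P_def using near_unit[OF u] by metis
    fix y assume y: "y \<in> path_image g"
    with g have "y \<in> B.U" by auto
    then obtain r where r: "r > 0" "ball y r \<inter> C' \<subseteq> B.U" using B.U_open by blast
    have step: "P w" if z: "z \<in> ball y r" "P z" and w: "w \<in> path_image g" "w \<in> ball y r" for z w
      unfolding P_def
    proof (intro allI impI)
      fix e :: real assume e: "e > 0"
      \<comment> \<open>This slack keeps \<open>\<Phi> a\<close> in the ball around
        \<open>y\<close>, although \<open>a\<close> is chosen near \<open>z\<close>.\<close>
      have "r - dist y z > 0" using z by simp
      with z(2) obtain a where a: "a \<in> X" "dist (\<Phi> a) z < r - dist y z" "path_component A.U u a"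
        unfolding P_def by blast
      have ra: "\<Phi> a \<in> ball y r" using a(2) dist_triangle[of y "\<Phi> a" z] by (simp add: dist_commute)
      have "w \<in> C'" using w g B.U_inv(1) by blast
      then obtain b where b: "b \<in> X" "dist (\<Phi> b) w < min e (r - dist y w)"
        using approximate_image[of w "min e (r - dist y w)"] e w by auto
      have rb: "\<Phi> b \<in> ball y r" using b(2) dist_triangle[of y "\<Phi> b" w] by (simp add: dist_commute)
      have "path_component A.U a b" by (rule spectral_segment_path[OF a(1) b(1) ra rb r(2)])
      from path_component_trans[OF a(3) this] b
      show "\<exists>a\<in>X. dist (\<Phi> a) w < e \<and> path_component A.U u a" by auto
    qed
    show "\<exists>T. openin (top_of_set (path_image g)) T \<and> y \<in> T \<and> (\<forall>z\<in>T. \<forall>w\<in>T. P z \<longrightarrow> P w)"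
    proof (intro exI[of _ "path_image g \<inter> ball y r"] conjI openin_open_Int ballI impI)
      show "y \<in> path_image g \<inter> ball y r" using y r(1) by simp
      show "P w" if "z \<in> path_image g \<inter> ball y r" "w \<in> path_image g \<inter> ball y r" "P z" for z w
        by (rule step[of z w]) (use that in blast)+
    qed simp
  qed
  \<comment> \<open>\<open>P\<close> gives only an element with image near \<open>\<Phi> v\<close>.
    A last segment joins it to an element of \<open>X\<close> in the component of
    \<open>v\<close>.\<close>
  obtain r where r: "r > 0" "ball (\<Phi> v) r \<inter> C' \<subseteq> B.U" using B.U_open[OF \<Phi>_U(1)[OF v]] by blast
  obtain a where a: "a \<in> X" "dist (\<Phi> a) (\<Phi> v) < r" "path_component A.U u a"
    using \<open>P (\<Phi> v)\<close> r(1) unfolding P_def by blast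
  obtain b where b: "b \<in> X" "dist (\<Phi> b) (\<Phi> v) < r" "path_component A.U v b"
    using near_unit[OF v r(1)] by blast
  have "path_component A.U a b"
    by (rule spectral_segment_path[OF a(1) b(1) _ _ r(2)]) (use a b in \<open>auto simp: dist_commute\<close>)
  from path_component_trans[OF path_component_trans[OF a(3) this] path_component_sym[OF b(3)]]
  show ?thesis .
qed

section \<open>Similarity classes of idempotents\<close>

text \<open>Approximate \<open>2f\<close> by \<open>\<Phi> a\<close> with \<open>a\<close> in
  \<open>X\<close>. The spectral gap is inherited by \<open>a\<close>, and the complement of its
  Riesz projection is the required idempotent.\<close>

lemma idem_surj:
  assumes f: "f \<in> C'" "f * f = f"
  obtains e where "e \<in> C" "e * e = e" "B.sim (\<Phi> e) f"
proof -
  note d = B.double_idempotent[OF f]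
  obtain r where r: "r > 0" "\<And>y. y \<in> C' \<Longrightarrow> dist y (2 *\<^sub>R f) < r \<Longrightarrow>
      y \<in> B.D \<and> B.sim (B.proj (2 *\<^sub>R f)) (B.proj y)"
    using B.proj_near_sim[OF d(1)] by blast
  obtain a where a: "a \<in> X" "dist (\<Phi> a) (2 *\<^sub>R f) < r"
    using approximate_image[OF B.scaleR_C[OF f(1)] r(1)] by blast
  then have aD: "\<Phi> a \<in> B.D" "B.sim (p' - f) (B.proj (\<Phi> a))"
    using r(2)[of "\<Phi> a"] X_C \<Phi>_C d(2) by auto
  then have a': "a \<in> A.D" using spectral_D a by blast
  let ?q = "A.proj a"
  have q: "?q \<in> C" "?q * ?q = ?q" using a' A.proj_C A.proj_idem by auto
  have "B.sim (p' - (p' - f)) (p' - \<Phi> ?q)" using B.sim_complement[OF aD(2)] \<Phi>_proj[OF a'] by simp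
  then have "B.sim (p' - \<Phi> ?q) f"
    using f q \<Phi>_C by (auto intro!: B.C_intros dest!: B.sim_sym)
  then have "B.sim (\<Phi> (p - ?q)) f" using q by (simp add: \<Phi>_diff A.p_C \<Phi>_p)
  moreover have "(p - ?q) * (p - ?q) = p - ?q"
    using q by (simp add: algebra_simps A.p_left A.p_right A.p_C)
  ultimately show ?thesis using q by (intro that[of "p - ?q"]) (auto intro!: A.C_intros)
qed

text \<open>Closeness is assumed only for the images. Elements of \<open>X\<close> near
  \<open>2e\<close> and near \<open>2f\<close> are joined by a segment with spectral gap, along
  which the Riesz projections stay similar.\<close>

lemma idem_near_inj:
  assumes f: "f \<in> C" "f * f = f"
  obtains r where "r > 0" "\<And>e. e \<in> C \<Longrightarrow> e * e = e \<Longrightarrow> dist (\<Phi> e) (\<Phi> f) < r \<Longrightarrow> A.sim e f"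
proof -
  have \<Phi>f: "\<Phi> f \<in> C'" "\<Phi> f * \<Phi> f = \<Phi> f" using f \<Phi>_C by (auto simp flip: \<Phi>_mult)
  obtain r where r: "r > 0" "\<And>y. y \<in> C' \<Longrightarrow> dist y (2 *\<^sub>R \<Phi> f) < r \<Longrightarrow> y \<in> B.D"
    using B.proj_near_sim[OF B.double_idempotent(1)[OF \<Phi>f]] by metis
  \<comment> \<open>The radius is \<open>r / 2\<close> because passing from \<open>e\<close> to
    \<open>2e\<close> doubles distances. The statement is used for \<open>e\<close> and again for
    \<open>f\<close> itself.\<close>
  have key: "\<exists>a\<in>X. A.sim (p - e) (A.proj a) \<and> A.proj a \<in> C \<and> \<Phi> a \<in> ball (2 *\<^sub>R \<Phi> f) r"
    if e: "e \<in> C" "e * e = e" "dist (\<Phi> e) (\<Phi> f) < r / 2" for e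
  proof -
    note d = A.double_idempotent[OF e(1,2)]
    obtain s where s: "s > 0" "\<And>y. y \<in> C \<Longrightarrow> dist y (2 *\<^sub>R e) < s \<Longrightarrow>
        y \<in> A.D \<and> A.sim (A.proj (2 *\<^sub>R e)) (A.proj y)"
      using A.proj_near_sim[OF d(1)] by blast
    have "dist (\<Phi> (2 *\<^sub>R e)) (2 *\<^sub>R \<Phi> f) < r"
      using e by (simp add: \<Phi>_scaleR dist_norm flip: scaleR_diff_right)
    then have "r - dist (\<Phi> (2 *\<^sub>R e)) (2 *\<^sub>R \<Phi> f) > 0" by simp
    from dense_approximation[OF A.scaleR_C[OF e(1)] s(1) this]
    obtain a where a: "a \<in> X" "dist a (2 *\<^sub>R e) < s"
      "dist (\<Phi> a) (\<Phi> (2 *\<^sub>R e)) < r - dist (\<Phi> (2 *\<^sub>R e)) (2 *\<^sub>R \<Phi> f)" by blast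
    have "\<Phi> a \<in> ball (2 *\<^sub>R \<Phi> f) r"
      using a(3) dist_triangle[of "\<Phi> a" "2 *\<^sub>R \<Phi> f" "\<Phi> (2 *\<^sub>R e)"] by (simp add: dist_commute)
    then show ?thesis using a s(2)[of a] X_C d(2) A.proj_C by auto
  qed
  have "A.sim e f" if e: "e \<in> C" "e * e = e" "dist (\<Phi> e) (\<Phi> f) < r / 2" for e
  proof -
    obtain a where a: "a \<in> X" "A.sim (p - e) (A.proj a)" "\<Phi> a \<in> ball (2 *\<^sub>R \<Phi> f) r"
      using key[OF e] by blast
    obtain b where b: "b \<in> X" "A.sim (p - f) (A.proj b)" "\<Phi> b \<in> ball (2 *\<^sub>R \<Phi> f) r" "A.proj b \<in> C"
      using key[OF f] r(1) by auto
    have "closed_segment a b \<subseteq> A.D"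
      using image_segment_subset_ball[OF a(1) b(1) a(3) b(3)] spectral_D r(2)
      by (auto simp: dist_commute)
    then have "A.sim (A.proj a) (A.proj b)" by (rule A.proj_segment_sim)
    moreover have "A.sim (A.proj b) (p - f)" using b f by (intro A.sim_sym[OF b(2)] A.C_intros)
    ultimately have "A.sim (p - e) (p - f)" using a(2) A.sim_trans by blast
    from A.sim_complement[OF this] show ?thesis by simp
  qed
  then show ?thesis using r(1) by (intro that[of "r / 2"]) auto
qed

text \<open>A similarity in the target is approximated by the image of some \<open>a\<close> in
  \<open>X\<close>, a unit of the source. Conjugating \<open>e\<close> by \<open>a\<close> brings
  its image close to \<open>\<Phi> f\<close>.\<close>

lemma idem_inj:
  assumes e: "e \<in> C" "e * e = e" and f: "f \<in> C" "f * f = f" and sim: "B.sim (\<Phi> e) (\<Phi> f)"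
  shows "A.sim e f"
proof -
  obtain r where r: "r > 0" "\<And>e. e \<in> C \<Longrightarrow> e * e = e \<Longrightarrow> dist (\<Phi> e) (\<Phi> f) < r \<Longrightarrow> A.sim e f"
    using idem_near_inj[OF f] by blast
  obtain z where z: "z \<in> B.U" "z * \<Phi> e = \<Phi> f * z" using sim unfolding B.sim_def by blast
  note zi = B.U_inv[OF z(1)]
  \<comment> \<open>Conjugation of \<open>\<Phi> e\<close>, continuous on the units, with value
    \<open>\<Phi> f\<close> at \<open>z\<close>.\<close>
  let ?h = "\<lambda>y. y * \<Phi> e * B.uinv y"
  have hz: "?h z = \<Phi> f" unfolding z(2) mult.assoc using zi \<Phi>_C[OF f(1)] by (simp add: B.p_right)
  have "continuous_on B.U ?h" by (intro continuous_intros B.uinv_cont)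
  then obtain d where d: "d > 0" "\<And>y. y \<in> B.U \<Longrightarrow> dist y z < d \<Longrightarrow> dist (?h y) (\<Phi> f) < r"
    unfolding continuous_on_iff hz[symmetric] using z(1) r(1) by metis
  obtain s where s: "s > 0" "ball z s \<inter> C' \<subseteq> B.U" using B.U_open[OF z(1)] by blast
  obtain a where a: "a \<in> X" "dist (\<Phi> a) z < min d s"
    using approximate_image[OF zi(1), of "min d s"] d s by auto
  have "\<Phi> a \<in> C'" using a X_C \<Phi>_C by blast
  with a s have \<Phi>aU: "\<Phi> a \<in> B.U" by (auto simp: dist_commute)
  then have aU: "a \<in> A.U" using spectral a by blast
  note ai = A.U_inv[OF aU]
  let ?e = "a * e * A.uinv a"
  have eC: "?e \<in> C" using ai e by (auto intro!: A.mult_C)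
  have c: "a * e = ?e * a" unfolding mult.assoc using ai e by (simp add: A.p_right)
  have "?e * ?e = a * e * (A.uinv a * a) * e * A.uinv a" by (simp only: mult.assoc)
  also have "\<dots> = a * (e * p * e) * A.uinv a" unfolding ai by (simp only: mult.assoc)
  also have "\<dots> = ?e" using e by (simp add: A.p_right)
  finally have idem: "?e * ?e = ?e" .
  have "\<Phi> ?e = ?h (\<Phi> a)" using ai e by (simp add: \<Phi>_mult A.mult_C \<Phi>_U(2)[OF aU])
  then have "A.sim ?e f" using r(2)[OF eC idem] d(2)[OF \<Phi>aU] a by simp
  moreover have "A.sim e ?e" unfolding A.sim_def using c aU by blast
  ultimately show ?thesis using A.sim_trans by blast
qed

end


section \<open>Matrix algebras as algebras of operators\<close>

text \<open>A copy of the bounded operators on which composition becomes \<open>*\<close>. No unit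
  is declared: over the zero space the identity operator equals 0.\<close>

typedef (overloaded) 'e opr = "UNIV :: ('e::real_normed_vector \<Rightarrow>\<^sub>L 'e) set"
  by simp

setup_lifting type_definition_opr

instantiation opr :: (real_normed_vector) real_vector
begin

lift_definition zero_opr :: "'a opr" is 0 .
lift_definition plus_opr :: "'a opr \<Rightarrow> 'a opr \<Rightarrow> 'a opr" is "(+)" .
lift_definition minus_opr :: "'a opr \<Rightarrow> 'a opr \<Rightarrow> 'a opr" is "(-)" .
lift_definition uminus_opr :: "'a opr \<Rightarrow> 'a opr" is uminus .
lift_definition scaleR_opr :: "real \<Rightarrow> 'a opr \<Rightarrow> 'a opr" is scaleR .

instance
  by standard (transfer; simp add: algebra_simps)+

end

instantiation opr :: (real_normed_vector) real_normed_algebra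
begin

lift_definition times_opr :: "'a opr \<Rightarrow> 'a opr \<Rightarrow> 'a opr" is blinfun_compose .
lift_definition norm_opr :: "'a opr \<Rightarrow> real" is norm .
definition dist_opr :: "'a opr \<Rightarrow> 'a opr \<Rightarrow> real" where "dist_opr x y = norm (x - y)"
definition sgn_opr :: "'a opr \<Rightarrow> 'a opr" where "sgn_opr x = x /\<^sub>R norm x"
definition uniformity_opr :: "('a opr \<times> 'a opr) filter" where
  "uniformity_opr = (INF e\<in>{0 <..}. principal {(x, y). dist x y < e})"
definition open_opr :: "'a opr set \<Rightarrow> bool" where
  "open_opr S = (\<forall>x\<in>S. \<forall>\<^sub>F (x', y) in uniformity. x' = x \<longrightarrow> y \<in> S)"

instance
proof
  fix a b c :: "'a opr" and r s :: real
  show "a * b * c = a * (b * c)" by transfer (rule blinfun_eqI, simp)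
  show "(a + b) * c = a * c + b * c" by transfer (rule blinfun_eqI, simp add: blinfun.bilinear_simps)
  show "a * (b + c) = a * b + a * c" by transfer (rule blinfun_eqI, simp add: blinfun.bilinear_simps)
  show "r *\<^sub>R a * b = r *\<^sub>R (a * b)" by transfer (rule blinfun_eqI, simp add: blinfun.bilinear_simps)
  show "a * r *\<^sub>R b = r *\<^sub>R (a * b)" by transfer (rule blinfun_eqI, simp add: blinfun.bilinear_simps)
  show "norm (r *\<^sub>R a) = \<bar>r\<bar> * norm a" by transfer simp
  show "norm a = 0 \<longleftrightarrow> a = 0" by transfer simp
  show "norm (a + b) \<le> norm a + norm b" by transfer (rule norm_triangle_ineq)
  show "norm (a * b) \<le> norm a * norm b" by transfer (rule norm_blinfun_compose)
qed (simp_all add: dist_opr_def sgn_opr_def uniformity_opr_def open_opr_def)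

end

instance opr :: (banach) banach
proof
  fix X :: "nat \<Rightarrow> 'a opr" assume "Cauchy X"
  then have "Cauchy (\<lambda>n. Rep_opr (X n))"
    unfolding Cauchy_def dist_norm by transfer
  then obtain L where "(\<lambda>n. Rep_opr (X n)) \<longlonglongrightarrow> L" by (auto simp: Cauchy_convergent_iff convergent_def)
  then have "X \<longlonglongrightarrow> Abs_opr L"
    unfolding LIMSEQ_iff by (simp add: norm_opr.rep_eq minus_opr.rep_eq Abs_opr_inverse)
  then show "convergent X" by (auto simp: convergent_def)
qed

text \<open>Completeness of \<^typ>\<open>'a \<Rightarrow>\<^sub>C 'b\<close> is available only over metric domains.\<close>

instantiation nat :: metric_space
begin

definition dist_nat :: "nat \<Rightarrow> nat \<Rightarrow> real" where "dist_nat m n = \<bar>real m - real n\<bar>"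
definition uniformity_nat :: "(nat \<times> nat) filter" where
  "uniformity_nat = (INF e\<in>{0 <..}. principal {(x, y). dist x y < e})"

instance
proof
  fix S :: "nat set"
  have "\<forall>\<^sub>F (x', y) in uniformity. x' = x \<longrightarrow> y \<in> S" if "x \<in> S" for x
  proof -
    have "\<forall>\<^sub>F z in principal {(x, y). dist x y < (1::real)}. (case z of (x', y) \<Rightarrow> x' = x \<longrightarrow> y \<in> S)"
    proof -
      have "m = n" if "\<bar>real m - real n\<bar> < 1" for m n using that by linarith
      with that show ?thesis by (auto simp: eventually_principal dist_nat_def)
    qed
    then show ?thesis unfolding uniformity_nat_def
      by (rule filter_leD[rotated]) (rule INF_lower, simp)
  qed
  then show "open S \<longleftrightarrow> (\<forall>x\<in>S. \<forall>\<^sub>F (x', y) in uniformity. x' = x \<longrightarrow> y \<in> S)"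
    by (simp add: open_discrete)
qed (auto simp: dist_nat_def uniformity_nat_def)

end

instance bcontfun :: (metric_space, banach) banach ..

section \<open>Matrix units acting on bounded sequences\<close>

lemma bcontfun_nat_finite_support:
  fixes a :: "'a::real_normed_vector"
  shows "(\<lambda>k::nat. if k = i then a else 0) \<in> bcontfun"
  by (rule bcontfun_normI[of _ "norm a"]) auto

definition delta :: "nat \<Rightarrow> 'a::real_normed_vector \<Rightarrow> (nat \<Rightarrow>\<^sub>C 'a)" where
  "delta i a = Bcontfun (\<lambda>k. if k = i then a else 0)"

lemma delta_apply: "apply_bcontfun (delta i a) k = (if k = i then a else 0)"
  by (simp add: delta_def Bcontfun_inverse bcontfun_nat_finite_support)

lemma norm_delta: "norm (delta i a) \<le> norm a"
  by (rule norm_bound) (simp add: delta_apply)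

lemma delta_linear: "delta i (a + b) = delta i a + delta i b" "delta i (r *\<^sub>R a) = r *\<^sub>R delta i a"
  by (auto intro!: bcontfun_eqI simp: delta_apply)

lemma bounded_linear_matrix_unit_action:
  "bounded_linear (\<lambda>f :: nat \<Rightarrow>\<^sub>C 'a. delta i (a * apply_bcontfun f j))"
  for a :: "'a::real_normed_algebra"
proof (rule bounded_linear_intro[of _ "norm a"])
  fix f g :: "nat \<Rightarrow>\<^sub>C 'a" and r
  show "delta i (a * apply_bcontfun (f + g) j) = delta i (a * apply_bcontfun f j) + delta i (a * apply_bcontfun g j)"
    by (simp add: delta_linear distrib_left)
  show "delta i (a * apply_bcontfun (r *\<^sub>R f) j) = r *\<^sub>R delta i (a * apply_bcontfun f j)"
    by (simp add: delta_linear)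
  have "norm (delta i (a * apply_bcontfun f j)) \<le> norm a * norm (apply_bcontfun f j)"
    using norm_delta norm_mult_ineq order_trans by blast
  also have "\<dots> \<le> norm a * norm f" by (intro mult_left_mono norm_bounded) simp
  finally show "norm (delta i (a * apply_bcontfun f j)) \<le> norm f * norm a" by (simp add: mult.commute)
qed

definition matrix_unit_blinfun ::
    "nat \<Rightarrow> nat \<Rightarrow> 'a::real_normed_algebra \<Rightarrow> (nat \<Rightarrow>\<^sub>C 'a) \<Rightarrow>\<^sub>L (nat \<Rightarrow>\<^sub>C 'a)" where
  "matrix_unit_blinfun i j a = Blinfun (\<lambda>f. delta i (a * apply_bcontfun f j))"

lemma matrix_unit_blinfun_apply: "blinfun_apply (matrix_unit_blinfun i j a) f = delta i (a * apply_bcontfun f j)"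
  unfolding matrix_unit_blinfun_def by (simp add: bounded_linear_Blinfun_apply bounded_linear_matrix_unit_action)

lift_definition matrix_unit :: "nat \<Rightarrow> nat \<Rightarrow> 'a::real_normed_algebra \<Rightarrow> (nat \<Rightarrow>\<^sub>C 'a) opr"
  is matrix_unit_blinfun .

text \<open>Reads a coefficient off the image of the basis sequence \<open>delta j 1\<close>; it
  makes sense for every operator, matrix or not.\<close>

lift_definition entry :: "nat \<Rightarrow> nat \<Rightarrow> (nat \<Rightarrow>\<^sub>C 'a) opr \<Rightarrow> 'a::{real_normed_algebra,monoid_mult}"
  is "\<lambda>i j T. apply_bcontfun (blinfun_apply T (delta j 1)) i" .

lemma bounded_linear_matrix_unit: "bounded_linear (matrix_unit i j)"
proof (rule bounded_linear_intro[of _ 1])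
  fix a b :: 'a and r
  show "matrix_unit i j (a + b) = matrix_unit i j a + matrix_unit i j b"
    by transfer (rule blinfun_eqI, simp add: matrix_unit_blinfun_apply distrib_right delta_linear blinfun.add_left)
  show "matrix_unit i j (r *\<^sub>R a) = r *\<^sub>R matrix_unit i j a"
    by transfer (rule blinfun_eqI, simp add: matrix_unit_blinfun_apply delta_linear blinfun.scaleR_left)
  show "norm (matrix_unit i j a) \<le> norm a * 1"
  proof transfer
    fix i j :: nat and a :: 'a
    have "norm (delta i (a * apply_bcontfun f j)) \<le> norm a * norm f" for f
    proof -
      have "norm (delta i (a * apply_bcontfun f j)) \<le> norm a * norm (apply_bcontfun f j)"
        using norm_delta norm_mult_ineq order_trans by blast
      also have "\<dots> \<le> norm a * norm f" by (intro mult_left_mono norm_bounded) simp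
      finally show ?thesis .
    qed
    then show "norm (matrix_unit_blinfun i j a) \<le> norm a * 1"
      by (intro norm_blinfun_bound) (auto simp: matrix_unit_blinfun_apply)
  qed
qed

text \<open>The bound is the norm of \<open>delta j 1\<close>, since \<open>norm 1 = 1\<close> is
  not assumed.\<close>

lemma bounded_linear_entry:
  "bounded_linear (entry i j :: _ \<Rightarrow> 'a::{real_normed_algebra,monoid_mult})"
proof (rule bounded_linear_intro[of _ "norm (delta j 1 :: nat \<Rightarrow>\<^sub>C 'a)"])
  fix S T :: "(nat \<Rightarrow>\<^sub>C 'a) opr" and r
  show "entry i j (S + T) = entry i j S + entry i j T" by transfer (simp add: blinfun.add_left)
  show "entry i j (r *\<^sub>R S) = r *\<^sub>R entry i j S" by transfer (simp add: blinfun.scaleR_left)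
  show "norm (entry i j S) \<le> norm S * norm (delta j 1 :: nat \<Rightarrow>\<^sub>C 'a)"
    by transfer (meson norm_blinfun norm_bounded order_trans)
qed

lemma matrix_unit_mult: "matrix_unit i j a * matrix_unit k l b = (if j = k then matrix_unit i l (a * b) else 0)"
  by transfer (rule blinfun_eqI, simp add: matrix_unit_blinfun_apply delta_apply mult.assoc delta_linear(2)[of _ 0, simplified] )

lemma entry_matrix_unit: "entry i j (matrix_unit k l a) = (if i = k \<and> j = l then a else 0)"
  by transfer (simp add: matrix_unit_blinfun_apply delta_apply)

lemma continuous_map_mat_topology_iff:
  "continuous_map T (mat_topology n) g \<longleftrightarrow>
     g \<in> topspace T \<rightarrow> carrier_mat n n \<and> (\<forall>i<n. \<forall>j<n. continuous_map T euclidean (\<lambda>x. g x $$ (i, j)))"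
    (is "?L \<longleftrightarrow> ?R")
proof
  let ?I = "{..<n} \<times> {..<n}"
  assume L: ?L
  have "continuous_map T euclidean (\<lambda>x. g x $$ (i, j))" if "i < n" "j < n" for i j
  proof -
    have "continuous_map (mat_topology n) euclidean
        ((\<lambda>x. x (i, j)) \<circ> (\<lambda>a. restrict (\<lambda>ij. a $$ ij) ?I))"
      unfolding mat_topology_def using that
      by (intro continuous_map_pullback continuous_map_product_projection) auto
    then have "continuous_map (mat_topology n) euclidean (\<lambda>a. a $$ (i, j))"
      using that by (simp add: o_def)
    from continuous_map_compose[OF L this] show ?thesis by (simp add: o_def)
  qed
  moreover have "g \<in> topspace T \<rightarrow> carrier_mat n n"
    using continuous_map_funspace[OF L] by (auto simp: mat_topology_def topspace_pullback_topology)
  ultimately show ?R by blast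
next
  assume R: ?R
  then show ?L unfolding mat_topology_def
    by (intro continuous_map_pullback') (auto simp: continuous_map_componentwise o_def)
qed

lemma topspace_mat_topology: "topspace (mat_topology n) = carrier_mat n n"
  by (auto simp: mat_topology_def topspace_pullback_topology)

lemma continuous_map_mat_entry:
  "i < n \<Longrightarrow> j < n \<Longrightarrow> continuous_map (mat_topology n) euclidean (\<lambda>a. a $$ (i, j))"
  using continuous_map_mat_topology_iff[of "mat_topology n" n "\<lambda>a. a"] by auto

section \<open>Matrices of size n inside the operator algebra\<close>

definition mat_opr :: "nat \<Rightarrow> 'a::complex_banach_algebra mat \<Rightarrow> (nat \<Rightarrow>\<^sub>C 'a) opr" where
  "mat_opr n a = (\<Sum>i<n. \<Sum>j<n. matrix_unit i j (a $$ (i, j)))"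

definition opr_mat :: "nat \<Rightarrow> (nat \<Rightarrow>\<^sub>C 'a) opr \<Rightarrow> 'a::complex_banach_algebra mat" where
  "opr_mat n T = mat n n (\<lambda>(i, j). entry i j T)"

lemmas linear_matrix_unit = bounded_linear.linear[OF bounded_linear_matrix_unit]
lemmas linear_entry = bounded_linear.linear[OF bounded_linear_entry]

lemma matrix_unit_sum: "matrix_unit i j (\<Sum>k\<in>S. f k) = (\<Sum>k\<in>S. matrix_unit i j (f k))"
  by (rule linear_sum[OF linear_matrix_unit])

lemma opr_mat_carrier: "opr_mat n T \<in> carrier_mat n n"
  by (simp add: opr_mat_def)

lemma entry_mat_opr: "i < n \<Longrightarrow> j < n \<Longrightarrow> entry i j (mat_opr n a) = a $$ (i, j)"
proof -
  assume "i < n" "j < n"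
  have "entry i j (mat_opr n a) = (\<Sum>k<n. \<Sum>l<n. if i = k \<and> j = l then a $$ (k, l) else 0)"
    unfolding mat_opr_def by (simp add: linear_sum[OF linear_entry] entry_matrix_unit)
  also have "\<dots> = (\<Sum>k<n. if i = k then \<Sum>l<n. if j = l then a $$ (k, l) else 0 else 0)"
    by (intro sum.cong refl) auto
  also have "\<dots> = a $$ (i, j)" using \<open>i < n\<close> \<open>j < n\<close> by simp
  finally show ?thesis .
qed

lemma opr_mat_mat_opr: "a \<in> carrier_mat n n \<Longrightarrow> opr_mat n (mat_opr n a) = a"
  by (intro eq_matI) (auto simp: opr_mat_def entry_mat_opr)

lemma mat_opr_opr_mat: "mat_opr n (opr_mat n T) = (\<Sum>i<n. \<Sum>j<n. matrix_unit i j (entry i j T))"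
  unfolding mat_opr_def opr_mat_def by simp

lemma mat_opr_add:
  assumes "a \<in> carrier_mat n n" "b \<in> carrier_mat n n"
  shows "mat_opr n (a + b) = mat_opr n a + mat_opr n b"
  using assms by (simp add: mat_opr_def linear_add[OF linear_matrix_unit] sum.distrib)

lemma mat_opr_mult:
  assumes "a \<in> carrier_mat n n" "b \<in> carrier_mat n n"
  shows "mat_opr n (a * b) = mat_opr n a * mat_opr n b"
proof -
  have "mat_opr n a * mat_opr n b =
      (\<Sum>i<n. \<Sum>j<n. \<Sum>k<n. \<Sum>l<n. matrix_unit i j (a $$ (i, j)) * matrix_unit k l (b $$ (k, l)))"
    unfolding mat_opr_def
    by (subst sum_distrib_right, intro sum.cong refl, subst sum_distrib_right, intro sum.cong refl)
      (simp add: sum_distrib_left)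
  also have "\<dots> = (\<Sum>i<n. \<Sum>j<n. \<Sum>k<n. if j = k then \<Sum>l<n. matrix_unit i l (a $$ (i, j) * b $$ (k, l)) else 0)"
    by (intro sum.cong refl) (simp add: matrix_unit_mult if_distrib[of "\<lambda>x. sum x _"])
  also have "\<dots> = (\<Sum>i<n. \<Sum>j<n. \<Sum>l<n. matrix_unit i l (a $$ (i, j) * b $$ (j, l)))"
    by (rule sum.cong[OF refl], rule sum.cong[OF refl]) simp
  also have "\<dots> = (\<Sum>i<n. \<Sum>l<n. \<Sum>j<n. matrix_unit i l (a $$ (i, j) * b $$ (j, l)))"
    by (intro sum.cong refl sum.swap)
  also have "\<dots> = (\<Sum>i<n. \<Sum>l<n. matrix_unit i l ((a * b) $$ (i, l)))"
    using assms by (intro sum.cong refl)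
      (simp add: matrix_unit_sum scalar_prod_def lessThan_atLeast0)
  finally show ?thesis unfolding mat_opr_def by simp
qed

definition mat_oprs :: "nat \<Rightarrow> (nat \<Rightarrow>\<^sub>C 'a::complex_banach_algebra) opr set" where
  "mat_oprs n = mat_opr n ` carrier_mat n n"

text \<open>Describes \<open>mat_oprs\<close> as the fixed points of a bounded linear map, from
  which closedness and the subspace property follow.\<close>

lemma mat_oprs_iff: "T \<in> mat_oprs n \<longleftrightarrow> mat_opr n (opr_mat n T) = T"
proof
  assume "mat_opr n (opr_mat n T) = T"
  moreover have "mat_opr n (opr_mat n T) \<in> mat_oprs n"
    unfolding mat_oprs_def by (intro imageI opr_mat_carrier)
  ultimately show "T \<in> mat_oprs n" by simp
qed (auto simp: mat_oprs_def opr_mat_mat_opr)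

lemma mat_opr_in: "a \<in> carrier_mat n n \<Longrightarrow> mat_opr n a \<in> mat_oprs n"
  by (simp add: mat_oprs_def)

lemma bounded_linear_mat_opr_opr_mat:
  "bounded_linear (\<lambda>T :: (nat \<Rightarrow>\<^sub>C 'a::complex_banach_algebra) opr. mat_opr n (opr_mat n T))"
  unfolding mat_opr_opr_mat
  by (intro bounded_linear_sum bounded_linear_compose[OF bounded_linear_matrix_unit bounded_linear_entry])

definition scalar_mat :: "nat \<Rightarrow> complex \<Rightarrow> 'a::complex_banach_algebra mat" where
  "scalar_mat n c = map_mat (scaleC c) (1\<^sub>m n)"

lemma scaleC_0 [simp]: "c *\<^sub>C (0 :: 'a::complex_banach_algebra) = 0" "0 *\<^sub>C (x :: 'a) = 0"
  using scaleC_add_right[of c 0 0] scaleC_add_left[of 0 0 x] by simp_all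

lemma scaleC_one [simp]: "1 *\<^sub>C (x :: 'a::complex_banach_algebra) = x"
  using scaleR_scaleC[of 1 x] by simp

lemma scalar_mat_carrier: "scalar_mat n c \<in> carrier_mat n n"
  by (simp add: scalar_mat_def)

lemma scalar_mat_index: "i < n \<Longrightarrow> j < n \<Longrightarrow> scalar_mat n c $$ (i, j) = (if i = j then c *\<^sub>C 1 else 0)"
  by (simp add: scalar_mat_def)

lemma sum_if_mult:
  fixes f :: "nat \<Rightarrow> 'a::semiring_0"
  assumes "i < n"
  shows "(\<Sum>k<n. (if i = k then c else 0) * f k) = c * f i" "(\<Sum>k<n. f k * (if k = i then c else 0)) = f i * c"
  using assms by (simp_all add: if_distrib[of "\<lambda>x. x * _"] if_distrib[of "\<lambda>x. _ * x"] cong: if_cong)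

lemma scalar_mat_mult_left:
  fixes a :: "'a::complex_banach_algebra mat"
  assumes a: "a \<in> carrier_mat n m"
  shows "scalar_mat n c * a = map_mat (scaleC c) a"
proof (rule eq_matI)
  fix i j assume ij: "i < dim_row (map_mat (scaleC c) a)" "j < dim_col (map_mat (scaleC c) a)"
  have "(scalar_mat n c * a) $$ (i, j) = (\<Sum>k<n. (if i = k then c *\<^sub>C 1 else 0) * a $$ (k, j))"
    using a ij carrier_matD[OF scalar_mat_carrier[of n c, where 'a='a]]
    by (auto simp: scalar_prod_def scalar_mat_index lessThan_atLeast0 intro!: sum.cong)
  also have "\<dots> = (c *\<^sub>C 1) * a $$ (i, j)" using a ij by (intro sum_if_mult(1)) simp
  finally show "(scalar_mat n c * a) $$ (i, j) = map_mat (scaleC c) a $$ (i, j)"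
    using ij by (simp add: mult_scaleC_left)
qed (use a scalar_mat_carrier[of n c, where 'a='a] in auto)

lemma scalar_mat_mult_right:
  fixes a :: "'a::complex_banach_algebra mat"
  assumes a: "a \<in> carrier_mat m n"
  shows "a * scalar_mat n c = map_mat (scaleC c) a"
proof (rule eq_matI)
  fix i j assume ij: "i < dim_row (map_mat (scaleC c) a)" "j < dim_col (map_mat (scaleC c) a)"
  have "(a * scalar_mat n c) $$ (i, j) = (\<Sum>k<n. a $$ (i, k) * (if k = j then c *\<^sub>C 1 else 0))"
    using a ij carrier_matD[OF scalar_mat_carrier[of n c, where 'a='a]]
    by (auto simp: scalar_prod_def scalar_mat_index lessThan_atLeast0 intro!: sum.cong)
  also have "\<dots> = a $$ (i, j) * (c *\<^sub>C 1)" using a ij by (intro sum_if_mult(2)) simp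
  finally show "(a * scalar_mat n c) $$ (i, j) = map_mat (scaleC c) a $$ (i, j)"
    using ij by (simp add: mult_scaleC_right)
qed (use a scalar_mat_carrier[of n c, where 'a='a] in auto)

lemma one_mat_eq_scalar: "1\<^sub>m n = scalar_mat n 1"
  by (intro eq_matI) (auto simp: scalar_mat_def)

text \<open>The case c = 1 of scalar matrices. The entries may satisfy 0 = 1 and so do not form a
  \<open>semiring_1\<close>.\<close>

lemma left_one_mat:
  fixes a :: "'a::complex_banach_algebra mat"
  shows "a \<in> carrier_mat n m \<Longrightarrow> 1\<^sub>m n * a = a"
  unfolding one_mat_eq_scalar by (subst scalar_mat_mult_left) (auto intro: eq_matI)

lemma right_one_mat:
  fixes a :: "'a::complex_banach_algebra mat"
  shows "a \<in> carrier_mat m n \<Longrightarrow> a * 1\<^sub>m n = a"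
  unfolding one_mat_eq_scalar by (subst scalar_mat_mult_right) (auto intro: eq_matI)

lemma bounded_linear_scaleC_left: "bounded_linear (\<lambda>c. c *\<^sub>C (x :: 'a::complex_banach_algebra))"
  by (rule bounded_linear_intro[of _ "norm x"])
    (simp_all add: scaleC_add_left scaleR_scaleC scaleC_scaleC norm_scaleC scaleR_conv_of_real)

lemma bounded_linear_mat_opr_scalar_mat:
  "bounded_linear (\<lambda>c. mat_opr n (scalar_mat n c :: 'a::complex_banach_algebra mat))"
proof -
  have "mat_opr n (scalar_mat n c) = (\<Sum>i<n. matrix_unit i i (c *\<^sub>C (1 :: 'a)))" for c
    unfolding mat_opr_def
    by (intro sum.cong refl) (simp add: scalar_mat_index if_distrib linear_0[OF linear_matrix_unit] cong: if_cong)
  then show ?thesis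
    by (simp add: bounded_linear_sum bounded_linear_compose[OF bounded_linear_matrix_unit bounded_linear_scaleC_left])
qed

lemma banach_subalg_mat_oprs:
  "banach_subalg (mat_oprs n :: (nat \<Rightarrow>\<^sub>C 'a::complex_banach_algebra) opr set)
     (mat_opr n (1\<^sub>m n)) (\<lambda>c. mat_opr n (scalar_mat n c))"
proof (rule banach_subalg.intro)
  let ?P = "\<lambda>T :: (nat \<Rightarrow>\<^sub>C 'a) opr. mat_opr n (opr_mat n T)"
  have lin: "linear ?P" by (rule bounded_linear.linear[OF bounded_linear_mat_opr_opr_mat])
  have eq: "mat_oprs n = {T. ?P T = T}" by (auto simp: mat_oprs_iff)
  show "closed (mat_oprs n :: (nat \<Rightarrow>\<^sub>C 'a) opr set)"
    unfolding eq by (intro closed_Collect_eq continuous_intros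
        bounded_linear.continuous_on[OF bounded_linear_mat_opr_opr_mat])
  show "subspace (mat_oprs n :: (nat \<Rightarrow>\<^sub>C 'a) opr set)"
    unfolding eq subspace_def by (simp add: linear_add[OF lin] linear_0[OF lin] linear_scale[OF lin])
  show "x * y \<in> mat_oprs n" if "x \<in> mat_oprs n" "y \<in> mat_oprs n" for x y :: "(nat \<Rightarrow>\<^sub>C 'a) opr"
    using that unfolding mat_oprs_def by (auto simp flip: mat_opr_mult)
  show "mat_opr n (1\<^sub>m n) \<in> (mat_oprs n :: (nat \<Rightarrow>\<^sub>C 'a) opr set)" by (simp add: mat_opr_in)
  show "mat_opr n (1\<^sub>m n) * x = x" "x * mat_opr n (1\<^sub>m n) = x"
    if "x \<in> mat_oprs n" for x :: "(nat \<Rightarrow>\<^sub>C 'a) opr"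
    using that unfolding mat_oprs_def by (auto simp: left_one_mat right_one_mat simp flip: mat_opr_mult)
  show "mat_opr n (scalar_mat n c) \<in> (mat_oprs n :: (nat \<Rightarrow>\<^sub>C 'a) opr set)" for c
    by (simp add: mat_opr_in scalar_mat_carrier)
  show "mat_opr n (scalar_mat n 1) = mat_opr n (1\<^sub>m n :: 'a mat)" by (simp add: one_mat_eq_scalar)
  show "mat_opr n (scalar_mat n (a * b)) = (mat_opr n (scalar_mat n a) * mat_opr n (scalar_mat n b) :: (nat \<Rightarrow>\<^sub>C 'a) opr)"
    for a b
    by (subst mat_opr_mult[symmetric, OF scalar_mat_carrier scalar_mat_carrier],
        subst scalar_mat_mult_left[OF scalar_mat_carrier])
      (auto simp: scalar_mat_def scaleC_scaleC intro!: arg_cong[of _ _ "mat_opr n"] eq_matI)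
  show "mat_opr n (scalar_mat n c) * x = x * mat_opr n (scalar_mat n c)"
    if "x \<in> mat_oprs n" for c and x :: "(nat \<Rightarrow>\<^sub>C 'a) opr"
    using that unfolding mat_oprs_def
    by (auto simp: scalar_mat_mult_left scalar_mat_mult_right scalar_mat_carrier simp flip: mat_opr_mult)
qed (rule bounded_linear_mat_opr_scalar_mat)

lemma GL_iff: "u \<in> GL n \<longleftrightarrow> u \<in> carrier_mat n n \<and> (\<exists>w\<in>carrier_mat n n. u * w = 1\<^sub>m n \<and> w * u = 1\<^sub>m n)"
  by (auto simp: GL_def Units_def mat_alg_def)

lemma mat_opr_inj: "mat_opr n a = mat_opr n b \<Longrightarrow> a \<in> carrier_mat n n \<Longrightarrow> b \<in> carrier_mat n n \<Longrightarrow> a = b"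
  using opr_mat_mat_opr by metis

lemma mat_opr_GL:
  fixes u :: "'a::complex_banach_algebra mat"
  assumes u: "u \<in> carrier_mat n n"
  shows "mat_opr n u \<in> banach_subalg.U (mat_oprs n) (mat_opr n (1\<^sub>m n)) \<longleftrightarrow> u \<in> GL n"
proof -
  have "mat_opr n u * mat_opr n w = mat_opr n (1\<^sub>m n) \<longleftrightarrow> u * w = 1\<^sub>m n"
    "mat_opr n w * mat_opr n u = mat_opr n (1\<^sub>m n) \<longleftrightarrow> w * u = 1\<^sub>m n" if "w \<in> carrier_mat n n" for w
    using u that mat_opr_inj[OF _ mult_carrier_mat one_carrier_mat] by (auto simp flip: mat_opr_mult)
  then have "(\<exists>T\<in>mat_oprs n. mat_opr n u * T = mat_opr n (1\<^sub>m n) \<and> T * mat_opr n u = mat_opr n (1\<^sub>m n)) \<longleftrightarrow>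
      (\<exists>w\<in>carrier_mat n n. u * w = 1\<^sub>m n \<and> w * u = 1\<^sub>m n)"
    unfolding mat_oprs_def bex_simps by blast
  then show ?thesis
    unfolding GL_iff banach_subalg.U_def[OF banach_subalg_mat_oprs] using mat_opr_in[OF u] u by blast
qed

lemma U_mat_oprs:
  "banach_subalg.U (mat_oprs n) (mat_opr n (1\<^sub>m n)) = mat_opr n ` GL n"
proof (intro equalityI subsetI)
  fix T :: "(nat \<Rightarrow>\<^sub>C 'a) opr" assume T: "T \<in> banach_subalg.U (mat_oprs n) (mat_opr n (1\<^sub>m n))"
  then have "T \<in> mat_oprs n" using banach_subalg.U_inv(1)[OF banach_subalg_mat_oprs] by blast
  then obtain u where "u \<in> carrier_mat n n" "T = mat_opr n u" unfolding mat_oprs_def by blast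
  then show "T \<in> mat_opr n ` GL n" using T mat_opr_GL by blast
qed (use mat_opr_GL GL_iff in blast)

lemma continuous_map_mat_opr: "continuous_map (mat_topology n) euclidean (mat_opr n)"
  unfolding mat_opr_def
  by (intro continuous_map_sum finite_lessThan
      continuous_map_compose[OF continuous_map_mat_entry, unfolded o_def, of _ _ _ euclidean])
    (auto intro: linear_continuous_on bounded_linear_matrix_unit)

lemma continuous_map_opr_mat: "continuous_map euclidean (mat_topology n) (opr_mat n)"
  unfolding continuous_map_mat_topology_iff
  by (auto simp: opr_mat_carrier opr_mat_def intro: linear_continuous_on bounded_linear_entry)

text \<open>\<open>mat_opr\<close> and \<open>opr_mat\<close> are continuous and mutually inverse
  between \<open>GL n\<close> and its image, so paths are carried over in both directions.\<close>

lemma path_component_GL_iff: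
  assumes u: "u \<in> carrier_mat n n" and v: "v \<in> carrier_mat n n"
  shows "path_component_of (GL_topology n) u v \<longleftrightarrow> path_component (mat_opr n ` GL n) (mat_opr n u) (mat_opr n v)"
proof
  assume "path_component_of (GL_topology n) u v"
  then obtain g where g: "pathin (GL_topology n) g" "g 0 = u" "g 1 = v" unfolding path_component_of_def by blast
  have "continuous_map (GL_topology n) (top_of_set (mat_opr n ` GL n)) (mat_opr n)"
    unfolding GL_topology_def
    by (auto simp: continuous_map_in_subtopology intro: continuous_map_from_subtopology continuous_map_mat_opr)
  from pathin_compose[OF g(1) this] have "path_component_of (top_of_set (mat_opr n ` GL n)) (mat_opr n u) (mat_opr n v)"
    unfolding path_component_of_def using g by (intro exI[of _ "mat_opr n \<circ> g"]) auto
  then show "path_component (mat_opr n ` GL n) (mat_opr n u) (mat_opr n v)" by simp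
next
  assume "path_component (mat_opr n ` GL n) (mat_opr n u) (mat_opr n v)"
  then have "path_component_of (top_of_set (mat_opr n ` GL n)) (mat_opr n u) (mat_opr n v)" by simp
  then obtain g where g: "pathin (top_of_set (mat_opr n ` GL n)) g" "g 0 = mat_opr n u" "g 1 = mat_opr n v"
    unfolding path_component_of_def by blast
  have "GL n \<subseteq> carrier_mat n n" by (auto simp: GL_iff)
  then have "continuous_map (top_of_set (mat_opr n ` GL n)) (GL_topology n) (opr_mat n)"
    unfolding GL_topology_def
    by (auto simp: continuous_map_in_subtopology opr_mat_mat_opr subset_iff
        intro!: continuous_map_from_subtopology continuous_map_opr_mat)
  from pathin_compose[OF g(1) this] show "path_component_of (GL_topology n) u v"
    unfolding path_component_of_def using g u v
    by (intro exI[of _ "opr_mat n \<circ> g"]) (auto simp: opr_mat_mat_opr)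
qed


section \<open>Dense completely relatively spectral morphisms\<close>

lemma abelian_group_mat_alg: "abelian_group (mat_alg n :: (complex, 'a::complex_banach_algebra mat) module)"
proof (rule abelian_groupI)
  show "\<exists>y\<in>carrier (mat_alg n). y \<oplus>\<^bsub>mat_alg n\<^esub> x = \<zero>\<^bsub>mat_alg n\<^esub>"
    if "x \<in> carrier (mat_alg n)" for x :: "'a mat"
    using that by (intro bexI[of _ "- x"]) (auto simp: mat_alg_def uminus_l_inv_mat)
qed (auto simp: mat_alg_def comm_add_mat assoc_add_mat)

lemma GL_uminus:
  fixes a :: "'a::complex_banach_algebra mat"
  assumes "a \<in> GL n"
  shows "- a \<in> GL n"
proof -
  obtain w where "a \<in> carrier_mat n n" "w \<in> carrier_mat n n" "a * w = 1\<^sub>m n" "w * a = 1\<^sub>m n"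
    using assms GL_iff by blast
  then show ?thesis unfolding GL_iff by (intro conjI bexI[of _ "- w"]) auto
qed

text \<open>At the value 0 the element tested is \<open>- a\<close>, which is invertible exactly
  when \<open>a\<close> is.\<close>

lemma zero_in_spectrum_mat_alg_iff:
  fixes a :: "'a::complex_banach_algebra mat"
  assumes a: "a \<in> carrier_mat n n"
  shows "0 \<in> spectrum (mat_alg n) a \<longleftrightarrow> a \<notin> GL n"
proof -
  interpret abelian_group "mat_alg n :: (complex, 'a mat) module" by (rule abelian_group_mat_alg)
  have "\<ominus>\<^bsub>mat_alg n\<^esub> a = - a"
    by (rule minus_equality) (use a in \<open>auto simp: mat_alg_def uminus_l_inv_mat\<close>)
  moreover have "0 \<odot>\<^bsub>mat_alg n\<^esub> \<one>\<^bsub>mat_alg n\<^esub> = (0\<^sub>m n n :: 'a mat)"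
    by (auto simp: mat_alg_def intro!: eq_matI)
  ultimately have "0 \<odot>\<^bsub>mat_alg n\<^esub> \<one>\<^bsub>mat_alg n\<^esub> \<ominus>\<^bsub>mat_alg n\<^esub> a = - a"
    unfolding a_minus_def using a by (simp add: mat_alg_def)
  then show ?thesis unfolding spectrum_def
    using GL_uminus[of a n] GL_uminus[of "- a" n] a by (auto simp: GL_def)
qed

locale algebra_morphism =
  fixes \<phi> :: "'a::complex_banach_algebra \<Rightarrow> 'b::complex_banach_algebra"
  assumes morphism: "morphism \<phi>"
begin

lemma \<phi>_simps:
  "\<phi> 1 = 1" "\<phi> (x + y) = \<phi> x + \<phi> y" "\<phi> (x * y) = \<phi> x * \<phi> y" "\<phi> (c *\<^sub>C x) = c *\<^sub>C \<phi> x"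
  using morphism unfolding morphism_def by blast+

lemma \<phi>_scaleR: "\<phi> (r *\<^sub>R x) = r *\<^sub>R \<phi> x"
  by (simp add: scaleR_scaleC \<phi>_simps)

lemma \<phi>_linear: "linear \<phi>"
  by (intro linearI \<phi>_simps \<phi>_scaleR)

lemma \<phi>_0: "\<phi> 0 = 0"
  by (rule linear_0[OF \<phi>_linear])

lemma \<phi>_cont: "continuous_on S \<phi>"
  using morphism unfolding morphism_def using continuous_on_subset by blast

abbreviation \<phi>m :: "'a mat \<Rightarrow> 'b mat" where "\<phi>m \<equiv> map_mat \<phi>"

lemma \<phi>m_mult: "a \<in> carrier_mat n m \<Longrightarrow> b \<in> carrier_mat m k \<Longrightarrow> \<phi>m (a * b) = \<phi>m a * \<phi>m b"
  by (intro eq_matI) (auto simp: scalar_prod_def linear_sum[OF \<phi>_linear] \<phi>_simps)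

lemma \<phi>m_one: "\<phi>m (1\<^sub>m n) = 1\<^sub>m n"
  by (intro eq_matI) (auto simp: \<phi>_simps \<phi>_0)

lemma \<phi>m_zero: "\<phi>m (0\<^sub>m n m) = 0\<^sub>m n m"
  by (intro eq_matI) (auto simp: \<phi>_0)

lemma \<phi>m_scalar: "\<phi>m (scalar_mat n c) = scalar_mat n c"
  by (intro eq_matI) (auto simp: scalar_mat_def \<phi>_simps \<phi>_0)

lemma \<phi>m_GL: "u \<in> GL n \<Longrightarrow> \<phi>m u \<in> GL n"
  unfolding GL_iff by (metis map_carrier_mat \<phi>m_mult \<phi>m_one)

text \<open>Cutting an operator down to its n by n corner first makes this total and linear on all
  operators; it is multiplicative on \<open>mat_oprs n\<close>.\<close>

definition \<Phi> :: "nat \<Rightarrow> (nat \<Rightarrow>\<^sub>C 'a) opr \<Rightarrow> (nat \<Rightarrow>\<^sub>C 'b) opr" where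
  "\<Phi> n T = mat_opr n (\<phi>m (opr_mat n T))"

lemma \<Phi>_mat_opr: "a \<in> carrier_mat n n \<Longrightarrow> \<Phi> n (mat_opr n a) = mat_opr n (\<phi>m a)"
  by (simp add: \<Phi>_def opr_mat_mat_opr)

lemma \<Phi>_eq: "\<Phi> n T = (\<Sum>i<n. \<Sum>j<n. matrix_unit i j (\<phi> (entry i j T)))"
  by (simp add: \<Phi>_def mat_opr_def opr_mat_def)

lemma \<Phi>_linear: "linear (\<Phi> n)"
  by (intro linearI) (simp_all add: \<Phi>_eq linear_add[OF linear_entry] linear_scale[OF linear_entry] \<phi>_simps
      linear_add[OF linear_matrix_unit] linear_scale[OF linear_matrix_unit] \<phi>_scaleR sum.distrib scaleR_right.sum)

lemma \<Phi>_continuous: "continuous_on S (\<Phi> n)"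
  unfolding \<Phi>_eq
  by (intro continuous_intros bounded_linear.continuous_on[OF bounded_linear_matrix_unit]
      continuous_on_compose2[OF \<phi>_cont[of UNIV]] bounded_linear.continuous_on[OF bounded_linear_entry]) auto

end

lemma sim_mat_opr_iff:
  fixes e f :: "'a::complex_banach_algebra mat"
  assumes e: "e \<in> carrier_mat n n" and f: "f \<in> carrier_mat n n"
  shows "banach_subalg.sim (mat_oprs n) (mat_opr n (1\<^sub>m n)) (mat_opr n e) (mat_opr n f) \<longleftrightarrow>
    (\<exists>z\<in>GL n. z * e = f * z)"
proof -
  have "mat_opr n z * mat_opr n e = mat_opr n f * mat_opr n z \<longleftrightarrow> z * e = f * z" if "z \<in> GL n" for z
  proof -
    have z: "z \<in> carrier_mat n n" using that GL_iff by blast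
    then show ?thesis using e f mat_opr_inj[OF _ mult_carrier_mat mult_carrier_mat]
      by (auto simp flip: mat_opr_mult)
  qed
  then show ?thesis
    unfolding banach_subalg.sim_def[OF banach_subalg_mat_oprs] U_mat_oprs by auto
qed

locale dense_crs_morphism = algebra_morphism +
  assumes dense: "dense_morphism \<phi>" and crs: "completely_relatively_spectral \<phi>"
begin

text \<open>Approximate each entry by a sequence from the range of \<open>\<phi>\<close>;
  \<open>mat_opr\<close> is a finite sum of continuous functions of the entries.\<close>

lemma mat_oprs_range_dense: "mat_oprs n \<subseteq> closure (\<Phi> n ` mat_oprs n)"
proof
  fix T :: "(nat \<Rightarrow>\<^sub>C 'b) opr" assume "T \<in> mat_oprs n"
  then obtain b where b: "b \<in> carrier_mat n n" "T = mat_opr n b" unfolding mat_oprs_def by blast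
  have "\<exists>s. (\<lambda>m. \<phi> (s m)) \<longlonglongrightarrow> y" for y
  proof -
    have "y \<in> closure (range \<phi>)" using dense by (simp add: dense_morphism_def)
    then obtain x where x: "\<forall>m. x m \<in> range \<phi>" "x \<longlonglongrightarrow> y" unfolding closure_sequential by blast
    then have "\<forall>m. \<exists>a. \<phi> a = x m" by (metis rangeE)
    then obtain s where "\<And>m. \<phi> (s m) = x m" by metis
    with x show ?thesis by (intro exI[of _ s]) simp
  qed
  then obtain s where s: "\<And>y. (\<lambda>m. \<phi> (s y m)) \<longlonglongrightarrow> y" by metis
  define a where "a m = mat n n (\<lambda>ij. s (b $$ ij) m)" for m
  have a: "a m \<in> carrier_mat n n" for m by (simp add: a_def)
  have "(\<lambda>m. mat_opr n (\<phi>m (a m))) \<longlonglongrightarrow> T"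
    unfolding b(2) mat_opr_def
  proof (intro tendsto_sum bounded_linear.tendsto[OF bounded_linear_matrix_unit])
    fix i j assume "i \<in> {..<n}" "j \<in> {..<n}"
    then show "(\<lambda>m. \<phi>m (a m) $$ (i, j)) \<longlonglongrightarrow> b $$ (i, j)" using s by (simp add: a_def)
  qed
  moreover have "mat_opr n (\<phi>m (a m)) \<in> \<Phi> n ` mat_oprs n" for m
    using \<Phi>_mat_opr[OF a] mat_opr_in[OF a] by (metis imageI)
  ultimately show "T \<in> closure (\<Phi> n ` mat_oprs n)"
    unfolding closure_sequential by (intro exI[of _ "\<lambda>m. mat_opr n (\<phi>m (a m))"]) simp
qed

lemma relatively_spectral_hom_mat_oprs:
  assumes "n \<ge> 1"
  obtains X where "relatively_spectral_hom (mat_oprs n) (mat_opr n (1\<^sub>m n)) (\<lambda>c. mat_opr n (scalar_mat n c))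
    (mat_oprs n) (mat_opr n (1\<^sub>m n)) (\<lambda>c. mat_opr n (scalar_mat n c)) (\<Phi> n) X"
proof -
  obtain Y where Y: "unital_subalgebra Y (mat_alg n)"
      "(mat_topology n) closure_of Y = carrier (mat_alg n)"
      "spectral_relative_to Y (mat_alg n) (mat_alg n) \<phi>m"
    using crs assms unfolding completely_relatively_spectral_def relatively_spectral_def by blast
  have YC: "Y \<subseteq> carrier_mat n n" and Y1: "1\<^sub>m n \<in> Y"
    and Yadd: "\<And>x y. x \<in> Y \<Longrightarrow> y \<in> Y \<Longrightarrow> x + y \<in> Y"
    and Ysc: "\<And>c x. x \<in> Y \<Longrightarrow> map_mat (scaleC c) x \<in> Y"
    using Y(1) by (auto simp: unital_subalgebra_def mat_alg_def)
  let ?X = "mat_opr n ` Y"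
  interpret A: banach_subalg "mat_oprs n :: (nat \<Rightarrow>\<^sub>C 'a) opr set" "mat_opr n (1\<^sub>m n)" "\<lambda>c. mat_opr n (scalar_mat n c)"
    by (rule banach_subalg_mat_oprs)
  have csX: "mat_opr n (scalar_mat n c) * x \<in> ?X" if x: "x \<in> ?X" for c x
  proof -
    obtain y where y: "y \<in> Y" "x = mat_opr n y" using x by blast
    then have "mat_opr n (scalar_mat n c) * x = mat_opr n (map_mat (scaleC c) y)"
      using YC by (auto simp: scalar_mat_mult_left simp flip: mat_opr_mult[OF scalar_mat_carrier])
    then show ?thesis using Ysc y by blast
  qed
  have "relatively_spectral_hom_axioms (mat_oprs n) (mat_opr n (1\<^sub>m n)) (\<lambda>c. mat_opr n (scalar_mat n c))
    (mat_oprs n) (mat_opr n (1\<^sub>m n)) (\<lambda>c. mat_opr n (scalar_mat n c)) (\<Phi> n) ?X"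
  proof
    show "\<Phi> n x \<in> mat_oprs n" for x by (simp add: \<Phi>_def mat_opr_in opr_mat_carrier)
    show "\<Phi> n (x + y) = \<Phi> n x + \<Phi> n y" "\<Phi> n (r *\<^sub>R x) = r *\<^sub>R \<Phi> n x" for x y r
      by (simp_all add: linear_add[OF \<Phi>_linear] linear_scale[OF \<Phi>_linear])
    show "\<Phi> n (x * y) = \<Phi> n x * \<Phi> n y" if "x \<in> mat_oprs n" "y \<in> mat_oprs n" for x y
      using that unfolding mat_oprs_def
      by (auto simp: \<Phi>_mat_opr \<phi>m_mult mat_opr_mult[symmetric, of _ n] simp del: mat_opr_mult)
    show "\<Phi> n (mat_opr n (scalar_mat n c)) = mat_opr n (scalar_mat n c)" for c
      by (simp add: \<Phi>_mat_opr scalar_mat_carrier \<phi>m_scalar)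
    show "continuous_on (mat_oprs n) (\<Phi> n)" by (rule \<Phi>_continuous)
    show X: "?X \<subseteq> mat_oprs n" using YC by (auto simp: mat_oprs_def)
    show "mat_opr n (1\<^sub>m n) \<in> ?X" using Y1 by blast
    show "mat_opr n (scalar_mat n c) * x \<in> ?X" if "x \<in> ?X" for c x by (rule csX[OF that])
    show "subspace ?X"
    proof (rule subspaceI)
      \<comment> \<open>Real scaling is multiplication by a scalar matrix, under which
        \<open>?X\<close> is already known to be stable.\<close>
      have scaleR: "r *\<^sub>R x = mat_opr n (scalar_mat n (of_real r)) * x" if "x \<in> ?X" for r x
      proof -
        have "mat_opr n (scalar_mat n (complex_of_real r)) = (r *\<^sub>R mat_opr n (1\<^sub>m n) :: (nat \<Rightarrow>\<^sub>C 'a) opr)"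
          using linear_scale[OF bounded_linear.linear[OF A.cs_lin], of r 1]
          by (simp add: scaleR_conv_of_real one_mat_eq_scalar)
        then show ?thesis using A.p_left[of x] that X by auto
      qed
      show "r *\<^sub>R x \<in> ?X" if "x \<in> ?X" for r x using csX[OF that] scaleR[OF that] by simp
      from this[of "mat_opr n (1\<^sub>m n)" 0] show "0 \<in> ?X" using Y1 by auto
      show "x + y \<in> ?X" if xy: "x \<in> ?X" "y \<in> ?X" for x y
      proof -
        obtain a b where "a \<in> Y" "b \<in> Y" "x = mat_opr n a" "y = mat_opr n b" using xy by blast
        then show ?thesis using YC Yadd by (auto simp: subset_iff simp flip: mat_opr_add)
      qed
    qed
    \<comment> \<open>Density of \<open>Y\<close> in the entrywise topology passes to the operator
      norm by continuity of \<open>mat_opr\<close>.\<close>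
    show "mat_oprs n \<subseteq> closure ?X"
      using continuous_map_image_closure_subset[OF continuous_map_mat_opr, of n Y] Y(2)
      by (simp add: mat_oprs_def mat_alg_def)
    show "mat_oprs n \<subseteq> closure (\<Phi> n ` mat_oprs n)" by (rule mat_oprs_range_dense)
    show "x \<in> banach_subalg.U (mat_oprs n) (mat_opr n (1\<^sub>m n))"
      if x: "x \<in> ?X" and U: "\<Phi> n x \<in> banach_subalg.U (mat_oprs n) (mat_opr n (1\<^sub>m n))" for x
    proof -
      obtain y where y: "y \<in> Y" "x = mat_opr n y" using x by blast
      have yC: "y \<in> carrier_mat n n" using y YC by blast
      have "\<phi>m y \<in> GL n" using U yC unfolding y by (simp add: \<Phi>_mat_opr mat_opr_GL)
      \<comment> \<open>Equality of spectra is read at the value 0, where it compares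
        invertibility.\<close>
      then have "0 \<notin> spectrum (mat_alg n) (\<phi>m y)" using yC by (simp add: zero_in_spectrum_mat_alg_iff)
      then have "0 \<notin> spectrum (mat_alg n) y" using Y(3) y unfolding spectral_relative_to_def by blast
      then show ?thesis using yC unfolding y by (simp add: zero_in_spectrum_mat_alg_iff mat_opr_GL)
    qed
  qed
  then show ?thesis
    by (intro that relatively_spectral_hom.intro banach_subalg_mat_oprs)
qed

text \<open>The dense subalgebra may change with \<open>n\<close>, so the abstract lifting is
  instantiated separately for each size.\<close>

lemma GL_lift:
  assumes "n \<ge> 1" "v \<in> GL n"
  obtains u where "u \<in> GL n" "path_component_of (GL_topology n) (\<phi>m u) v"
proof -
  obtain X where "relatively_spectral_hom (mat_oprs n) (mat_opr n (1\<^sub>m n)) (\<lambda>c. mat_opr n (scalar_mat n c))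
    (mat_oprs n) (mat_opr n (1\<^sub>m n)) (\<lambda>c. mat_opr n (scalar_mat n c)) (\<Phi> n) X"
    using relatively_spectral_hom_mat_oprs[OF assms(1)] .
  then interpret H: relatively_spectral_hom "mat_oprs n" "mat_opr n (1\<^sub>m n)" "\<lambda>c. mat_opr n (scalar_mat n c)"
    "mat_oprs n" "mat_opr n (1\<^sub>m n)" "\<lambda>c. mat_opr n (scalar_mat n c)" "\<Phi> n" X .
  obtain T where T: "T \<in> mat_opr n ` GL n" "path_component (mat_opr n ` GL n) (\<Phi> n T) (mat_opr n v)"
    using H.GL_surj[of "mat_opr n v"] assms(2) unfolding U_mat_oprs by blast
  then obtain u where u: "u \<in> GL n" "T = mat_opr n u" by blast
  have "u \<in> carrier_mat n n" "v \<in> carrier_mat n n" using u assms GL_iff by blast+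
  with T u show ?thesis by (intro that[OF u(1)]) (simp add: path_component_GL_iff \<Phi>_mat_opr)
qed

lemma GL_path_reflect:
  assumes "n \<ge> 1" "u \<in> GL n" "v \<in> GL n" "path_component_of (GL_topology n) (\<phi>m u) (\<phi>m v)"
  shows "path_component_of (GL_topology n) u v"
proof -
  obtain X where "relatively_spectral_hom (mat_oprs n) (mat_opr n (1\<^sub>m n)) (\<lambda>c. mat_opr n (scalar_mat n c))
    (mat_oprs n) (mat_opr n (1\<^sub>m n)) (\<lambda>c. mat_opr n (scalar_mat n c)) (\<Phi> n) X"
    using relatively_spectral_hom_mat_oprs[OF assms(1)] .
  then interpret H: relatively_spectral_hom "mat_oprs n" "mat_opr n (1\<^sub>m n)" "\<lambda>c. mat_opr n (scalar_mat n c)"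
    "mat_oprs n" "mat_opr n (1\<^sub>m n)" "\<lambda>c. mat_opr n (scalar_mat n c)" "\<Phi> n" X .
  have c: "u \<in> carrier_mat n n" "v \<in> carrier_mat n n" using assms GL_iff by blast+
  show ?thesis
    using H.GL_inj[of "mat_opr n u" "mat_opr n v"] assms c
    unfolding U_mat_oprs by (simp add: path_component_GL_iff \<Phi>_mat_opr)
qed

lemma idempotent_lift:
  assumes "n \<ge> 1" "f \<in> carrier_mat n n" "f * f = f"
  obtains e z where "e \<in> carrier_mat n n" "e * e = e" "z \<in> GL n" "z * \<phi>m e = f * z"
proof -
  obtain X where "relatively_spectral_hom (mat_oprs n) (mat_opr n (1\<^sub>m n)) (\<lambda>c. mat_opr n (scalar_mat n c))
    (mat_oprs n) (mat_opr n (1\<^sub>m n)) (\<lambda>c. mat_opr n (scalar_mat n c)) (\<Phi> n) X"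
    using relatively_spectral_hom_mat_oprs[OF assms(1)] .
  then interpret H: relatively_spectral_hom "mat_oprs n" "mat_opr n (1\<^sub>m n)" "\<lambda>c. mat_opr n (scalar_mat n c)"
    "mat_oprs n" "mat_opr n (1\<^sub>m n)" "\<lambda>c. mat_opr n (scalar_mat n c)" "\<Phi> n" X .
  have "mat_opr n f * mat_opr n f = mat_opr n f" using assms by (simp flip: mat_opr_mult)
  then obtain T where T: "T \<in> mat_oprs n" "T * T = T" "H.B.sim (\<Phi> n T) (mat_opr n f)"
    using H.idem_surj[OF mat_opr_in[OF assms(2)]] by blast
  then obtain e where e: "e \<in> carrier_mat n n" "T = mat_opr n e" unfolding mat_oprs_def by blast
  have "mat_opr n (e * e) = mat_opr n e" using T e by (simp add: mat_opr_mult)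
  then have "e * e = e" by (rule mat_opr_inj) (use e in auto)
  moreover have "\<exists>z\<in>GL n. z * \<phi>m e = f * z"
    using T(3) e assms by (simp add: \<Phi>_mat_opr sim_mat_opr_iff)
  ultimately show ?thesis using e that by blast
qed

lemma idempotent_similar_reflect:
  assumes "n \<ge> 1" "e \<in> carrier_mat n n" "e * e = e" "f \<in> carrier_mat n n" "f * f = f"
    and "z \<in> GL n" "z * \<phi>m e = \<phi>m f * z"
  obtains w where "w \<in> GL n" "w * e = f * w"
proof -
  obtain X where "relatively_spectral_hom (mat_oprs n) (mat_opr n (1\<^sub>m n)) (\<lambda>c. mat_opr n (scalar_mat n c))
    (mat_oprs n) (mat_opr n (1\<^sub>m n)) (\<lambda>c. mat_opr n (scalar_mat n c)) (\<Phi> n) X"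
    using relatively_spectral_hom_mat_oprs[OF assms(1)] .
  then interpret H: relatively_spectral_hom "mat_oprs n" "mat_opr n (1\<^sub>m n)" "\<lambda>c. mat_opr n (scalar_mat n c)"
    "mat_oprs n" "mat_opr n (1\<^sub>m n)" "\<lambda>c. mat_opr n (scalar_mat n c)" "\<Phi> n" X .
  have "mat_opr n f * mat_opr n f = mat_opr n f" "mat_opr n e * mat_opr n e = mat_opr n e"
    using assms by (simp_all flip: mat_opr_mult)
  moreover have "H.B.sim (\<Phi> n (mat_opr n e)) (\<Phi> n (mat_opr n f))"
    using assms by (auto simp: \<Phi>_mat_opr sim_mat_opr_iff)
  ultimately have "H.A.sim (mat_opr n e) (mat_opr n f)"
    using assms by (intro H.idem_inj mat_opr_in)
  then show ?thesis using that assms by (auto simp: sim_mat_opr_iff)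
qed

end


section \<open>The isomorphism on \<open>K\<^sub>0\<close>\<close>

context comm_monoid
begin

lemma groth_rel_iff: "((x, y), (x', y')) \<in> groth_rel G \<longleftrightarrow>
    x \<in> carrier G \<and> y \<in> carrier G \<and> x' \<in> carrier G \<and> y' \<in> carrier G \<and>
    (\<exists>z \<in> carrier G. x \<otimes> y' \<otimes> z = x' \<otimes> y \<otimes> z)"
  by (simp add: groth_rel_def)

lemma equiv_groth_rel: "equiv (carrier G \<times> carrier G) (groth_rel G)"
proof (rule equivI)
  show "groth_rel G \<subseteq> (carrier G \<times> carrier G) \<times> (carrier G \<times> carrier G)" by (auto simp: groth_rel_def)
  show "refl_on (carrier G \<times> carrier G) (groth_rel G)" by (auto simp: refl_on_def groth_rel_def)
  show "sym (groth_rel G)" by (clarsimp simp: sym_def groth_rel_def) metis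
  show "trans (groth_rel G)"
  proof (rule transI, clarify)
    fix x y x' y' x'' y''
    assume "((x, y), (x', y')) \<in> groth_rel G" "((x', y'), (x'', y'')) \<in> groth_rel G"
    then obtain z w where c: "x \<in> carrier G" "y \<in> carrier G" "x' \<in> carrier G" "y' \<in> carrier G"
        "x'' \<in> carrier G" "y'' \<in> carrier G" "z \<in> carrier G" "w \<in> carrier G"
      and z: "x \<otimes> y' \<otimes> z = x' \<otimes> y \<otimes> z" and w: "x' \<otimes> y'' \<otimes> w = x'' \<otimes> y' \<otimes> w"
      unfolding groth_rel_iff by blast
    \<comment> \<open>The monoid need not be cancellative, so the middle term y' joins the two old
      witnesses in the new one.\<close>
    have "x \<otimes> y'' \<otimes> (y' \<otimes> z \<otimes> w) = (x \<otimes> y' \<otimes> z) \<otimes> (y'' \<otimes> w)" using c by (simp add: m_ac)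
    also have "\<dots> = (x' \<otimes> y'' \<otimes> w) \<otimes> (y \<otimes> z)" unfolding z using c by (simp add: m_ac)
    also have "\<dots> = x'' \<otimes> y \<otimes> (y' \<otimes> z \<otimes> w)" unfolding w using c by (simp add: m_ac)
    finally show "((x, y), (x'', y'')) \<in> groth_rel G" unfolding groth_rel_iff using c by blast
  qed
qed

lemma groth_rel_mult:
  assumes "((x, y), (x', y')) \<in> groth_rel G" "((u, v), (u', v')) \<in> groth_rel G"
  shows "((x \<otimes> u, y \<otimes> v), (x' \<otimes> u', y' \<otimes> v')) \<in> groth_rel G"
proof -
  obtain z w where c: "x \<in> carrier G" "y \<in> carrier G" "x' \<in> carrier G" "y' \<in> carrier G"
      "u \<in> carrier G" "v \<in> carrier G" "u' \<in> carrier G" "v' \<in> carrier G" "z \<in> carrier G" "w \<in> carrier G"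
    and z: "x \<otimes> y' \<otimes> z = x' \<otimes> y \<otimes> z" and w: "u \<otimes> v' \<otimes> w = u' \<otimes> v \<otimes> w"
    using assms unfolding groth_rel_iff by blast
  have "x \<otimes> u \<otimes> (y' \<otimes> v') \<otimes> (z \<otimes> w) = (x \<otimes> y' \<otimes> z) \<otimes> (u \<otimes> v' \<otimes> w)" using c by (simp add: m_ac)
  also have "\<dots> = x' \<otimes> u' \<otimes> (y \<otimes> v) \<otimes> (z \<otimes> w)" unfolding z w using c by (simp add: m_ac)
  finally show ?thesis unfolding groth_rel_iff using c by blast
qed

lemma groth_class_eq_iff:
  assumes "x \<in> carrier G" "y \<in> carrier G" "x' \<in> carrier G" "y' \<in> carrier G"
  shows "groth_rel G `` {(x, y)} = groth_rel G `` {(x', y')} \<longleftrightarrow> ((x, y), (x', y')) \<in> groth_rel G"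
  using eq_equiv_class_iff[OF equiv_groth_rel, of "(x, y)" "(x', y')"] assms by simp

lemma groth_mult_class:
  assumes "x \<in> carrier G" "y \<in> carrier G" "u \<in> carrier G" "v \<in> carrier G"
  shows "groth_rel G `` {(x, y)} \<otimes>\<^bsub>groth_group G\<^esub> groth_rel G `` {(u, v)} = groth_rel G `` {(x \<otimes> u, y \<otimes> v)}"
proof -
  have "(\<lambda>a b. case a of (x, y) \<Rightarrow> case b of (x', y') \<Rightarrow> groth_rel G `` {(x \<otimes> x', y \<otimes> y')})
      respects2 groth_rel G"
    by (rule congruent2I', clarsimp, rule equiv_class_eq[OF equiv_groth_rel], rule groth_rel_mult)
  from UN_equiv_class2[OF equiv_groth_rel equiv_groth_rel this, of "(x, y)" "(u, v)"] assms
  show ?thesis by (simp add: groth_group_def case_prod_unfold)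
qed

end

text \<open>Surjectivity of \<open>f\<close> brings the stabilising element of \<open>N\<close> back
  to \<open>M\<close>; injectivity then reflects the equation.\<close>

lemma groth_map_iso:
  assumes "comm_monoid M" "comm_monoid N" and f: "f \<in> iso M N"
  shows "groth_map N f \<in> iso (groth_group M) (groth_group N)"
proof -
  interpret M: comm_monoid M by fact
  interpret N: comm_monoid N by fact
  have fc: "\<And>x. x \<in> carrier M \<Longrightarrow> f x \<in> carrier N"
    and fm: "\<And>x y. x \<in> carrier M \<Longrightarrow> y \<in> carrier M \<Longrightarrow> f (x \<otimes>\<^bsub>M\<^esub> y) = f x \<otimes>\<^bsub>N\<^esub> f y"
    and inj: "inj_on f (carrier M)" and surj: "f ` carrier M = carrier N"
    using f by (auto simp: iso_def hom_def bij_betw_def)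
  have rel: "((f x, f y), (f x', f y')) \<in> groth_rel N \<longleftrightarrow> ((x, y), (x', y')) \<in> groth_rel M"
    if c: "x \<in> carrier M" "y \<in> carrier M" "x' \<in> carrier M" "y' \<in> carrier M" for x y x' y'
  proof -
    have "(f x \<otimes>\<^bsub>N\<^esub> f y' \<otimes>\<^bsub>N\<^esub> f z = f x' \<otimes>\<^bsub>N\<^esub> f y \<otimes>\<^bsub>N\<^esub> f z) \<longleftrightarrow> (x \<otimes>\<^bsub>M\<^esub> y' \<otimes>\<^bsub>M\<^esub> z = x' \<otimes>\<^bsub>M\<^esub> y \<otimes>\<^bsub>M\<^esub> z)"
      if "z \<in> carrier M" for z
      using c that inj by (simp add: inj_on_eq_iff flip: fm)
    then show ?thesis unfolding M.groth_rel_iff N.groth_rel_iff using c fc by (simp flip: surj)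
  qed
  have cls: "groth_map N f (groth_rel M `` {(x, y)}) = groth_rel N `` {(f x, f y)}"
    if c: "x \<in> carrier M" "y \<in> carrier M" for x y
  proof -
    have "(\<lambda>(x, y). groth_rel N `` {(f x, f y)}) respects groth_rel M"
      by (auto simp: congruent_def M.groth_rel_iff intro!: equiv_class_eq[OF N.equiv_groth_rel] rel[THEN iffD2])
    from UN_equiv_class[OF M.equiv_groth_rel this, of "(x, y)"] c show ?thesis
      by (simp add: groth_map_def case_prod_unfold)
  qed
  have carr: "carrier (groth_group K) = {groth_rel K `` {(x, y)} | x y. x \<in> carrier K \<and> y \<in> carrier K}"
    for K :: "('z, 'w) monoid_scheme"
    by (auto simp: groth_group_def quotient_def)
  show ?thesis
  proof (rule isoI)
    show "groth_map N f \<in> hom (groth_group M) (groth_group N)"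
    proof (rule homI)
      fix P assume "P \<in> carrier (groth_group M)"
      then show "groth_map N f P \<in> carrier (groth_group N)" unfolding carr using cls fc by blast
    next
      fix P Q assume "P \<in> carrier (groth_group M)" "Q \<in> carrier (groth_group M)"
      then obtain x y u v where c: "x \<in> carrier M" "y \<in> carrier M" "u \<in> carrier M" "v \<in> carrier M"
        and PQ: "P = groth_rel M `` {(x, y)}" "Q = groth_rel M `` {(u, v)}" unfolding carr by blast
      then show "groth_map N f (P \<otimes>\<^bsub>groth_group M\<^esub> Q) = groth_map N f P \<otimes>\<^bsub>groth_group N\<^esub> groth_map N f Q"
        using fc by (simp add: M.groth_mult_class N.groth_mult_class cls fm)
    qed
    show "bij_betw (groth_map N f) (carrier (groth_group M)) (carrier (groth_group N))"
      unfolding bij_betw_def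
    proof
      show "inj_on (groth_map N f) (carrier (groth_group M))"
      proof (rule inj_onI)
        fix P Q assume "P \<in> carrier (groth_group M)" "Q \<in> carrier (groth_group M)"
        then obtain x y u v where c: "x \<in> carrier M" "y \<in> carrier M" "u \<in> carrier M" "v \<in> carrier M"
          and PQ: "P = groth_rel M `` {(x, y)}" "Q = groth_rel M `` {(u, v)}" unfolding carr by blast
        assume "groth_map N f P = groth_map N f Q"
        then show "P = Q" unfolding PQ using c fc
          by (simp add: cls M.groth_class_eq_iff N.groth_class_eq_iff rel)
      qed
      show "groth_map N f ` carrier (groth_group M) = carrier (groth_group N)"
      proof
        show "groth_map N f ` carrier (groth_group M) \<subseteq> carrier (groth_group N)"
          unfolding carr using cls fc by blast
        show "carrier (groth_group N) \<subseteq> groth_map N f ` carrier (groth_group M)"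
        proof
          fix Q assume "Q \<in> carrier (groth_group N)"
          then obtain x y where "x \<in> carrier M" "y \<in> carrier M" "Q = groth_rel N `` {(f x, f y)}"
            unfolding carr surj[symmetric] by blast
          then have "Q = groth_map N f (groth_rel M `` {(x, y)})" "groth_rel M `` {(x, y)} \<in> carrier (groth_group M)"
            unfolding carr by (auto simp: cls)
          then show "Q \<in> groth_map N f ` carrier (groth_group M)" by blast
        qed
      qed
    qed
  qed
qed

section \<open>Block sums and equivalence of idempotents\<close>

lemma block_sum_carrier:
  "a \<in> carrier_mat n m \<Longrightarrow> b \<in> carrier_mat k l \<Longrightarrow> block_sum a b \<in> carrier_mat (n + k) (m + l)"
  by (simp add: block_sum_def)

lemma block_sum_dim [simp]: "dim_row (block_sum a b) = dim_row a + dim_row b"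
  "dim_col (block_sum a b) = dim_col a + dim_col b"
  by (simp_all add: block_sum_def)

lemma block_sum_eq: "a \<in> carrier_mat n m \<Longrightarrow> b \<in> carrier_mat k l \<Longrightarrow>
    block_sum a b = four_block_mat a (0\<^sub>m n l) (0\<^sub>m k m) b"
  by (auto simp: block_sum_def)

lemma block_sum_mult:
  fixes a b c d :: "'a::semiring_0 mat"
  assumes "a \<in> carrier_mat n m" "b \<in> carrier_mat n' m'" "c \<in> carrier_mat m k" "d \<in> carrier_mat m' k'"
  shows "block_sum a b * block_sum c d = block_sum (a * c) (b * d)"
  unfolding block_sum_eq[OF assms(1,2)] block_sum_eq[OF assms(3,4)]
    block_sum_eq[OF mult_carrier_mat[OF assms(1,3)] mult_carrier_mat[OF assms(2,4)]]
  using assms by (subst mult_four_block_mat) auto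

lemma block_sum_assoc: "block_sum (block_sum a b) c = block_sum a (block_sum b c)"
  unfolding block_sum_def by (rule assoc_four_block_mat[symmetric])

lemma block_sum_empty: "a \<in> carrier_mat n n \<Longrightarrow> block_sum (0\<^sub>m 0 0) a = a" "a \<in> carrier_mat n n \<Longrightarrow> block_sum a (0\<^sub>m 0 0) = a"
  by (auto simp: block_sum_def intro!: eq_matI)

lemma idempotentI: "e \<in> carrier_mat n n \<Longrightarrow> e * e = e \<Longrightarrow> e \<in> idempotents"
  by (auto simp: idempotents_def)

lemma idempotentE:
  assumes "e \<in> idempotents" obtains n where "e \<in> carrier_mat n n" "e * e = e"
  using assms by (auto simp: idempotents_def)

lemma block_sum_idempotents: "e \<in> idempotents \<Longrightarrow> f \<in> idempotents \<Longrightarrow> block_sum e f \<in> idempotents"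
  by (elim idempotentE, rule idempotentI[OF block_sum_carrier]) (auto simp: block_sum_mult)

lemma idem_relI:
  assumes "e \<in> carrier_mat n n" "f \<in> carrier_mat m m" "e * e = e" "f * f = f"
    "x \<in> carrier_mat n m" "y \<in> carrier_mat m n" "x * y = e" "y * x = f"
  shows "(e, f) \<in> idem_rel"
  using assms by (auto simp: idem_rel_def idempotentI)

lemma idem_relE:
  assumes "(e, f) \<in> idem_rel"
  obtains n m x y where "e \<in> carrier_mat n n" "f \<in> carrier_mat m m" "e * e = e" "f * f = f"
    "x \<in> carrier_mat n m" "y \<in> carrier_mat m n" "x * y = e" "y * x = f"
proof -
  from assms obtain x y where xy: "e \<in> idempotents" "f \<in> idempotents" "x \<in> carrier_mat (dim_row e) (dim_row f)"
    "y \<in> carrier_mat (dim_row f) (dim_row e)" "x * y = e" "y * x = f" unfolding idem_rel_def by blast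
  obtain n where "e \<in> carrier_mat n n" "e * e = e" by (rule idempotentE[OF xy(1)])
  moreover obtain m where "f \<in> carrier_mat m m" "f * f = f" by (rule idempotentE[OF xy(2)])
  ultimately show ?thesis using xy by (intro that[of n m x y]) auto
qed

lemma mat_mult_regroup:
  fixes a b c d :: "'a::semiring_0 mat"
  assumes "a \<in> carrier_mat n1 n2" "b \<in> carrier_mat n2 n3" "c \<in> carrier_mat n3 n4" "d \<in> carrier_mat n4 n5"
  shows "(a * b) * (c * d) = a * (b * c) * d"
proof -
  have "(a * b) * (c * d) = a * (b * (c * d))" by (rule assoc_mult_mat) (use assms in auto)
  also have "b * (c * d) = (b * c) * d" by (rule assoc_mult_mat[symmetric]) (use assms in auto)
  also have "a * ((b * c) * d) = a * (b * c) * d" by (rule assoc_mult_mat[symmetric]) (use assms in auto)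
  finally show ?thesis .
qed

lemma equiv_idem_rel: "equiv idempotents (idem_rel :: ('a::complex_banach_algebra mat \<times> 'a mat) set)"
proof (rule equivI)
  show "idem_rel \<subseteq> idempotents \<times> (idempotents :: 'a mat set)" by (auto simp: idem_rel_def)
  show "refl_on idempotents (idem_rel :: ('a mat \<times> 'a mat) set)"
    by (auto simp: refl_on_def elim!: idempotentE intro: idem_relI)
  show "sym (idem_rel :: ('a mat \<times> 'a mat) set)"
    by (rule symI) (auto elim!: idem_relE intro: idem_relI)
  show "trans (idem_rel :: ('a mat \<times> 'a mat) set)"
  proof (rule transI)
    fix e f g :: "'a mat" assume ef: "(e, f) \<in> idem_rel" and fg: "(f, g) \<in> idem_rel"
    obtain n m x y where 1: "e \<in> carrier_mat n n" "f \<in> carrier_mat m m" "e * e = e" "f * f = f"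
      "x \<in> carrier_mat n m" "y \<in> carrier_mat m n" "x * y = e" "y * x = f" by (rule idem_relE[OF ef])
    obtain m' k u v where 2: "f \<in> carrier_mat m' m'" "g \<in> carrier_mat k k" "g * g = g"
      "u \<in> carrier_mat m' k" "v \<in> carrier_mat k m'" "u * v = f" "v * u = g" by (rule idem_relE[OF fg])
    have m': "m' = m" using 1 2 by auto
    note 2 = 2[unfolded m']
    have a: "(x * u) * (v * y) = e"
    proof -
      have "(x * u) * (v * y) = x * (u * v) * y" by (rule mat_mult_regroup) (use 1 2 in auto)
      also have "\<dots> = x * (y * x) * y" unfolding 2(6) 1(8) ..
      also have "\<dots> = (x * y) * (x * y)" by (rule mat_mult_regroup[symmetric]) (use 1 in auto)
      finally show ?thesis unfolding 1(7) 1(3) .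
    qed
    have b: "(v * y) * (x * u) = g"
    proof -
      have "(v * y) * (x * u) = v * (y * x) * u" by (rule mat_mult_regroup) (use 1 2 in auto)
      also have "\<dots> = v * (u * v) * u" unfolding 2(6) 1(8) ..
      also have "\<dots> = (v * u) * (v * u)" by (rule mat_mult_regroup[symmetric]) (use 2 in auto)
      finally show ?thesis unfolding 2(7) 2(3) .
    qed
    show "(e, g) \<in> idem_rel"
      by (rule idem_relI[OF 1(1) 2(2) 1(3) 2(3) _ _ a b]) (use 1 2 in auto)
  qed
qed

lemma idem_rel_block_sum:
  assumes "(e, f) \<in> idem_rel" "(e', f') \<in> idem_rel"
  shows "(block_sum e e', block_sum f f') \<in> idem_rel"
proof -
  obtain n m x y where 1: "e \<in> carrier_mat n n" "f \<in> carrier_mat m m" "e * e = e" "f * f = f"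
    "x \<in> carrier_mat n m" "y \<in> carrier_mat m n" "x * y = e" "y * x = f" by (rule idem_relE[OF assms(1)])
  obtain n' m' x' y' where 2: "e' \<in> carrier_mat n' n'" "f' \<in> carrier_mat m' m'" "e' * e' = e'" "f' * f' = f'"
    "x' \<in> carrier_mat n' m'" "y' \<in> carrier_mat m' n'" "x' * y' = e'" "y' * x' = f'" by (rule idem_relE[OF assms(2)])
  show ?thesis
    by (rule idem_relI[of _ "n + n'" _ "m + m'" "block_sum x x'" "block_sum y y'"])
      (use 1 2 in \<open>auto intro: block_sum_carrier simp: block_sum_mult\<close>)
qed

lemma idem_rel_block_sum_commute:
  assumes "e \<in> idempotents" "f \<in> idempotents"
  shows "(block_sum e f, block_sum f e) \<in> idem_rel"
proof -
  obtain n where e: "e \<in> carrier_mat n n" "e * e = e" by (rule idempotentE[OF assms(1)])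
  obtain m where f: "f \<in> carrier_mat m m" "f * f = f" by (rule idempotentE[OF assms(2)])
  \<comment> \<open>The flip of the two summands, with \<open>e\<close> and \<open>f\<close> in
    place of the identity blocks.\<close>
  let ?x = "four_block_mat (0\<^sub>m n m) e f (0\<^sub>m m n)" and ?y = "four_block_mat (0\<^sub>m m n) f e (0\<^sub>m n m)"
  have xy: "?x * ?y = block_sum e f"
    unfolding block_sum_eq[OF e(1) f(1)] using e f by (subst mult_four_block_mat) auto
  have yx: "?y * ?x = block_sum f e"
    unfolding block_sum_eq[OF f(1) e(1)] using e f by (subst mult_four_block_mat) auto
  show ?thesis
  proof (rule idem_relI[OF block_sum_carrier[OF e(1) f(1)] block_sum_carrier[OF f(1) e(1)] _ _ _ _ xy yx])
    show "?x \<in> carrier_mat (n + m) (m + n)" "?y \<in> carrier_mat (m + n) (n + m)" by auto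
  qed (use e f in \<open>simp_all add: block_sum_mult\<close>)
qed

text \<open>The empty matrix is equivalent to a zero block through the empty rectangular matrices of
  sizes 0 by k and k by 0.\<close>

lemma idem_rel_block_sum_zero:
  fixes e :: "'a::complex_banach_algebra mat"
  assumes e: "e \<in> idempotents"
  shows "(e, block_sum e (0\<^sub>m k k)) \<in> idem_rel"
proof -
  have "(0\<^sub>m 0 0, 0\<^sub>m k k :: 'a mat) \<in> idem_rel"
    by (rule idem_relI[of _ 0 _ k "0\<^sub>m 0 k" "0\<^sub>m k 0"]) auto
  moreover have "(e, e) \<in> idem_rel" using equiv_idem_rel e by (auto simp: equiv_def refl_on_def)
  ultimately have "(block_sum e (0\<^sub>m 0 0), block_sum e (0\<^sub>m k k)) \<in> idem_rel" by (intro idem_rel_block_sum)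
  moreover have "block_sum e (0\<^sub>m 0 0) = e" using e by (auto elim!: idempotentE simp: block_sum_empty)
  ultimately show ?thesis by simp
qed

text \<open>With w the inverse of \<open>z\<close>, the pair w f and z e realises the
  equivalence.\<close>

lemma idem_rel_if_similar:
  fixes e f :: "'a::complex_banach_algebra mat"
  assumes e: "e \<in> carrier_mat n n" "e * e = e" and f: "f \<in> carrier_mat n n" "f * f = f"
    and z: "z \<in> GL n" "z * e = f * z"
  shows "(e, f) \<in> idem_rel"
proof -
  obtain w where w: "z \<in> carrier_mat n n" "w \<in> carrier_mat n n" "z * w = 1\<^sub>m n" "w * z = 1\<^sub>m n"
    using z GL_iff by blast
  have "(w * f) * (z * e) = w * (f * z) * e" by (rule mat_mult_regroup) (use w e f in auto)
  also have "\<dots> = (w * z) * (e * e)"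
    unfolding z(2)[symmetric] by (rule mat_mult_regroup[symmetric]) (use w e in auto)
  finally have 1: "(w * f) * (z * e) = e" using w e by (simp add: left_one_mat)
  have "(z * e) * (w * f) = f * (z * w) * f"
    unfolding z(2) by (rule mat_mult_regroup) (use w f in auto)
  then have 2: "(z * e) * (w * f) = f" using w f by (simp add: right_one_mat)
  show ?thesis by (rule idem_relI[OF e(1) f(1) e(2) f(2) _ _ 1 2]) (use w e f in auto)
qed

lemma one_minus_mult_mat:
  fixes e x :: "'a::complex_banach_algebra mat"
  assumes "e \<in> carrier_mat n n" "x \<in> carrier_mat n m" "e * x = x"
  shows "(1\<^sub>m n - e) * x = 0\<^sub>m n m"
  using assms by (simp add: minus_mult_distrib_mat[of _ n n] left_one_mat)

lemma mult_one_minus_mat: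
  fixes e y :: "'a::complex_banach_algebra mat"
  assumes "e \<in> carrier_mat n n" "y \<in> carrier_mat m n" "y * e = y"
  shows "y * (1\<^sub>m n - e) = 0\<^sub>m m n"
  using assms by (simp add: mult_minus_distrib_mat[OF assms(2) one_carrier_mat assms(1)] right_one_mat)

lemma one_minus_idempotent:
  fixes e :: "'a::complex_banach_algebra mat"
  assumes "e \<in> carrier_mat n n" "e * e = e"
  shows "(1\<^sub>m n - e) * (1\<^sub>m n - e) = 1\<^sub>m n - e"
proof -
  have c: "1\<^sub>m n - e \<in> carrier_mat n n" using assms by auto
  have "(1\<^sub>m n - e) * (1\<^sub>m n - e) = (1\<^sub>m n - e) * 1\<^sub>m n - (1\<^sub>m n - e) * e"
    by (rule mult_minus_distrib_mat[OF c]) (use assms in auto)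
  also have "\<dots> = 1\<^sub>m n - e"
    unfolding one_minus_mult_mat[OF assms(1,1,2)] right_one_mat[OF c] using assms by (auto intro: eq_matI)
  finally show ?thesis .
qed

text \<open>Equivalent idempotents of sizes \<open>n\<close> and \<open>m\<close> become similar in size \<open>n + m\<close>: after replacing
  \<open>x\<close>, \<open>y\<close> by \<open>x y x\<close>, \<open>y x y\<close> a similarity is given by the block matrix \<open>(y, 1 - f; 1 - e, x)\<close>.\<close>

lemma similar_if_idem_rel:
  fixes e f :: "'a::complex_banach_algebra mat"
  assumes rel: "(e, f) \<in> idem_rel" and n: "e \<in> carrier_mat n n" and m: "f \<in> carrier_mat m m"
  obtains z where "z \<in> GL (n + m)" "z * block_sum e (0\<^sub>m m m) = block_sum f (0\<^sub>m n n) * z"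
proof -
  obtain n' m' x0 y0 where "e \<in> carrier_mat n' n'" "f \<in> carrier_mat m' m'" and idem: "e * e = e" "f * f = f"
    and 0: "x0 \<in> carrier_mat n' m'" "y0 \<in> carrier_mat m' n'" "x0 * y0 = e" "y0 * x0 = f"
    by (rule idem_relE[OF rel])
  with n m have "n' = n" "m' = m" by auto
  note 0 = 0[unfolded this]
  define x where "x = e * x0"
  define y where "y = f * y0"
  have x: "x = x0 * f" unfolding x_def 0(3)[symmetric] 0(4)[symmetric] using 0(1,2) by simp
  have y: "y = y0 * e" unfolding y_def 0(3)[symmetric] 0(4)[symmetric] using 0(1,2) by simp
  have c: "x \<in> carrier_mat n m" "y \<in> carrier_mat m n" using 0 n m by (auto simp: x_def y_def)
  have ex: "e * x = x" and fy: "f * y = y"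
    using 0(1,2) n m by (simp_all add: x_def y_def idem flip: assoc_mult_mat)
  have xf: "x * f = x" and ye: "y * e = y" using 0(1,2) n m by (simp_all add: x y idem)
  have "x * y = e * (x0 * y0) * e" unfolding x_def y by (rule mat_mult_regroup) (use 0 n in auto)
  then have xy: "x * y = e" by (simp add: 0 idem)
  have "y * x = f * (y0 * x0) * f" unfolding y_def x by (rule mat_mult_regroup) (use 0 m in auto)
  then have yx: "y * x = f" by (simp add: 0 idem)
  let ?e = "1\<^sub>m n - e" and ?f = "1\<^sub>m m - f"
  have cc: "?e \<in> carrier_mat n n" "?f \<in> carrier_mat m m" using n m by auto
  note ee = one_minus_mult_mat[OF n n idem(1)] one_minus_mult_mat[OF n c(1) ex] mult_one_minus_mat[OF n c(2) ye]
    one_minus_idempotent[OF n idem(1)]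
  note ff = mult_one_minus_mat[OF m m idem(2)] one_minus_mult_mat[OF m c(2) fy] mult_one_minus_mat[OF m c(1) xf]
    one_minus_idempotent[OF m idem(2)]
  have one: "e + ?e = 1\<^sub>m n" "?e + e = 1\<^sub>m n" "f + ?f = 1\<^sub>m m" "?f + f = 1\<^sub>m m"
    using n m by auto
  \<comment> \<open>In both products the mixed blocks vanish because \<open>x\<close> and
    \<open>y\<close> absorb \<open>e\<close> and \<open>f\<close>; the diagonal blocks are sums such
    as f + (1 - f).\<close>
  let ?z = "four_block_mat y ?f ?e x" and ?w = "four_block_mat x ?e ?f y"
  have z: "?z \<in> carrier_mat (n + m) (n + m)" and w: "?w \<in> carrier_mat (n + m) (n + m)"
    using c by (metis add.commute four_block_carrier_mat)+
  have "?z * ?w = 1\<^sub>m (m + n)"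
    using c cc by (subst mult_four_block_mat) (auto simp: xy yx ee ff one)
  moreover have "?w * ?z = 1\<^sub>m (n + m)"
    using c cc by (subst mult_four_block_mat) (auto simp: xy yx ee ff one)
  ultimately have "?z \<in> GL (n + m)" unfolding GL_iff using z w by (auto simp: add.commute)
  moreover have "?z * block_sum e (0\<^sub>m m m) = block_sum f (0\<^sub>m n n) * ?z"
  proof -
    have "?z * block_sum e (0\<^sub>m m m) = four_block_mat y (0\<^sub>m m m) (0\<^sub>m n n) (0\<^sub>m n m)"
      unfolding block_sum_eq[OF n zero_carrier_mat] using c cc n m
      by (subst mult_four_block_mat) (auto simp: ye ee)
    also have "\<dots> = block_sum f (0\<^sub>m n n) * ?z"
      unfolding block_sum_eq[OF m zero_carrier_mat] using c cc n m
      by (subst mult_four_block_mat) (auto simp: fy ff)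
    finally show ?thesis .
  qed
  ultimately show ?thesis by (rule that)
qed


section \<open>The monoid of classes and the induced map\<close>

lemma idem_class_eq_iff:
  assumes "e \<in> idempotents" "f \<in> idempotents"
  shows "idem_rel `` {e} = idem_rel `` {f} \<longleftrightarrow> (e, f) \<in> idem_rel"
  using eq_equiv_class_iff[OF equiv_idem_rel assms] .

lemma V_mult_class:
  fixes e f :: "'a::complex_banach_algebra mat"
  assumes "e \<in> idempotents" "f \<in> idempotents"
  shows "(idem_rel `` {e}) \<otimes>\<^bsub>V_monoid TYPE('a)\<^esub> (idem_rel `` {f}) = idem_rel `` {block_sum e f}"
proof -
  have "(\<lambda>e f :: 'a mat. idem_rel `` {block_sum e f}) respects2 idem_rel"
    by (rule congruent2I', rule equiv_class_eq[OF equiv_idem_rel], rule idem_rel_block_sum)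
  from UN_equiv_class2[OF equiv_idem_rel equiv_idem_rel this assms]
  show ?thesis by (simp add: V_monoid_def)
qed

lemma carrier_V_monoid:
  "carrier (V_monoid TYPE('a::complex_banach_algebra)) = {idem_rel `` {e :: 'a mat} | e. e \<in> idempotents}"
  by (auto simp: V_monoid_def quotient_def)

lemma empty_mat_idempotent: "0\<^sub>m 0 0 \<in> idempotents"
  by (rule idempotentI[of _ 0]) auto

lemma comm_monoid_V_monoid: "comm_monoid (V_monoid TYPE('a::complex_banach_algebra))"
proof (rule comm_monoidI)
  let ?V = "V_monoid TYPE('a)"
  have one: "\<one>\<^bsub>?V\<^esub> = idem_rel `` {0\<^sub>m 0 0}" by (simp add: V_monoid_def)
  show "\<one>\<^bsub>?V\<^esub> \<in> carrier ?V" unfolding one carrier_V_monoid using empty_mat_idempotent by blast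
  fix P Q R assume "P \<in> carrier ?V" "Q \<in> carrier ?V" "R \<in> carrier ?V"
  then obtain e f g where e: "e \<in> idempotents" "P = idem_rel `` {e}" and f: "f \<in> idempotents" "Q = idem_rel `` {f}"
    and g: "g \<in> idempotents" "R = idem_rel `` {g}" unfolding carrier_V_monoid by blast
  show "P \<otimes>\<^bsub>?V\<^esub> Q \<in> carrier ?V"
    unfolding e f using e f by (auto simp: V_mult_class carrier_V_monoid block_sum_idempotents)
  show "P \<otimes>\<^bsub>?V\<^esub> Q \<otimes>\<^bsub>?V\<^esub> R = P \<otimes>\<^bsub>?V\<^esub> (Q \<otimes>\<^bsub>?V\<^esub> R)"
    unfolding e f g using e f g by (simp add: V_mult_class block_sum_idempotents block_sum_assoc)
  show "P \<otimes>\<^bsub>?V\<^esub> Q = Q \<otimes>\<^bsub>?V\<^esub> P"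
    unfolding e f using e f
    by (simp add: V_mult_class idem_class_eq_iff block_sum_idempotents idem_rel_block_sum_commute)
  have "block_sum (0\<^sub>m 0 0) e = e" using e(1) by (auto elim!: idempotentE simp: block_sum_empty)
  then show "\<one>\<^bsub>?V\<^esub> \<otimes>\<^bsub>?V\<^esub> P = P"
    unfolding one e using e by (simp add: V_mult_class empty_mat_idempotent)
qed

context algebra_morphism
begin

lemma \<phi>m_idempotents: "e \<in> idempotents \<Longrightarrow> \<phi>m e \<in> idempotents"
  by (auto elim!: idempotentE intro!: idempotentI simp flip: \<phi>m_mult)

lemma \<phi>m_block_sum: "\<phi>m (block_sum a b) = block_sum (\<phi>m a) (\<phi>m b)"
  by (intro eq_matI) (auto simp: block_sum_def \<phi>_0)

lemma \<phi>m_idem_rel: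
  assumes "(e, f) \<in> idem_rel"
  shows "(\<phi>m e, \<phi>m f) \<in> idem_rel"
proof -
  obtain n m x y where 1: "e \<in> carrier_mat n n" "f \<in> carrier_mat m m" "e * e = e" "f * f = f"
    "x \<in> carrier_mat n m" "y \<in> carrier_mat m n" "x * y = e" "y * x = f" by (rule idem_relE[OF assms])
  show ?thesis
    by (rule idem_relI[of _ n _ m "\<phi>m x" "\<phi>m y"]) (use 1 in \<open>auto simp flip: \<phi>m_mult\<close>)
qed

lemma V_map_class:
  assumes "e \<in> idempotents"
  shows "V_map \<phi> (idem_rel `` {e}) = idem_rel `` {\<phi>m e}"
proof -
  have "(\<lambda>e. idem_rel `` {\<phi>m e}) respects idem_rel"
    by (auto simp: congruent_def intro!: equiv_class_eq[OF equiv_idem_rel] \<phi>m_idem_rel)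
  from UN_equiv_class[OF equiv_idem_rel this assms] show ?thesis by (simp add: V_map_def)
qed

end

context dense_crs_morphism
begin

text \<open>Zero blocks bring both idempotents to size n + m. There equivalence of the images is a
  similarity, which reflects to the source; the blocks are then removed up to equivalence.\<close>

lemma idem_rel_reflect:
  assumes e: "e \<in> idempotents" and f: "f \<in> idempotents" and rel: "(\<phi>m e, \<phi>m f) \<in> idem_rel"
  shows "(e, f) \<in> idem_rel"
proof -
  obtain n where n: "e \<in> carrier_mat n n" "e * e = e" by (rule idempotentE[OF e])
  obtain m where m: "f \<in> carrier_mat m m" "f * f = f" by (rule idempotentE[OF f])
  show ?thesis
  proof (cases "n + m = 0")
    \<comment> \<open>Size 0 is outside the range of the spectral hypothesis, but there is only one
      matrix of that size.\<close>
    case True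
    then have "e = f" using n m by (intro eq_matI) auto
    then show ?thesis using equiv_idem_rel e by (auto simp: equiv_def refl_on_def)
  next
    case False
    let ?e = "block_sum e (0\<^sub>m m m)" and ?f = "block_sum f (0\<^sub>m n n)"
    have c: "?e \<in> carrier_mat (n + m) (n + m)" "?f \<in> carrier_mat (n + m) (n + m)"
      using block_sum_carrier[OF n(1) zero_carrier_mat[of m m]] block_sum_carrier[OF m(1) zero_carrier_mat[of n n]]
      by (simp_all add: add.commute)
    have idem: "?e * ?e = ?e" "?f * ?f = ?f" using n m block_sum_mult[OF n(1) zero_carrier_mat n(1) zero_carrier_mat, of m m m]
        block_sum_mult[OF m(1) zero_carrier_mat m(1) zero_carrier_mat, of n n n] by simp_all
    obtain z where z: "z \<in> GL (n + m)" "z * \<phi>m ?e = \<phi>m ?f * z"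
      using similar_if_idem_rel[OF rel, of n m] n m by (auto simp: \<phi>m_block_sum \<phi>m_zero)
    have "n + m \<ge> 1" using False by linarith
    then obtain w where "w \<in> GL (n + m)" "w * ?e = ?f * w"
      using idempotent_similar_reflect[OF _ c(1) idem(1) c(2) idem(2) z] by blast
    then have "(?e, ?f) \<in> idem_rel" by (rule idem_rel_if_similar[OF c(1) idem(1) c(2) idem(2)])
    with idem_rel_block_sum_zero[OF e, of m] idem_rel_block_sum_zero[OF f, of n] show ?thesis
      using equiv_idem_rel[where 'a='a] unfolding equiv_def by (meson symD transD)
  qed
qed

lemma idem_rel_surj:
  assumes "f \<in> idempotents"
  obtains e where "e \<in> idempotents" "(\<phi>m e, f) \<in> idem_rel"
proof -
  obtain n where n: "f \<in> carrier_mat n n" "f * f = f" by (rule idempotentE[OF assms])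
  show ?thesis
  proof (cases "n = 0")
    case True
    then have f: "f = 0\<^sub>m 0 0" using n by (intro eq_matI) auto
    have "(\<phi>m (0\<^sub>m 0 0), f) \<in> idem_rel"
      unfolding f \<phi>m_zero using equiv_idem_rel[where 'a='b] empty_mat_idempotent[where 'a='b]
      by (auto simp: equiv_def refl_on_def)
    then show ?thesis by (rule that[OF empty_mat_idempotent])
  next
    case False
    then obtain e z where e: "e \<in> carrier_mat n n" "e * e = e" "z \<in> GL n" "z * \<phi>m e = f * z"
      using idempotent_lift[OF _ n] by (metis One_nat_def Suc_leI neq0_conv)
    have "(\<phi>m e, f) \<in> idem_rel"
      by (rule idem_rel_if_similar[OF _ _ n e(3,4)]) (use e in \<open>auto simp flip: \<phi>m_mult\<close>)
    then show ?thesis using e by (intro that[of e] idempotentI)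
  qed
qed

lemma V_map_iso: "V_map \<phi> \<in> iso (V_monoid TYPE('a)) (V_monoid TYPE('b))"
proof (rule isoI)
  let ?A = "V_monoid TYPE('a)" and ?B = "V_monoid TYPE('b)"
  have into: "V_map \<phi> P \<in> carrier ?B" if "P \<in> carrier ?A" for P
    using that \<phi>m_idempotents unfolding carrier_V_monoid by (auto simp: V_map_class)
  show "V_map \<phi> \<in> hom ?A ?B"
  proof (rule homI[OF into])
    fix P Q assume "P \<in> carrier ?A" "Q \<in> carrier ?A"
    then obtain e f where e: "e \<in> idempotents" "P = idem_rel `` {e}" and f: "f \<in> idempotents" "Q = idem_rel `` {f}"
      unfolding carrier_V_monoid by blast
    then show "V_map \<phi> (P \<otimes>\<^bsub>?A\<^esub> Q) = V_map \<phi> P \<otimes>\<^bsub>?B\<^esub> V_map \<phi> Q"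
      by (simp add: V_mult_class V_map_class \<phi>m_idempotents block_sum_idempotents \<phi>m_block_sum)
  qed
  show "bij_betw (V_map \<phi>) (carrier ?A) (carrier ?B)"
    unfolding bij_betw_def
  proof
    show "inj_on (V_map \<phi>) (carrier ?A)"
      unfolding carrier_V_monoid
      by (rule inj_onI, clarify)
        (simp only: V_map_class idem_class_eq_iff \<phi>m_idempotents idem_rel_reflect)
    show "V_map \<phi> ` carrier ?A = carrier ?B"
    proof
      show "V_map \<phi> ` carrier ?A \<subseteq> carrier ?B" using into by blast
      show "carrier ?B \<subseteq> V_map \<phi> ` carrier ?A"
      proof
        fix Q assume "Q \<in> carrier ?B"
        then obtain f where f: "f \<in> idempotents" "Q = idem_rel `` {f}" unfolding carrier_V_monoid by blast
        obtain e where e: "e \<in> idempotents" "(\<phi>m e, f) \<in> idem_rel" by (rule idem_rel_surj[OF f(1)])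
        then have "Q = V_map \<phi> (idem_rel `` {e})"
          using f by (simp add: V_map_class idem_class_eq_iff[symmetric] \<phi>m_idempotents)
        moreover have "idem_rel `` {e} \<in> carrier ?A" using e unfolding carrier_V_monoid by blast
        ultimately show "Q \<in> V_map \<phi> ` carrier ?A" by blast
      qed
    qed
  qed
qed

lemma K0_map_iso: "K0_map \<phi> \<in> iso (K0 TYPE('a)) (K0 TYPE('b))"
  unfolding K0_map_def K0_def by (intro groth_map_iso comm_monoid_V_monoid V_map_iso)

end


section \<open>The isomorphism on \<open>K\<^sub>1\<close>\<close>

lemma GL_carrier: "u \<in> GL n \<Longrightarrow> u \<in> carrier_mat n n"
  by (simp add: GL_iff)

lemma topspace_GL_topology: "topspace (GL_topology n) = GL n"
  by (auto simp: GL_topology_def topspace_mat_topology GL_iff)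

lemma pathin_GL_iff:
  "pathin (GL_topology n) g \<longleftrightarrow>
     (\<forall>t\<in>{0..1}. g t \<in> GL n) \<and> (\<forall>i<n. \<forall>j<n. continuous_on {0..1} (\<lambda>t. g t $$ (i, j)))"
  by (auto simp: pathin_def GL_topology_def continuous_map_in_subtopology continuous_map_mat_topology_iff Pi_iff
      dest: GL_carrier)

lemma GL_dim: "u \<in> GL n \<Longrightarrow> dim_row u = n" "u \<in> GL n \<Longrightarrow> dim_col u = n"
  using GL_carrier by blast+

lemma GL_mult:
  fixes u v :: "'a::complex_banach_algebra mat"
  assumes "u \<in> GL n" "v \<in> GL n"
  shows "u * v \<in> GL n"
proof -
  obtain u' v' where c: "u \<in> carrier_mat n n" "u' \<in> carrier_mat n n" "v \<in> carrier_mat n n" "v' \<in> carrier_mat n n"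
    and "u * u' = 1\<^sub>m n" "u' * u = 1\<^sub>m n" "v * v' = 1\<^sub>m n" "v' * v = 1\<^sub>m n"
    using assms unfolding GL_iff by blast
  moreover have "(u * v) * (v' * u') = u * (v * v') * u'" "(v' * u') * (u * v) = v' * (u' * u) * v"
    by (rule mat_mult_regroup; use c in auto)+
  ultimately show ?thesis unfolding GL_iff using c
    by (intro conjI bexI[of _ "v' * u'"]) (auto simp: right_one_mat)
qed

lemma block_sum_one: "block_sum (1\<^sub>m n) (1\<^sub>m m) = 1\<^sub>m (n + m)"
  by (simp add: block_sum_def)

lemma stabilize_carrier: "u \<in> carrier_mat n n \<Longrightarrow> n \<le> k \<Longrightarrow> stabilize k u \<in> carrier_mat k k"
  unfolding stabilize_def using block_sum_carrier[of u n n "1\<^sub>m (k - n)" "k - n" "k - n"] by auto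

lemma stabilize_index:
  assumes "u \<in> carrier_mat n n" "n \<le> k" "i < k" "j < k"
  shows "stabilize k u $$ (i, j) = (if i < n \<and> j < n then u $$ (i, j) else if i = j then 1 else 0)"
  using assms by (auto simp: stabilize_def block_sum_def)

lemma stabilize_self: "u \<in> carrier_mat n n \<Longrightarrow> stabilize n u = u"
  using stabilize_carrier[of u n n] by (intro eq_matI) (auto simp: stabilize_index)

lemma stabilize_stabilize:
  assumes u: "u \<in> carrier_mat n n" and "n \<le> k" "k \<le> l"
  shows "stabilize l (stabilize k u) = stabilize l u"
proof -
  have le: "n \<le> l" using assms by simp
  note c = stabilize_carrier[OF u assms(2)]
  note cl = stabilize_carrier[OF c assms(3)] stabilize_carrier[OF u le]
  show ?thesis
  proof (rule eq_matI)
    fix i j assume "i < dim_row (stabilize l u)" "j < dim_col (stabilize l u)"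
    then have "i < l" "j < l" unfolding carrier_matD[OF cl(2)] .
    then show "stabilize l (stabilize k u) $$ (i, j) = stabilize l u $$ (i, j)"
      using assms(2) stabilize_index[OF u assms(2), of i j]
      unfolding stabilize_index[OF c assms(3) \<open>i < l\<close> \<open>j < l\<close>] stabilize_index[OF u le \<open>i < l\<close> \<open>j < l\<close>]
      by auto
  qed (simp_all only: carrier_matD[OF cl(1)] carrier_matD[OF cl(2)])
qed

lemma stabilize_mult:
  fixes u v :: "'a::complex_banach_algebra mat"
  assumes "u \<in> carrier_mat n n" "v \<in> carrier_mat n n" "n \<le> k"
  shows "stabilize k (u * v) = stabilize k u * stabilize k v"
  using assms block_sum_mult[of u n n "1\<^sub>m (k - n)" "k - n" "k - n" v n "1\<^sub>m (k - n)" "k - n"]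
  by (simp add: stabilize_def left_one_mat[OF one_carrier_mat])

lemma stabilize_one: "n \<le> k \<Longrightarrow> stabilize k (1\<^sub>m n) = 1\<^sub>m k"
  by (simp add: stabilize_def block_sum_one)

lemma stabilize_GL:
  fixes u :: "'a::complex_banach_algebra mat"
  assumes u: "u \<in> GL n" and "n \<le> k"
  shows "stabilize k u \<in> GL k"
proof -
  obtain w where w: "u \<in> carrier_mat n n" "w \<in> carrier_mat n n" "u * w = 1\<^sub>m n" "w * u = 1\<^sub>m n"
    using u GL_iff by blast
  then have "stabilize k u * stabilize k w = 1\<^sub>m k" "stabilize k w * stabilize k u = 1\<^sub>m k"
    using \<open>n \<le> k\<close> by (simp_all add: stabilize_one flip: stabilize_mult[of _ n])
  then show ?thesis unfolding GL_iff using w stabilize_carrier[OF _ \<open>n \<le> k\<close>] by blast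
qed

lemma path_stabilize:
  fixes u v :: "'a::complex_banach_algebra mat"
  assumes "path_component_of (GL_topology n) u v" "n \<le> k"
  shows "path_component_of (GL_topology k) (stabilize k u) (stabilize k v)"
proof -
  obtain g where g: "pathin (GL_topology n) g" "g 0 = u" "g 1 = v"
    using assms(1) unfolding path_component_of_def by blast
  have "pathin (GL_topology k) (\<lambda>t. stabilize k (g t))"
    unfolding pathin_GL_iff
  proof (intro conjI ballI allI impI)
    show "stabilize k (g t) \<in> GL k" if "t \<in> {0..1}" for t
      using that g(1) assms(2) unfolding pathin_GL_iff by (blast intro: stabilize_GL)
    fix i j assume ij: "i < k" "j < k"
    have "continuous_on {0..1} (\<lambda>t. if i < n \<and> j < n then g t $$ (i, j) else if i = j then 1 else 0)"
      using g(1) unfolding pathin_GL_iff by (cases "i < n \<and> j < n") auto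
    then show "continuous_on {0..1} (\<lambda>t. stabilize k (g t) $$ (i, j))"
      by (rule continuous_on_eq) (use g(1) ij assms(2) in \<open>simp add: pathin_GL_iff GL_carrier stabilize_index[of _ n]\<close>)
  qed
  then show ?thesis unfolding path_component_of_def using g by (intro exI[of _ "\<lambda>t. stabilize k (g t)"]) simp
qed

lemma path_mult:
  fixes u v u' v' :: "'a::complex_banach_algebra mat"
  assumes "path_component_of (GL_topology n) u u'" "path_component_of (GL_topology n) v v'"
  shows "path_component_of (GL_topology n) (u * v) (u' * v')"
proof -
  obtain g where g: "pathin (GL_topology n) g" "g 0 = u" "g 1 = u'"
    using assms(1) unfolding path_component_of_def by blast
  obtain h where h: "pathin (GL_topology n) h" "h 0 = v" "h 1 = v'"
    using assms(2) unfolding path_component_of_def by blast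
  have "pathin (GL_topology n) (\<lambda>t. g t * h t)"
    unfolding pathin_GL_iff
  proof (intro conjI ballI allI impI)
    show "g t * h t \<in> GL n" if "t \<in> {0..1}" for t
      using that g(1) h(1) unfolding pathin_GL_iff by (blast intro: GL_mult)
    fix i j assume ij: "i < n" "j < n"
    have "continuous_on {0..1} (\<lambda>t. \<Sum>k<n. g t $$ (i, k) * h t $$ (k, j))"
      using g(1) h(1) ij unfolding pathin_GL_iff by (intro continuous_intros) auto
    moreover have "(\<Sum>k<n. g t $$ (i, k) * h t $$ (k, j)) = (g t * h t) $$ (i, j)" if "t \<in> {0..1}" for t
    proof -
      have "g t \<in> carrier_mat n n" "h t \<in> carrier_mat n n"
        using that g(1) h(1) unfolding pathin_GL_iff by (blast intro: GL_carrier)+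
      then show ?thesis using ij by (auto simp: scalar_prod_def lessThan_atLeast0 intro!: sum.cong)
    qed
    ultimately show "continuous_on {0..1} (\<lambda>t. (g t * h t) $$ (i, j))" by (rule continuous_on_eq)
  qed
  then show ?thesis unfolding path_component_of_def using g h by (intro exI[of _ "\<lambda>t. g t * h t"]) simp
qed

lemma K1_relI:
  assumes "u \<in> GL n" "v \<in> GL m" "n \<le> k" "m \<le> k"
    "path_component_of (GL_topology k) (stabilize k u) (stabilize k v)"
  shows "(u, v) \<in> K1_rel"
  unfolding K1_rel_def using assms GL_dim(1)[OF assms(1)] GL_dim(1)[OF assms(2)]
  by (intro CollectI case_prodI conjI exI[of _ k]) auto

text \<open>Padding a path by 1 extends the relation to every larger size, so several related pairs
  can be compared at a common size.\<close>

lemma K1_relE: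
  fixes u v :: "'a::complex_banach_algebra mat"
  assumes "(u, v) \<in> K1_rel"
  obtains n m k where "u \<in> GL n" "v \<in> GL m" "n \<le> k" "m \<le> k"
    "\<And>l. k \<le> l \<Longrightarrow> path_component_of (GL_topology l) (stabilize l u) (stabilize l v)"
proof -
  obtain n m k where 1: "u \<in> GL n" "v \<in> GL m" "max (dim_row u) (dim_row v) \<le> k"
    and p: "path_component_of (GL_topology k) (stabilize k u) (stabilize k v)"
    using assms unfolding K1_rel_def by blast
  then have le: "n \<le> k" "m \<le> k" by (auto simp: GL_dim)
  have "path_component_of (GL_topology l) (stabilize l u) (stabilize l v)" if "k \<le> l" for l
    using path_stabilize[OF p that] stabilize_stabilize[OF GL_carrier[OF 1(1)] le(1) that]
      stabilize_stabilize[OF GL_carrier[OF 1(2)] le(2) that] by simp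
  with 1 le show ?thesis by (intro that)
qed

lemma equiv_K1_rel: "equiv (\<Union>n. GL n) (K1_rel :: ('a::complex_banach_algebra mat \<times> 'a mat) set)"
proof (rule equivI)
  show "K1_rel \<subseteq> (\<Union>n. GL n) \<times> (\<Union>n. GL n :: 'a mat set)" by (auto simp: K1_rel_def)
  show "refl_on (\<Union>n. GL n) (K1_rel :: ('a mat \<times> 'a mat) set)"
  proof (rule refl_onI)
    fix u :: "'a mat" assume "u \<in> (\<Union>n. GL n)"
    then obtain n where "u \<in> GL n" by blast
    then show "(u, u) \<in> K1_rel"
      by (intro K1_relI[of u n u n n])
        (auto simp: path_component_of_refl topspace_GL_topology intro: stabilize_GL)
  qed
  show "sym (K1_rel :: ('a mat \<times> 'a mat) set)"
  proof (rule symI)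
    fix u v :: "'a mat" assume uv: "(u, v) \<in> K1_rel"
    obtain n m k where "u \<in> GL n" "v \<in> GL m" "n \<le> k" "m \<le> k"
      "\<And>l. k \<le> l \<Longrightarrow> path_component_of (GL_topology l) (stabilize l u) (stabilize l v)"
      by (rule K1_relE[OF uv]) blast
    then show "(v, u) \<in> K1_rel"
      by (intro K1_relI[of v m u n k]) (auto simp: path_component_of_sym)
  qed
  show "trans (K1_rel :: ('a mat \<times> 'a mat) set)"
  proof (rule transI)
    fix u v w :: "'a mat" assume uv: "(u, v) \<in> K1_rel" and vw: "(v, w) \<in> K1_rel"
    obtain n m k where 1: "u \<in> GL n" "v \<in> GL m" "n \<le> k" "m \<le> k"
      "\<And>l. k \<le> l \<Longrightarrow> path_component_of (GL_topology l) (stabilize l u) (stabilize l v)"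
      by (rule K1_relE[OF uv]) blast
    obtain m' r k' where 2: "v \<in> GL m'" "w \<in> GL r" "m' \<le> k'" "r \<le> k'"
      "\<And>l. k' \<le> l \<Longrightarrow> path_component_of (GL_topology l) (stabilize l v) (stabilize l w)"
      by (rule K1_relE[OF vw]) blast
    show "(u, w) \<in> K1_rel"
      using path_component_of_trans[OF 1(5)[of "max k k'"] 2(5)[of "max k k'"]] 1(1-4) 2(1-4)
      by (intro K1_relI[of u n w r "max k k'"]) auto
  qed
qed

lemma stable_mult_GL:
  assumes "u \<in> GL n" "v \<in> GL m"
  shows "stable_mult u v \<in> GL (max n m)"
  unfolding stable_mult_def Let_def GL_dim(1)[OF assms(1)] GL_dim(1)[OF assms(2)]
  using assms by (intro GL_mult stabilize_GL) auto

lemma stabilize_stable_mult: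
  fixes u v :: "'a::complex_banach_algebra mat"
  assumes "u \<in> GL n" "v \<in> GL m" "max n m \<le> k"
  shows "stabilize k (stable_mult u v) = stabilize k u * stabilize k v"
proof -
  have "stabilize k (stable_mult u v) = stabilize k (stabilize (max n m) u) * stabilize k (stabilize (max n m) v)"
    unfolding stable_mult_def Let_def GL_dim(1)[OF assms(1)] GL_dim(1)[OF assms(2)]
    by (rule stabilize_mult[OF _ _ assms(3)]) (use assms in \<open>auto intro: stabilize_carrier GL_carrier\<close>)
  then show ?thesis
    using stabilize_stabilize[OF GL_carrier[OF assms(1)] _ assms(3)]
      stabilize_stabilize[OF GL_carrier[OF assms(2)] _ assms(3)] by simp
qed

text \<open>At a common size, stable products become ordinary products, and paths multiply
  pointwise.\<close>

lemma K1_rel_stable_mult: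
  fixes u v u' v' :: "'a::complex_banach_algebra mat"
  assumes u: "(u, u') \<in> K1_rel" and v: "(v, v') \<in> K1_rel"
  shows "(stable_mult u v, stable_mult u' v') \<in> K1_rel"
proof -
  obtain n n' k where 1: "u \<in> GL n" "u' \<in> GL n'" "n \<le> k" "n' \<le> k"
    "\<And>l. k \<le> l \<Longrightarrow> path_component_of (GL_topology l) (stabilize l u) (stabilize l u')"
    by (rule K1_relE[OF u]) blast
  obtain m m' r where 2: "v \<in> GL m" "v' \<in> GL m'" "m \<le> r" "m' \<le> r"
    "\<And>l. r \<le> l \<Longrightarrow> path_component_of (GL_topology l) (stabilize l v) (stabilize l v')"
    by (rule K1_relE[OF v]) blast
  let ?l = "max k r"
  have le: "max n m \<le> ?l" "max n' m' \<le> ?l" using 1(1-4) 2(1-4) by auto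
  show ?thesis
    by (rule K1_relI[OF stable_mult_GL[OF 1(1) 2(1)] stable_mult_GL[OF 1(2) 2(2)] le])
      (simp add: stabilize_stable_mult[OF 1(1) 2(1) le(1)] stabilize_stable_mult[OF 1(2) 2(2) le(2)]
        path_mult 1(5) 2(5))
qed

lemma K1_class_eq_iff:
  assumes "u \<in> (\<Union>n. GL n)" "v \<in> (\<Union>n. GL n)"
  shows "K1_rel `` {u} = K1_rel `` {v} \<longleftrightarrow> (u, v) \<in> K1_rel"
  using eq_equiv_class_iff[OF equiv_K1_rel assms] .

lemma K1_mult_class:
  fixes u v :: "'a::complex_banach_algebra mat"
  assumes "u \<in> (\<Union>n. GL n)" "v \<in> (\<Union>n. GL n)"
  shows "(K1_rel `` {u}) \<otimes>\<^bsub>K1 TYPE('a)\<^esub> (K1_rel `` {v}) = K1_rel `` {stable_mult u v}"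
proof -
  have "(\<lambda>u v :: 'a mat. K1_rel `` {stable_mult u v}) respects2 K1_rel"
    by (rule congruent2I', rule equiv_class_eq[OF equiv_K1_rel], rule K1_rel_stable_mult)
  from UN_equiv_class2[OF equiv_K1_rel equiv_K1_rel this assms]
  show ?thesis by (simp add: K1_def)
qed

lemma carrier_K1: "carrier (K1 TYPE('a::complex_banach_algebra)) = {K1_rel `` {u :: 'a mat} | u. u \<in> (\<Union>n. GL n)}"
  by (auto simp: K1_def quotient_def)

lemma stable_mult_in: "u \<in> (\<Union>n. GL n) \<Longrightarrow> v \<in> (\<Union>n. GL n) \<Longrightarrow> stable_mult u v \<in> (\<Union>n. GL n)"
  using stable_mult_GL by blast

section \<open>The induced map on classes of invertible matrices\<close>

context algebra_morphism
begin

lemma \<phi>m_GLs: "u \<in> (\<Union>n. GL n) \<Longrightarrow> \<phi>m u \<in> (\<Union>n. GL n)"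
  using \<phi>m_GL by blast

lemma \<phi>m_stabilize: "\<phi>m (stabilize k u) = stabilize k (\<phi>m u)"
  by (simp add: stabilize_def \<phi>m_block_sum \<phi>m_one)

lemma \<phi>m_stable_mult:
  assumes "u \<in> (\<Union>n. GL n)" "v \<in> (\<Union>n. GL n)"
  shows "\<phi>m (stable_mult u v) = stable_mult (\<phi>m u) (\<phi>m v)"
proof -
  obtain n m where u: "u \<in> GL n" and v: "v \<in> GL m" using assms by blast
  have "stabilize (max n m) u \<in> carrier_mat (max n m) (max n m)" "stabilize (max n m) v \<in> carrier_mat (max n m) (max n m)"
    using u v by (auto intro: stabilize_carrier GL_carrier)
  from \<phi>m_mult[OF this] show ?thesis
    by (simp add: stable_mult_def Let_def GL_dim[OF u] GL_dim[OF v] \<phi>m_stabilize)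
qed

lemma \<phi>m_path:
  assumes "path_component_of (GL_topology n) u v"
  shows "path_component_of (GL_topology n) (\<phi>m u) (\<phi>m v)"
proof -
  obtain g where g: "pathin (GL_topology n) g" "g 0 = u" "g 1 = v"
    using assms unfolding path_component_of_def by blast
  have "pathin (GL_topology n) (\<lambda>t. \<phi>m (g t))"
    unfolding pathin_GL_iff
  proof (intro conjI ballI allI impI)
    show "\<phi>m (g t) \<in> GL n" if "t \<in> {0..1}" for t
      using that g(1) unfolding pathin_GL_iff by (blast intro: \<phi>m_GL)
    fix i j assume ij: "i < n" "j < n"
    have "continuous_on {0..1} (\<lambda>t. \<phi> (g t $$ (i, j)))"
      using g(1) ij unfolding pathin_GL_iff by (intro continuous_on_compose2[OF \<phi>_cont[of UNIV]]) auto
    moreover have "\<phi> (g t $$ (i, j)) = \<phi>m (g t) $$ (i, j)" if "t \<in> {0..1}" for t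
    proof -
      have "g t \<in> carrier_mat n n" using that g(1) unfolding pathin_GL_iff by (blast intro: GL_carrier)
      then show ?thesis using ij by simp
    qed
    ultimately show "continuous_on {0..1} (\<lambda>t. \<phi>m (g t) $$ (i, j))" by (rule continuous_on_eq)
  qed
  then show ?thesis unfolding path_component_of_def using g by (intro exI[of _ "\<lambda>t. \<phi>m (g t)"]) simp
qed

lemma \<phi>m_K1_rel:
  assumes "(u, v) \<in> K1_rel"
  shows "(\<phi>m u, \<phi>m v) \<in> K1_rel"
proof -
  obtain n m k where 1: "u \<in> GL n" "v \<in> GL m" "n \<le> k" "m \<le> k"
    "\<And>l. k \<le> l \<Longrightarrow> path_component_of (GL_topology l) (stabilize l u) (stabilize l v)"
    by (rule K1_relE[OF assms]) blast
  have "path_component_of (GL_topology k) (stabilize k (\<phi>m u)) (stabilize k (\<phi>m v))"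
    using \<phi>m_path[OF 1(5)[OF order_refl]] by (simp only: \<phi>m_stabilize)
  then show ?thesis by (rule K1_relI[OF \<phi>m_GL[OF 1(1)] \<phi>m_GL[OF 1(2)] 1(3,4)])
qed

lemma K1_map_class:
  assumes "u \<in> (\<Union>n. GL n)"
  shows "K1_map \<phi> (K1_rel `` {u}) = K1_rel `` {\<phi>m u}"
proof -
  have "(\<lambda>u. K1_rel `` {\<phi>m u}) respects K1_rel"
    by (rule congruentI, rule equiv_class_eq[OF equiv_K1_rel], rule \<phi>m_K1_rel)
  from UN_equiv_class[OF equiv_K1_rel this assms] show ?thesis by (simp add: K1_map_def)
qed

end

context dense_crs_morphism
begin

lemma K1_rel_reflect:
  assumes u: "u \<in> (\<Union>n. GL n)" and v: "v \<in> (\<Union>n. GL n)" and rel: "(\<phi>m u, \<phi>m v) \<in> K1_rel"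
  shows "(u, v) \<in> K1_rel"
proof -
  obtain n m where n: "u \<in> GL n" and m: "v \<in> GL m" using u v by blast
  obtain n' m' k where 1: "\<phi>m u \<in> GL n'" "\<phi>m v \<in> GL m'" "n' \<le> k" "m' \<le> k"
    "\<And>l. k \<le> l \<Longrightarrow> path_component_of (GL_topology l) (stabilize l (\<phi>m u)) (stabilize l (\<phi>m v))"
    by (rule K1_relE[OF rel]) blast
  \<comment> \<open>The successor ensures size at least 1, as the spectral hypothesis requires, even
    if \<open>k = 0\<close>.\<close>
  have le: "n \<le> Suc k" "m \<le> Suc k"
    using 1(3,4) GL_dim(1)[OF n] GL_dim(1)[OF m] GL_dim(1)[OF 1(1)] GL_dim(1)[OF 1(2)] by auto
  have "path_component_of (GL_topology (Suc k)) (\<phi>m (stabilize (Suc k) u)) (\<phi>m (stabilize (Suc k) v))"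
    unfolding \<phi>m_stabilize by (rule 1(5)) simp
  then have "path_component_of (GL_topology (Suc k)) (stabilize (Suc k) u) (stabilize (Suc k) v)"
    by (intro GL_path_reflect stabilize_GL[OF n le(1)] stabilize_GL[OF m le(2)]) simp_all
  then show ?thesis by (rule K1_relI[OF n m le])
qed

lemma K1_rel_surj:
  assumes "v \<in> (\<Union>n. GL n)"
  obtains u where "u \<in> (\<Union>n. GL n)" "(\<phi>m u, v) \<in> K1_rel"
proof -
  obtain n where v: "v \<in> GL n" using assms by blast
  \<comment> \<open>Enlarging by one also covers the empty matrix, since lifting needs positive
    size.\<close>
  have "stabilize (Suc n) v \<in> GL (Suc n)" using v by (auto intro: stabilize_GL)
  then obtain u where u: "u \<in> GL (Suc n)" "path_component_of (GL_topology (Suc n)) (\<phi>m u) (stabilize (Suc n) v)"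
    using GL_lift[of "Suc n"] by auto
  have "stabilize (Suc n) (\<phi>m u) = \<phi>m u" using stabilize_self GL_carrier \<phi>m_GL[OF u(1)] by blast
  then have "(\<phi>m u, v) \<in> K1_rel"
    using u(2) by (intro K1_relI[OF \<phi>m_GL[OF u(1)] v order_refl]) simp_all
  then show ?thesis using u(1) by (intro that[of u]) auto
qed

lemma K1_map_iso: "K1_map \<phi> \<in> iso (K1 TYPE('a)) (K1 TYPE('b))"
proof (rule isoI)
  let ?A = "K1 TYPE('a)" and ?B = "K1 TYPE('b)"
  have into: "K1_map \<phi> P \<in> carrier ?B" if "P \<in> carrier ?A" for P
  proof -
    obtain u where u: "u \<in> (\<Union>n. GL n)" "P = K1_rel `` {u}" using \<open>P \<in> carrier ?A\<close> unfolding carrier_K1 by blast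
    show ?thesis unfolding u(2) K1_map_class[OF u(1)] carrier_K1 using \<phi>m_GLs[OF u(1)] by blast
  qed
  show "K1_map \<phi> \<in> hom ?A ?B"
  proof (rule homI[OF into])
    fix P Q assume "P \<in> carrier ?A" "Q \<in> carrier ?A"
    then obtain u v where u: "u \<in> (\<Union>n. GL n)" "P = K1_rel `` {u}" and v: "v \<in> (\<Union>n. GL n)" "Q = K1_rel `` {v}"
      unfolding carrier_K1 by blast
    show "K1_map \<phi> (P \<otimes>\<^bsub>?A\<^esub> Q) = K1_map \<phi> P \<otimes>\<^bsub>?B\<^esub> K1_map \<phi> Q"
      unfolding u(2) v(2) K1_mult_class[OF u(1) v(1)] K1_map_class[OF u(1)] K1_map_class[OF v(1)]
        K1_map_class[OF stable_mult_in[OF u(1) v(1)]] K1_mult_class[OF \<phi>m_GLs[OF u(1)] \<phi>m_GLs[OF v(1)]]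
        \<phi>m_stable_mult[OF u(1) v(1)] ..
  qed
  show "bij_betw (K1_map \<phi>) (carrier ?A) (carrier ?B)"
    unfolding bij_betw_def
  proof
    show "inj_on (K1_map \<phi>) (carrier ?A)"
    proof (rule inj_onI)
      fix P Q assume "P \<in> carrier ?A" "Q \<in> carrier ?A" and eq: "K1_map \<phi> P = K1_map \<phi> Q"
      then obtain u v where u: "u \<in> (\<Union>n. GL n)" "P = K1_rel `` {u}" and v: "v \<in> (\<Union>n. GL n)" "Q = K1_rel `` {v}"
        unfolding carrier_K1 by blast
      have "(\<phi>m u, \<phi>m v) \<in> K1_rel"
        using eq unfolding u(2) v(2) K1_map_class[OF u(1)] K1_map_class[OF v(1)]
          K1_class_eq_iff[OF \<phi>m_GLs[OF u(1)] \<phi>m_GLs[OF v(1)]] .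
      then show "P = Q"
        unfolding u(2) v(2) K1_class_eq_iff[OF u(1) v(1)] by (rule K1_rel_reflect[OF u(1) v(1)])
    qed
    show "K1_map \<phi> ` carrier ?A = carrier ?B"
    proof
      show "K1_map \<phi> ` carrier ?A \<subseteq> carrier ?B" using into by blast
      show "carrier ?B \<subseteq> K1_map \<phi> ` carrier ?A"
      proof
        fix Q assume "Q \<in> carrier ?B"
        then obtain v where v: "v \<in> (\<Union>n. GL n)" "Q = K1_rel `` {v}" unfolding carrier_K1 by blast
        obtain u where u: "u \<in> (\<Union>n. GL n)" "(\<phi>m u, v) \<in> K1_rel" by (rule K1_rel_surj[OF v(1)])
        have "Q = K1_map \<phi> (K1_rel `` {u})"
          unfolding v(2) K1_map_class[OF u(1)] using K1_class_eq_iff[OF \<phi>m_GLs[OF u(1)] v(1)] u(2) by simp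
        moreover have "K1_rel `` {u} \<in> carrier ?A" using u unfolding carrier_K1 by blast
        ultimately show "Q \<in> K1_map \<phi> ` carrier ?A" by blast
      qed
    qed
  qed
qed

end

theorem theorem1p2:
  fixes \<phi> :: "'a::complex_banach_algebra \<Rightarrow> 'b::complex_banach_algebra"
  assumes "morphism \<phi>"
    and "dense_morphism \<phi>"
    and "completely_relatively_spectral \<phi>"
  shows "K0_map \<phi> \<in> iso (K0 TYPE('a)) (K0 TYPE('b)) \<and>
         K1_map \<phi> \<in> iso (K1 TYPE('a)) (K1 TYPE('b))"
proof -
  interpret dense_crs_morphism \<phi> by unfold_locales (fact assms)+
  show ?thesis using K0_map_iso K1_map_iso by blast
qed

end
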